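(* Let $m,t,d$ be positive integers with $d>1$ and $t\mid m$, let $G=G(m,t,d)$, let $\theta$ be the associated basic polynomial map, and let $\rho\in\widehat G_1$. Every normal Hilbert module over $C(\partial\theta(\mathbb D^d))$ is a projective object in the category $\mathfrak N$ of normal Hilbert modules over $\mathcal A(\theta(\mathbb D^d))$.
   Context: $G(m,t,d)$ is the finite group of unitaries $(z_1,\dots,z_d)\mapsto(e^{2\pi i\nu_1/m}z_{\sigma(1)},\dots,e^{2\pi i\nu_d/m}z_{\sigma(d)})$, where $\sigma$ is a permutation of $\{1,\dots,d\}$ and $\nu_i$ are integers whose sum is divisible by $t$. Its basic polynomial map is $\theta=(\theta_1,\dots,\theta_d)$, $\theta_i(z)=E_i(z_1^m,\dots,z_d^m)$ for $1\le i\le d-1$ ($E_i$ the elementary symmetric polynomials) and $\theta_d(z)=(z_1\cdots z_d)^{m/t}$. $\mathcal A(\theta(\mathbb D^d))$ is the uniform algebra of functions holomorphic in $\theta(\mathbb D^d)$ and continuous on its closure; its Šilov boundary is $\partial\theta(\mathbb D^d)=\theta(\mathbb T^d)$. $\widehat G_1$ is the set of one-dimensional representations of $G$. For $\rho\in\widehat G_1$, $\ell_\rho$ is a homogeneous polynomial with $\ell_\rho\circ\sigma=\rho(\sigma)\ell_\rho$ for all $\sigma\in G$ such that every polynomial $f$ with $f\circ\sigma=\rho(\sigma)f$ for all $\sigma$ is $\ell_\rho$ times a $G$-invariant polynomial. The measure $\mu_{\rho,\theta}$ on $\partial\theta(\mathbb D^d)$ is given by $\int f\,d\mu_{\rho,\theta}=\frac1{|G|}\int_{\mathbb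 T^d}(f\circ\theta)|\ell_\rho|^2d\nu$, $\nu$ normalized Haar measure. A Hilbert module over a function algebra $\mathcal A$ is a Hilbert space $\mathcal H$ that is a module over $\mathcal A$ such that $(a,h)\mapsto a\cdot h$ is continuous; module maps are bounded linear maps commuting with the action. A Hilbert $\mathcal A(\theta(\mathbb D^d))$-module $\mathcal H$ is normal if for each $h\in\mathcal H$ the map $\mathcal A(\theta(\mathbb D^d))\ni f\mapsto f\cdot h\in\mathcal H$ is continuous from the weak$^*$ topology of $L^\infty(\partial\theta(\mathbb D^d),\mu_{\rho,\theta})$ restricted to $\mathcal A(\theta(\mathbb D^d))$ to the weak topology of $\mathcal H$. A normal Hilbert module over $C(\partial\theta(\mathbb D^d))$ means a Hilbert module over $C(\partial\theta(\mathbb D^d))$ which, regarded as a Hilbert module over $\mathcal A(\theta(\mathbb D^d))$ (by restricting functions to $\partial\theta(\mathbb D^d)$), is normal. The category $\mathfrak N$ has normal Hilbert $\mathcal A(\theta(\mathbb D^d))$-modules as objects and Hilbert module maps as morphisms; $\mathcal P$ in $\mathfrak N$ is projective if every short exact sequence $0\to\mathcal H\to\mathcal K\to\mathcal P\to0$ of module maps with $\mathcal H,\mathcal K$ in $\mathfrak N$ splits. *)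

theory Defs
  imports "HOL-Analysis.Analysis" "HOL-Algebra.Group"
begin

section \<open>Complex Hilbert spaces\<close>

text \<open>
  The norm is the one of \<^class>\<open>real_inner\<close>; since the underlying real inner product is the
  real part of \<open>cinner\<close>, it satisfies \<open>(norm x)\<^sup>2 = cinner x x\<close>, and positive definiteness
  is inherited.
\<close>

class complex_hilbert = real_inner + complete_space +
  fixes scaleC :: "complex \<Rightarrow> 'a \<Rightarrow> 'a"  (infixr "*\<^sub>C" 75)
    and cinner :: "'a \<Rightarrow> 'a \<Rightarrow> complex"
  assumes scaleC_add_right: "a *\<^sub>C (x + y) = a *\<^sub>C x + a *\<^sub>C y"
    and scaleC_add_left: "(a + b) *\<^sub>C x = a *\<^sub>C x + b *\<^sub>C x"
    and scaleC_scaleC: "a *\<^sub>C (b *\<^sub>C x) = (a * b) *\<^sub>C x"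
    and scaleC_of_real: "complex_of_real r *\<^sub>C x = r *\<^sub>R x"
    and cinner_commute: "cinner x y = cnj (cinner y x)"
    and cinner_add_left: "cinner (x + y) z = cinner x z + cinner y z"
    and cinner_scaleC_left: "cinner (a *\<^sub>C x) y = a * cinner x y"
    and Re_cinner: "Re (cinner x y) = inner x y"

definition bounded_clinear :: "('h::complex_hilbert \<Rightarrow> 'k::complex_hilbert) \<Rightarrow> bool" where
  "bounded_clinear T \<longleftrightarrow> bounded_linear T \<and> (\<forall>c x. T (c *\<^sub>C x) = c *\<^sub>C T x)"

text \<open>The coarsest topology on \<open>X\<close> making all maps in \<open>F\<close> continuous.\<close>

definition initial_topology :: "'a set \<Rightarrow> ('a \<Rightarrow> complex) set \<Rightarrow> 'a topology" where
  "initial_topology X F =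
     topology_generated_by {{x \<in> X. \<phi> x \<in> U} | \<phi> U. \<phi> \<in> F \<and> open U}"

definition weak_topology :: "'h::complex_hilbert topology" where
  "weak_topology = initial_topology UNIV {\<lambda>h. cinner h k | k. True}"


section \<open>Function algebras and Hilbert modules\<close>

text \<open>
  An algebra of complex functions on a set \<open>X\<close> is represented by a set \<open>A\<close> of total functions
  that vanish off \<open>X\<close>.  Thus equality in \<open>A\<close> is equality on \<open>X\<close>, the operations are the
  pointwise ones, and the unit is \<open>indicator X\<close>.
\<close>

definition sup_norm :: "'x set \<Rightarrow> ('x \<Rightarrow> complex) \<Rightarrow> real" where
  "sup_norm X f = (SUP x\<in>X. norm (f x))"

definition restrict_fun :: "'x set \<Rightarrow> ('x \<Rightarrow> complex) \<Rightarrow> 'x \<Rightarrow> complex" where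
  "restrict_fun Y f = (\<lambda>x. if x \<in> Y then f x else 0)"

definition cont_algebra :: "'x::topological_space set \<Rightarrow> ('x \<Rightarrow> complex) set" where
  "cont_algebra X = {f. continuous_on X f \<and> (\<forall>x. x \<notin> X \<longrightarrow> f x = 0)}"

definition is_boundary ::
  "'x::topological_space set \<Rightarrow> ('x \<Rightarrow> complex) set \<Rightarrow> 'x set \<Rightarrow> bool" where
  "is_boundary X A B \<longleftrightarrow>
     closed B \<and> B \<subseteq> X \<and> (\<forall>f\<in>A. \<exists>b\<in>B. \<forall>x\<in>X. norm (f x) \<le> norm (f b))"

text \<open>The intersection of all closed boundaries; for a uniform algebra on a compact set this is
  the smallest closed boundary.\<close>

definition shilov_boundary ::
  "'x::topological_space set \<Rightarrow> ('x \<Rightarrow> complex) set \<Rightarrow> 'x set" where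
  "shilov_boundary X A = \<Inter> {B. is_boundary X A B}"

text \<open>Modules are unital.  The last conjunct is joint continuity of the action at every point
  \<open>(f, h)\<close> of \<open>A \<times> 'h\<close>, with \<open>A\<close> carrying the supremum norm over \<open>X\<close>.\<close>

definition hilbert_module ::
  "'x set \<Rightarrow> ('x \<Rightarrow> complex) set \<Rightarrow> (('x \<Rightarrow> complex) \<Rightarrow> 'h \<Rightarrow> 'h::complex_hilbert) \<Rightarrow> bool" where
  "hilbert_module X A act \<longleftrightarrow>
     (\<forall>f\<in>A. \<forall>h k. act f (h + k) = act f h + act f k) \<and>
     (\<forall>f\<in>A. \<forall>g\<in>A. \<forall>h. act (\<lambda>x. f x + g x) h = act f h + act g h) \<and>
     (\<forall>f\<in>A. \<forall>g\<in>A. \<forall>h. act (\<lambda>x. f x * g x) h = act f (act g h)) \<and>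
     (\<forall>f\<in>A. \<forall>c h. act (\<lambda>x. c * f x) h = c *\<^sub>C act f h) \<and>
     (\<forall>f\<in>A. \<forall>c h. act f (c *\<^sub>C h) = c *\<^sub>C act f h) \<and>
     (\<forall>h. act (indicator X) h = h) \<and>
     (\<forall>f\<in>A. \<forall>h. \<forall>\<epsilon>>0. \<exists>\<delta>>0. \<forall>g\<in>A. \<forall>k.
        sup_norm X (\<lambda>x. g x - f x) < \<delta> \<and> norm (k - h) < \<delta> \<longrightarrow> norm (act g k - act f h) < \<epsilon>)"

definition module_map ::
  "('x \<Rightarrow> complex) set \<Rightarrow> (('x \<Rightarrow> complex) \<Rightarrow> 'h \<Rightarrow> 'h::complex_hilbert)
     \<Rightarrow> (('x \<Rightarrow> complex) \<Rightarrow> 'k \<Rightarrow> 'k::complex_hilbert) \<Rightarrow> ('h \<Rightarrow> 'k) \<Rightarrow> bool" where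
  "module_map A actH actK T \<longleftrightarrow>
     bounded_clinear T \<and> (\<forall>f\<in>A. \<forall>h. T (actH f h) = actK f (T h))"

text \<open>
  The topology induced on \<open>A\<close> by the weak-star topology of \<open>L\<^sup>\<infinity>(M)\<close>, the latter being
  regarded as the dual of \<open>L\<^sup>1(M)\<close>.
\<close>

definition weak_star_topology ::
  "'x measure \<Rightarrow> ('x \<Rightarrow> complex) set \<Rightarrow> ('x \<Rightarrow> complex) topology" where
  "weak_star_topology M A =
     initial_topology A {\<lambda>f. \<integral>x. f x * g x \<partial>M | g. integrable M g}"

definition normal_module ::
  "'x measure \<Rightarrow> 'x set \<Rightarrow> ('x \<Rightarrow> complex) set
     \<Rightarrow> (('x \<Rightarrow> complex) \<Rightarrow> 'h \<Rightarrow> 'h::complex_hilbert) \<Rightarrow> bool" where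
  "normal_module M X A act \<longleftrightarrow>
     hilbert_module X A act \<and>
     (\<forall>h. continuous_map (weak_star_topology M A) weak_topology (\<lambda>f. act f h))"

definition short_exact ::
  "('h::complex_hilbert \<Rightarrow> 'k::complex_hilbert) \<Rightarrow> ('k \<Rightarrow> 'p::complex_hilbert) \<Rightarrow> bool" where
  "short_exact \<alpha> \<beta> \<longleftrightarrow> inj \<alpha> \<and> range \<alpha> = {k. \<beta> k = 0} \<and> surj \<beta>"

text \<open>
  Projectivity of a normal module \<open>P\<close> in the category of normal modules.  HOL cannot quantify
  over types inside a formula, so the Hilbert spaces underlying the first two terms of the
  sequences are passed as type arguments; a theorem about arbitrary \<open>'h\<close> and \<open>'k\<close>
  covers all short exact sequences.
\<close>

definition projective_normal_module ::
  "'h::complex_hilbert itself \<Rightarrow> 'k::complex_hilbert itself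
     \<Rightarrow> 'x measure \<Rightarrow> 'x set \<Rightarrow> ('x \<Rightarrow> complex) set
     \<Rightarrow> (('x \<Rightarrow> complex) \<Rightarrow> 'p \<Rightarrow> 'p::complex_hilbert) \<Rightarrow> bool" where
  "projective_normal_module _ _ M X A actP \<longleftrightarrow>
     normal_module M X A actP \<and>
     (\<forall>(actH :: ('x \<Rightarrow> complex) \<Rightarrow> 'h \<Rightarrow> 'h::complex_hilbert)
       (actK :: ('x \<Rightarrow> complex) \<Rightarrow> 'k \<Rightarrow> 'k::complex_hilbert) \<alpha> \<beta>.
        normal_module M X A actH \<and> normal_module M X A actK \<and>
        module_map A actH actK \<alpha> \<and> module_map A actK actP \<beta> \<and> short_exact \<alpha> \<beta> \<longrightarrow>
        (\<exists>\<gamma>. module_map A actP actK \<gamma> \<and> (\<forall>p. \<beta> (\<gamma> p) = p)))"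


section \<open>Polynomials and holomorphic functions in several variables\<close>

type_synonym 'n cspace = "(complex, 'n) vec"

definition monomial :: "('n::finite \<Rightarrow> nat) \<Rightarrow> 'n cspace \<Rightarrow> complex" where
  "monomial a z = (\<Prod>i\<in>UNIV. (z $ i) ^ a i)"

text \<open>Polynomials over the infinite field of complex numbers are identified with the functions
  they define.\<close>

definition is_polynomial :: "(('n::finite) cspace \<Rightarrow> complex) \<Rightarrow> bool" where
  "is_polynomial f \<longleftrightarrow> (\<exists>S c. finite S \<and> f = (\<lambda>z. \<Sum>a\<in>S. c a * monomial a z))"

definition is_homogeneous_polynomial :: "(('n::finite) cspace \<Rightarrow> complex) \<Rightarrow> bool" where
  "is_homogeneous_polynomial f \<longleftrightarrow>
     (\<exists>k S c. finite S \<and> (\<forall>a\<in>S. (\<Sum>i\<in>UNIV. a i) = k) \<and>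
        f = (\<lambda>z. \<Sum>a\<in>S. c a * monomial a z))"

definition elem_sym :: "nat \<Rightarrow> ('n::finite) cspace \<Rightarrow> complex" where
  "elem_sym k w = (\<Sum>S | S \<subseteq> UNIV \<and> card S = k. \<Prod>i\<in>S. w $ i)"

text \<open>Holomorphic: complex (Frechet) differentiable at every point of the open set \<open>W\<close>.\<close>

definition holomorphic_several ::
  "(('n::finite) cspace \<Rightarrow> complex) \<Rightarrow> 'n cspace set \<Rightarrow> bool" where
  "holomorphic_several f W \<longleftrightarrow>
     (\<forall>z\<in>W. \<exists>f'. (f has_derivative f') (at z within W) \<and> (\<forall>c v. f' (c *s v) = c * f' v))"

definition polydisc :: "('n::finite) cspace set" where
  "polydisc = {z. \<forall>i. norm (z $ i) < 1}"

text \<open>Normalized Haar measure of the torus \<open>{z. \<forall>i. norm (z $ i) = 1}\<close>, as a Borel measure on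
  the ambient space: the image of Lebesgue measure on the unit cube under
  \<open>x \<mapsto> (exp (2 \<pi> \<i> x\<^sub>1), \<dots>, exp (2 \<pi> \<i> x\<^sub>d))\<close>.\<close>

definition torus_haar :: "('n::finite) cspace measure" where
  "torus_haar =
     distr (uniform_measure lborel (cbox 0 1)) borel
       (\<lambda>x::real ^ 'n::finite. \<chi> i. cis (2 * pi * (x $ i)))"


section \<open>The groups \<open>G(m,t,d)\<close>\<close>

text \<open>Here \<open>d = CARD('n)\<close>.\<close>

definition G_maps :: "nat \<Rightarrow> nat \<Rightarrow> (('n::finite) cspace \<Rightarrow> 'n cspace) set" where
  "G_maps m t =
     {\<lambda>z. \<chi> i. cis (2 * pi * of_int (\<nu> i) / of_nat m) * z $ \<sigma> i
       | (\<nu> :: 'n::finite \<Rightarrow> int) (\<sigma> :: 'n \<Rightarrow> 'n). bij \<sigma> \<and> int t dvd (\<Sum>i\<in>UNIV. \<nu> i)}"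

definition G_group :: "nat \<Rightarrow> nat \<Rightarrow> (('n::finite) cspace \<Rightarrow> 'n cspace) monoid" where
  "G_group m t = \<lparr>carrier = G_maps m t, mult = (\<circ>), one = id\<rparr>"

text \<open>One-dimensional representations are homomorphisms into the multiplicative group of
  nonzero complex numbers.\<close>

definition complex_units :: "complex monoid" where
  "complex_units = \<lparr>carrier = UNIV - {0}, mult = (*), one = 1\<rparr>"

definition one_dim_reps ::
  "nat \<Rightarrow> nat \<Rightarrow> ((('n::finite) cspace \<Rightarrow> 'n cspace) \<Rightarrow> complex) set" where
  "one_dim_reps m t = hom (G_group m t) complex_units"

text \<open>The linear order on the index type serves only to number the coordinates \<open>1, \<dots>, d\<close>.\<close>

definition coord_index :: "'n::{finite,linorder} \<Rightarrow> nat" where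
  "coord_index i = card {j. j \<le> i}"

definition theta :: "nat \<Rightarrow> nat \<Rightarrow> ('n::{finite,linorder}) cspace \<Rightarrow> 'n cspace" where
  "theta m t z =
     (\<chi> i. if coord_index i < CARD('n)
           then elem_sym (coord_index i) (\<chi> j. (z $ j) ^ m)
           else (\<Prod>j\<in>UNIV. z $ j) ^ (m div t))"

definition theta_domain :: "nat \<Rightarrow> nat \<Rightarrow> ('n::{finite,linorder}) cspace set" where
  "theta_domain m t = theta m t ` polydisc"

definition theta_algebra ::
  "nat \<Rightarrow> nat \<Rightarrow> (('n::{finite,linorder}) cspace \<Rightarrow> complex) set" where
  "theta_algebra m t =
     {f \<in> cont_algebra (closure (theta_domain m t)). holomorphic_several f (theta_domain m t)}"

definition theta_boundary :: "nat \<Rightarrow> nat \<Rightarrow> ('n::{finite,linorder}) cspace set" where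
  "theta_boundary m t = shilov_boundary (closure (theta_domain m t)) (theta_algebra m t)"

text \<open>The polynomials that qualify as \<open>\<ell>\<^sub>\<rho>\<close>; they differ by nonzero constant factors.\<close>

definition is_ell ::
  "nat \<Rightarrow> nat \<Rightarrow> ((('n::finite) cspace \<Rightarrow> 'n cspace) \<Rightarrow> complex)
     \<Rightarrow> ('n cspace \<Rightarrow> complex) \<Rightarrow> bool" where
  "is_ell m t \<rho> l \<longleftrightarrow>
     is_homogeneous_polynomial l \<and>
     (\<forall>g\<in>G_maps m t. \<forall>z. l (g z) = \<rho> g * l z) \<and>
     (\<forall>f. is_polynomial f \<and> (\<forall>g\<in>G_maps m t. \<forall>z. f (g z) = \<rho> g * f z) \<longrightarrow>
        (\<exists>q. is_polynomial q \<and> (\<forall>g\<in>G_maps m t. \<forall>z. q (g z) = q z) \<and>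
             f = (\<lambda>z. l z * q z)))"

text \<open>The measure is taken as a Borel measure on the ambient space; it is concentrated on
  the image of the torus, that is, on \<open>theta_boundary m t\<close>.\<close>

definition theta_measure ::
  "nat \<Rightarrow> nat \<Rightarrow> (('n::{finite,linorder}) cspace \<Rightarrow> complex) \<Rightarrow> 'n cspace measure" where
  "theta_measure m t l =
     distr
       (density torus_haar
          (\<lambda>z. ennreal ((norm (l z))\<^sup>2 /
              card (G_maps m t :: (('n::{finite,linorder}) cspace \<Rightarrow> 'n cspace) set))))
       borel (theta m t)"

abbreviation normal_theta_module ::
  "nat \<Rightarrow> nat \<Rightarrow> (('n::{finite,linorder}) cspace \<Rightarrow> complex)
     \<Rightarrow> (('n cspace \<Rightarrow> complex) \<Rightarrow> 'h \<Rightarrow> 'h::complex_hilbert) \<Rightarrow> bool" where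
  "normal_theta_module m t l act \<equiv>
     normal_module (theta_measure m t l) (closure (theta_domain m t)) (theta_algebra m t) act"

definition restricted_action ::
  "'x set \<Rightarrow> (('x \<Rightarrow> complex) \<Rightarrow> 'h \<Rightarrow> 'h) \<Rightarrow> ('x \<Rightarrow> complex) \<Rightarrow> 'h \<Rightarrow> 'h" where
  "restricted_action B act = (\<lambda>f. act (restrict_fun B f))"

definition normal_boundary_module ::
  "nat \<Rightarrow> nat \<Rightarrow> (('n::{finite,linorder}) cspace \<Rightarrow> complex)
     \<Rightarrow> (('n cspace \<Rightarrow> complex) \<Rightarrow> 'h \<Rightarrow> 'h::complex_hilbert) \<Rightarrow> bool" where
  "normal_boundary_module m t l act \<longleftrightarrow>
     hilbert_module (theta_boundary m t) (cont_algebra (theta_boundary m t)) act \<and>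
     normal_theta_module m t l (restricted_action (theta_boundary m t) act)"

end

theory Submission
  imports Defs "HOL-Complex_Analysis.Complex_Analysis"
    "HOL-Computational_Algebra.Fundamental_Theorem_Algebra"
begin

text \<open>
  Write \<open>X\<close> for the closure of \<open>\<theta>(\<^bold>D\<^sup>d)\<close>, \<open>A\<close> for the algebra of the theorem, and let \<open>\<beta>: K \<rightarrow> P\<close> be
  a surjective module map onto the module \<open>P\<close> over the continuous functions on the boundary.  Call
  \<open>f \<in> A\<close> \<^emph>\<open>inner\<close> if \<open>\<bar>f\<bar> = 1\<close> on \<open>\<theta>(\<^bold>T\<^sup>d)\<close>.  By the maximum principle \<open>\<theta>(\<^bold>T\<^sup>d)\<close> is a closed
  boundary, so it contains the Shilov boundary (\<open>theta_boundary_subset\<close>).  Hence an inner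
  function \<open>f\<close> acts on \<open>P\<close> as an invertible operator whose inverse is the action of the conjugate
  of \<open>f\<close>, and both \<open>f\<close> on \<open>K\<close> and the conjugate on \<open>P\<close> act with norms bounded independently of \<open>f\<close>.

  The inner functions form a commutative semigroup.  A bounded linear section \<open>s\<close> of \<open>\<beta>\<close> exists
  because the adjoint of \<open>\<beta>\<close> is bounded below.  The maps \<open>s \<mapsto> f s f\<^bsup>-1\<^esup>\<close>, with \<open>f\<close> inner, commute and
  preserve a convex set of sections that is compact for the weak operator topology, so a fixed
  point theorem of Markov-Kakutani type yields a section \<open>\<gamma>\<close> that commutes with all inner functions
  (\<open>intertwining_section\<close>).  In effect this is averaging over an amenable semigroup.

  It remains to pass from inner functions to all of \<open>A\<close>.  The functions of \<open>A\<close> that \<open>\<gamma>\<close> intertwines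
  form a norm closed subalgebra.  The last coordinate \<open>w\<^sub>d\<close> is inner.  For \<open>i < d\<close> one has, on
  \<open>\<theta>(\<^bold>T\<^sup>d)\<close>, the reflection identity that the conjugate of \<open>w\<^sub>i\<close> times \<open>M = w\<^sub>d\<^sup>t\<close> is \<open>w\<^bsub>d-i\<^esub>\<close>;
  therefore \<open>(\<epsilon> w\<^sub>i + c M) / (1 + c \<epsilon> w\<^bsub>d-i\<^esub>)\<close> is inner whenever \<open>\<bar>c\<bar> = 1\<close> and \<open>\<epsilon>\<close> is small, and its
  derivative in \<open>\<epsilon>\<close> at \<open>0\<close> is \<open>w\<^sub>i - c\<^sup>2 M w\<^bsub>d-i\<^esub>\<close>.  Adding the cases \<open>c = 1\<close> and \<open>c = \<i>\<close> isolates \<open>w\<^sub>i\<close>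
  (\<open>intertwined_coord_difference\<close>, \<open>intertwined_coord\<close>).  So \<open>\<gamma>\<close> intertwines all polynomials in
  the coordinates \<open>w\<close>, and these are norm dense in \<open>A\<close> (\<open>poly_fun_dense\<close>).

  For the density, \<open>\<theta>(c z)\<close> is obtained from \<open>\<theta>(z)\<close> by multiplying each coordinate by a positive
  power of \<open>c\<close>.  Along such a weighted disc, \<open>f\<close> becomes a function of \<open>c\<close>, and \<open>f\<close> is uniformly
  close to a section of its Taylor series at \<open>c = r < 1\<close>.  The Taylor coefficients are determined
  by \<open>f\<close> near the origin, which is an interior point of \<open>\<theta>(\<^bold>D\<^sup>d)\<close>, and there \<open>f\<close> is a uniform
  limit of polynomials; the weighted homogeneous components of a polynomial are again polynomials.
\<close>

(* The symbol denotes components of vectors throughout. *)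
no_notation fps_nth (infixl "$" 75)

section \<open>Bounded sections of surjections between Hilbert spaces\<close>

text \<open>
  A form of the Lax-Milgram lemma: the functional \<open>\<parallel>A x\<parallel>\<^sup>2 - 2 \<phi> x\<close> is bounded below and, by the
  parallelogram law, its minimizing sequences are Cauchy; the equation says that the derivative
  vanishes at the minimizer.  With \<open>A\<close> the identity this is the Riesz representation theorem.
\<close>

lemma coercive_riesz:
  fixes A :: "'a::{real_inner,complete_space} \<Rightarrow> 'b::real_inner" and \<phi> :: "'a \<Rightarrow> real"
  assumes A: "bounded_linear A" and c: "c > 0" and coercive: "\<And>x. c * norm x \<le> norm (A x)"
    and \<phi>: "bounded_linear \<phi>"
  obtains x where "\<And>y. inner (A x) (A y) = \<phi> y"
proof -
  interpret A: bounded_linear A by fact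
  interpret \<phi>: bounded_linear \<phi> by fact
  define q where "q x = (norm (A x))\<^sup>2 - 2 * \<phi> x" for x
  obtain M where M: "\<And>x. norm (\<phi> x) \<le> norm x * M" and "M > 0"
    using \<phi>.pos_bounded by blast
  have low: "- (M\<^sup>2 / c\<^sup>2) \<le> q x" for x
  proof -
    have "\<phi> x \<le> norm x * M" using M[of x] by simp
    moreover have "(c * norm x)\<^sup>2 \<le> (norm (A x))\<^sup>2"
      using coercive[of x] c by (intro power_mono) auto
    moreover have "0 \<le> (c * norm x - M / c)\<^sup>2" by simp
    moreover have "(c * norm x - M / c)\<^sup>2 = (c * norm x)\<^sup>2 - 2 * (norm x * M) + M\<^sup>2 / c\<^sup>2"
      using c by (simp add: power2_diff power_divide)
    ultimately show ?thesis unfolding q_def by linarith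
  qed
  define I where "I = Inf (range q)"
  have bdd: "bdd_below (range q)" using low by (intro bdd_belowI) auto
  have Ile: "I \<le> q x" for x unfolding I_def using bdd by (intro cInf_lower) auto
  have "\<exists>x. q x < I + 1 / real (Suc n)" for n
    using cInf_lessD[of "range q" "I + 1 / real (Suc n)"] unfolding I_def by auto
  then obtain X where X: "\<And>n. q (X n) < I + 1 / real (Suc n)" by metis
  have par: "(norm (A (x - y)))\<^sup>2 / 2 \<le> q x + q y - 2 * I" for x y
  proof -
    have "q x + q y - 2 * q ((1/2) *\<^sub>R (x + y)) = (norm (A (x - y)))\<^sup>2 / 2"
      unfolding q_def A.scaleR \<phi>.scaleR A.add A.diff \<phi>.add power2_norm_eq_inner
      by (simp add: inner_add inner_diff inner_commute algebra_simps)
    then show ?thesis using Ile[of "(1/2) *\<^sub>R (x + y)"] by linarith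
  qed
  have "Cauchy X"
  proof (rule CauchyI)
    fix e :: real assume "e > 0"
    define \<eta> where "\<eta> = (c * e)\<^sup>2 / 4"
    have "\<eta> > 0" using \<open>e > 0\<close> c by (simp add: \<eta>_def)
    then obtain N where N: "N \<noteq> 0" "1 / real N < \<eta>"
      using real_arch_inverse[of \<eta>] by (auto simp: inverse_eq_divide)
    have small: "1 / real (Suc n) < \<eta>" if "n \<ge> N" for n
    proof -
      have "1 / real (Suc n) \<le> 1 / real N" using that N by (intro divide_left_mono) auto
      then show ?thesis using N by linarith
    qed
    show "\<exists>N. \<forall>m\<ge>N. \<forall>n\<ge>N. norm (X m - X n) < e"
    proof (intro exI allI impI)
      fix m n assume "m \<ge> N" "n \<ge> N"
      then have "(norm (A (X m - X n)))\<^sup>2 / 2 < 2 * \<eta>"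
        using par[of "X m" "X n"] X[of m] X[of n] small[of m] small[of n] by linarith
      then have "(norm (A (X m - X n)))\<^sup>2 < (c * e)\<^sup>2" by (simp add: \<eta>_def)
      then have "norm (A (X m - X n)) < c * e"
        using power_less_imp_less_base c \<open>e > 0\<close> by (metis less_eq_real_def mult_pos_pos)
      then show "norm (X m - X n) < e"
        using coercive[of "X m - X n"] c by (smt (verit) mult_le_cancel_left_pos)
    qed
  qed
  then obtain x where x: "X \<longlonglongrightarrow> x" using Cauchy_convergent_iff convergent_def by blast
  have "(\<lambda>n. q (X n)) \<longlonglongrightarrow> q x"
    unfolding q_def by (intro tendsto_intros A.tendsto \<phi>.tendsto x)
  moreover have "(\<lambda>n. I + 1 / real (Suc n)) \<longlonglongrightarrow> I + 0"
    by (intro tendsto_intros LIMSEQ_Suc[OF lim_1_over_n])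
  ultimately have qx: "q x \<le> I"
    using X by (intro LIMSEQ_le[of "\<lambda>n. q (X n)" _ "\<lambda>n. I + 1 / real (Suc n)"]) (auto intro: less_imp_le)
  have "inner (A x) (A y) = \<phi> y" for y
  proof (rule ccontr)
    assume ne: "inner (A x) (A y) \<noteq> \<phi> y"
    define a where "a = inner (A x) (A y) - \<phi> y"
    define b where "b = (norm (A y))\<^sup>2 + 1"
    have "a \<noteq> 0" using ne by (simp add: a_def)
    have "b > 0" by (simp add: b_def add_nonneg_pos)
    have expand: "q (x + s *\<^sub>R y) = q x + 2 * s * a + s\<^sup>2 * (norm (A y))\<^sup>2" for s
      unfolding q_def a_def A.add A.scaleR \<phi>.add \<phi>.scaleR power2_norm_eq_inner
      by (simp add: inner_add inner_commute algebra_simps power2_eq_square)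
    \<comment> \<open>The step that minimizes the quadratic upper bound \<open>2 s a + s\<^sup>2 b\<close>; adding \<open>1\<close> in \<open>b\<close> avoids
      a division by zero.\<close>
    define s where "s = - a / b"
    have "0 \<le> 2 * s * a + s\<^sup>2 * (norm (A y))\<^sup>2"
      using Ile[of "x + s *\<^sub>R y"] qx expand[of s] by linarith
    also have "\<dots> \<le> 2 * s * a + s\<^sup>2 * b"
      unfolding b_def by (intro add_left_mono mult_left_mono) auto
    also have "\<dots> = - (a\<^sup>2 / b)"
      using \<open>b > 0\<close> by (simp add: s_def field_simps power2_eq_square)
    also have "\<dots> < 0" using \<open>a \<noteq> 0\<close> \<open>b > 0\<close> by simp
    finally show False by simp
  qed
  then show thesis by (rule that)
qed

lemma adjoint_hilbert:
  fixes A :: "'a::{real_inner,complete_space} \<Rightarrow> 'b::real_inner"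
  assumes "bounded_linear A"
  shows "inner (A x) y = inner x (adjoint A y)" and "bounded_linear (adjoint A)"
proof -
  interpret A: bounded_linear A by fact
  have "\<exists>z. \<forall>x. inner (A x) y = inner x z" for y
  proof -
    have "bounded_linear (\<lambda>x. inner (A x) y)"
      by (rule bounded_linear_inner_left_comp[OF assms])
    then obtain z where "\<And>x. inner (id z) (id x) = inner (A x) y"
      using coercive_riesz[of "id" 1 "\<lambda>x. inner (A x) y"]
      by (auto simp: id_def bounded_linear_ident)
    then have "\<forall>x. inner (A x) y = inner x z" by (simp add: inner_commute)
    then show ?thesis by blast
  qed
  then obtain f where f: "\<forall>x y. inner (A x) y = inner x (f y)" by metis
  then have eq: "adjoint A = f" by (rule adjoint_unique)
  show adj: "inner (A x) y = inner x (adjoint A y)" for x y using f eq by simp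
  obtain K where K: "\<And>x. norm (A x) \<le> norm x * K" "K > 0" using A.pos_bounded by blast
  show "bounded_linear (adjoint A)"
  proof (rule bounded_linear_intro[where K = K])
    fix y y' and r :: real
    have "inner x (adjoint A (y + y') - (adjoint A y + adjoint A y')) = 0" for x
      by (simp add: inner_diff_right inner_add_right flip: adj)
    then show "adjoint A (y + y') = adjoint A y + adjoint A y'"
      by (metis inner_eq_zero_iff right_minus_eq)
    have "inner x (adjoint A (r *\<^sub>R y) - r *\<^sub>R adjoint A y) = 0" for x
      by (simp add: inner_diff_right flip: adj)
    then show "adjoint A (r *\<^sub>R y) = r *\<^sub>R adjoint A y"
      by (metis inner_eq_zero_iff right_minus_eq)
    have "norm (adjoint A y) * norm (adjoint A y) = inner (A (adjoint A y)) y"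
      by (simp add: adj norm_eq_sqrt_inner)
    also have "\<dots> \<le> norm (A (adjoint A y)) * norm y" by (rule norm_cauchy_schwarz)
    also have "\<dots> \<le> (norm (adjoint A y) * K) * norm y"
      by (intro mult_right_mono K) auto
    finally have "norm (adjoint A y) * norm (adjoint A y) \<le> norm (adjoint A y) * (norm y * K)"
      by (simp add: algebra_simps)
    then show "norm (adjoint A y) \<le> norm y * K"
      using K(2) by (cases "adjoint A y = 0") auto
  qed
qed

text \<open>
  Uniform boundedness: for \<open>p\<close> with \<open>\<parallel>\<beta>\<^sup>* p\<parallel> \<le> 1\<close> the functionals \<open>\<langle>\<cdot>, p\<rangle>\<close> are pointwise bounded,
  because \<open>\<langle>\<beta> k, p\<rangle> = \<langle>k, \<beta>\<^sup>* p\<rangle>\<close> and every vector is some \<open>\<beta> k\<close>.  By the Baire category theorem they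
  are bounded on a ball, which bounds the norms of such \<open>p\<close>.
\<close>

lemma adjoint_surjective_bounded_below:
  fixes \<beta> :: "'k::{real_inner,complete_space} \<Rightarrow> 'p::{real_inner,complete_space}"
  assumes \<beta>: "bounded_linear \<beta>" and surj: "surj \<beta>"
  obtains c where "c > 0" "\<And>p. c * norm p \<le> norm (adjoint \<beta> p)"
proof -
  interpret adj: bounded_linear "adjoint \<beta>" by (rule adjoint_hilbert(2)[OF \<beta>])
  define Q where "Q = {p. norm (adjoint \<beta> p) \<le> 1}"
  define F where "F n = {q. \<forall>p\<in>Q. \<bar>inner q p\<bar> \<le> real n}" for n :: nat
  have closed: "closed (F n)" for n
  proof -
    have "F n = (\<Inter>p\<in>Q. {q. \<bar>inner q p\<bar> \<le> real n})" by (auto simp: F_def)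
    moreover have "closed {q. \<bar>inner q p\<bar> \<le> real n}" for p
      by (intro closed_Collect_le continuous_intros)
    ultimately show ?thesis by auto
  qed
  have cover: "(\<Union>n. F n) = UNIV"
  proof -
    have "\<exists>n. q \<in> F n" for q
    proof -
      obtain k where k: "q = \<beta> k" using surj by (metis surjE)
      have "\<bar>inner q p\<bar> \<le> norm k" if "p \<in> Q" for p
      proof -
        have "\<bar>inner q p\<bar> \<le> norm k * norm (adjoint \<beta> p)"
          unfolding k adjoint_hilbert(1)[OF \<beta>] by (rule Cauchy_Schwarz_ineq2)
        also have "\<dots> \<le> norm k * 1" using that by (intro mult_left_mono) (auto simp: Q_def)
        finally show ?thesis by simp
      qed
      moreover obtain n where "norm k \<le> real n" using real_arch_simple by blast
      ultimately have "q \<in> F n" unfolding F_def by (auto intro: order_trans)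
      then show ?thesis by blast
    qed
    then show ?thesis by auto
  qed
  have "\<exists>n. interior (F n) \<noteq> {}"
  proof (rule ccontr)
    assume "\<nexists>n. interior (F n) \<noteq> {}"
    then have "euclidean interior_of (\<Union>(range F)) = {}"
      using closed
      by (intro Baire_category_alt)
         (auto simp: completely_metrizable_space_euclidean euclidean_interior_of)
    then show False using cover by (simp add: euclidean_interior_of)
  qed
  then obtain n q0 where "q0 \<in> interior (F n)" by auto
  then obtain r where r: "r > 0" "cball q0 r \<subseteq> F n" by (meson mem_interior_cball)
  have bnd: "r * norm p \<le> 2 * real n" if "p \<in> Q" for p
  proof (cases "p = 0")
    case False
    define u where "u = (r / norm p) *\<^sub>R p"
    have "norm u = r" using r False by (simp add: u_def)
    then have "q0 + u \<in> F n" "q0 \<in> F n" using r by (auto simp: dist_norm)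
    then have "\<bar>inner (q0 + u) p\<bar> \<le> real n" "\<bar>inner q0 p\<bar> \<le> real n" using that by (auto simp: F_def)
    then have "inner u p \<le> 2 * real n" by (simp add: inner_add_left)
    moreover have "inner u p = r * norm p"
      using False by (simp add: u_def flip: power2_norm_eq_inner) (simp add: power2_eq_square)
    ultimately show ?thesis by simp
  qed simp
  define c where "c = r / (2 * real n + 1)"
  have "c > 0" using r by (simp add: c_def)
  moreover have "c * norm p \<le> norm (adjoint \<beta> p)" for p
  proof -
    have main: "norm p * r \<le> a * (2 * real n + 1)" if a: "a > 0" "norm (adjoint \<beta> p) \<le> a" for a
    proof -
      have "(1 / a) *\<^sub>R p \<in> Q" using a by (simp add: Q_def adj.scaleR)
      then have "r * (norm p / a) \<le> 2 * real n" using bnd[of "(1 / a) *\<^sub>R p"] a by simp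
      then have "r * norm p \<le> (2 * real n) * a" using a by (simp add: field_simps)
      then show ?thesis using a by (simp add: algebra_simps)
    qed
    have "norm p * r / (2 * real n + 1) \<le> norm (adjoint \<beta> p)"
    proof (rule dense_ge)
      fix a assume "norm (adjoint \<beta> p) < a"
      moreover from this have "a > 0" by (meson norm_ge_zero order_le_less_trans)
      ultimately show "norm p * r / (2 * real n + 1) \<le> a"
        using main[of a] by (simp add: divide_le_eq)
    qed
    then show ?thesis by (simp add: c_def mult.commute)
  qed
  ultimately show thesis by (rule that)
qed

text \<open>
  The section is \<open>\<beta>\<^sup>* (\<beta> \<beta>\<^sup>*)\<^bsup>-1\<^esup>\<close>; the inverse exists because \<open>\<beta>\<^sup>*\<close> is bounded below.
\<close>

lemma surjective_bounded_section:
  fixes \<beta> :: "'k::{real_inner,complete_space} \<Rightarrow> 'p::{real_inner,complete_space}"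
  assumes \<beta>: "bounded_linear \<beta>" and surj: "surj \<beta>"
  obtains s where "bounded_linear s" "\<And>p. \<beta> (s p) = p"
proof -
  note adj = adjoint_hilbert[OF \<beta>]
  interpret \<beta>: bounded_linear \<beta> by fact
  interpret adj: bounded_linear "adjoint \<beta>" by fact
  obtain c where c: "c > 0" "\<And>p. c * norm p \<le> norm (adjoint \<beta> p)"
    using adjoint_surjective_bounded_below[OF assms] by blast
  have "\<exists>x. \<forall>y. inner (adjoint \<beta> x) (adjoint \<beta> y) = inner p y" for p
    using coercive_riesz[OF adj(2) c bounded_linear_inner_right[of p]] by metis
  then obtain x where x: "\<And>p y. inner (adjoint \<beta> (x p)) (adjoint \<beta> y) = inner p y" by metis
  define s where "s p = adjoint \<beta> (x p)" for p
  have inj: "p = p'" if "\<And>y. inner (adjoint \<beta> p) (adjoint \<beta> y) = inner (adjoint \<beta> p') (adjoint \<beta> y)" for p p'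
  proof -
    have "inner (adjoint \<beta> (p - p')) (adjoint \<beta> (p - p')) = 0"
      using that[of "p - p'"] by (simp add: adj.diff inner_diff_left)
    then show ?thesis using c(2)[of "p - p'"] c(1) by (simp add: mult_le_0_iff)
  qed
  have "\<beta> (s p) = p" for p
  proof -
    have "inner (\<beta> (s p) - p) y = 0" for y
      unfolding inner_diff_left s_def using x by (simp add: adj(1))
    then show ?thesis by (metis inner_eq_zero_iff right_minus_eq)
  qed
  moreover have "bounded_linear s"
  proof (rule bounded_linear_intro[where K = "1 / c"])
    fix p p' and r :: real
    have "x (p + p') = x p + x p'"
      by (rule inj) (simp add: x adj.add inner_add_left)
    then show "s (p + p') = s p + s p'" by (simp add: s_def adj.add)
    have "x (r *\<^sub>R p) = r *\<^sub>R x p" by (rule inj) (simp add: x adj.scaleR)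
    then show "s (r *\<^sub>R p) = r *\<^sub>R s p" by (simp add: s_def adj.scaleR)
    have "norm (s p) * norm (s p) = inner p (x p)"
      using x[of p "x p"] by (simp add: s_def flip: power2_norm_eq_inner) (simp add: power2_eq_square)
    also have "\<dots> \<le> norm p * norm (x p)" by (rule norm_cauchy_schwarz)
    also have "\<dots> \<le> norm p * (norm (s p) / c)"
      using c(2)[of "x p"] c(1) by (intro mult_left_mono) (auto simp: s_def field_simps)
    finally have "norm (s p) * norm (s p) \<le> norm (s p) * (norm p * (1 / c))" by (simp add: field_simps)
    then show "norm (s p) \<le> norm p * (1 / c)"
      using c(1) by (cases "s p = 0") (auto simp del: times_divide_eq_right)
  qed
  ultimately show thesis using that by blast
qed


section \<open>Sections that commute with a commutative semigroup\<close>

lemma compact_imp_closed_fun: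
  fixes C :: "('i \<Rightarrow> real) set"
  assumes "compact C"
  shows "closed C"
proof -
  have "Hausdorff_space (euclidean :: ('i \<Rightarrow> real) topology)"
    by (simp add: Hausdorff_space_product_topology flip: euclidean_product_topology)
  then show ?thesis using compactin_imp_closedin[of euclidean C] assms by simp
qed

text \<open>
  The Markov-Kakutani argument: the averages \<open>A (g, n) = (1/n) \<Sum>\<^bsub>k<n\<^esub> (\<tau> g)\<^sup>k\<close> commute, so finitely many
  of the compact sets \<open>A j ` X\<close> have a common point, hence all do.  A common point \<open>b\<close> is
  invariant, since \<open>b \<circ> \<tau> g - b\<close> telescopes to a bounded quantity divided by \<open>n\<close>.  Restricting to
  maps that act by precomposition makes continuity and affinity automatic.
\<close>

lemma markov_kakutani_precomposition:
  fixes X :: "('i \<Rightarrow> real) set" and \<tau> :: "'g \<Rightarrow> 'i \<Rightarrow> 'i"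
  assumes X: "compact X" "X \<noteq> {}"
    and avg: "\<And>n b. n > 0 \<Longrightarrow> (\<And>k. k < n \<Longrightarrow> b k \<in> X) \<Longrightarrow> (\<lambda>i. (\<Sum>k<n. b k i) / real n) \<in> X"
    and inv: "\<And>g b. g \<in> S \<Longrightarrow> b \<in> X \<Longrightarrow> b \<circ> \<tau> g \<in> X"
    and comm: "\<And>g h. g \<in> S \<Longrightarrow> h \<in> S \<Longrightarrow> \<tau> g \<circ> \<tau> h = \<tau> h \<circ> \<tau> g"
  obtains b where "b \<in> X" "\<And>g. g \<in> S \<Longrightarrow> b \<circ> \<tau> g = b"
proof -
  define A where "A = (\<lambda>(g, n) b i. (\<Sum>k<n. b ((\<tau> g ^^ k) i)) / real n)"
  define I where "I = S \<times> {0::nat<..}"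
  have pow: "b \<circ> \<tau> g ^^ k \<in> X" if "b \<in> X" "g \<in> S" for b g k
    using that by (induction k) (auto simp: inv comp_assoc[symmetric] funpow_Suc_right simp del: funpow.simps(2))
  have A_X: "A j b \<in> X" if j: "j \<in> I" and b: "b \<in> X" for j :: "'g \<times> nat" and b
  proof -
    obtain g n where gn: "j = (g, n)" "g \<in> S" "n > 0" using j by (auto simp: I_def)
    have "(\<lambda>i. (\<Sum>k<n. (b \<circ> \<tau> g ^^ k) i) / real n) \<in> X"
      using gn b by (intro avg pow) auto
    then show ?thesis by (simp add: A_def gn)
  qed
  have A_comm: "A j (A j' b) = A j' (A j b)" if j: "j \<in> I" "j' \<in> I" for j j' b
  proof -
    obtain g n where gn: "j = (g, n)" "g \<in> S" using j by (auto simp: I_def)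
    obtain h m where hm: "j' = (h, m)" "h \<in> S" using j by (auto simp: I_def)
    have c0: "\<tau> h (\<tau> g i) = \<tau> g (\<tau> h i)" for i
      using fun_cong[OF comm[OF gn(2) hm(2)], of i] by simp
    have c1: "\<tau> h ((\<tau> g ^^ k) i) = (\<tau> g ^^ k) (\<tau> h i)" for k i
      by (induction k) (simp_all add: c0)
    have c2: "(\<tau> h ^^ l) ((\<tau> g ^^ k) i) = (\<tau> g ^^ k) ((\<tau> h ^^ l) i)" for k l i
      by (induction l) (auto simp: c1)
    show ?thesis
    proof
      fix i
      have "A j (A j' b) i = (\<Sum>k<n. \<Sum>l<m. b ((\<tau> h ^^ l) ((\<tau> g ^^ k) i)) / (real m * real n))"
        by (simp add: gn hm A_def sum_divide_distrib)
      also have "\<dots> = (\<Sum>l<m. \<Sum>k<n. b ((\<tau> h ^^ l) ((\<tau> g ^^ k) i)) / (real m * real n))"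
        by (rule sum.swap)
      also have "\<dots> = A j' (A j b) i"
        by (simp add: gn hm A_def sum_divide_distrib c2 mult.commute)
      finally show "A j (A j' b) i = A j' (A j b) i" .
    qed
  qed
  have closed: "closed (A j ` X)" if j: "j \<in> I" for j
  proof (rule compact_imp_closed_fun, rule compact_continuous_image[OF _ X(1)])
    obtain g n where gn: "j = (g, n)" "n > 0" using j by (auto simp: I_def)
    show "continuous_on X (A j)"
      unfolding gn A_def prod.case
      by (intro continuous_on_coordinatewise_then_product continuous_intros
          continuous_on_subset[OF continuous_on_product_coordinates]) (use gn in auto)
  qed
  have fip: "X \<inter> (\<Inter>j\<in>J. A j ` X) \<noteq> {}" if "finite J" "J \<subseteq> I" for J
  proof -
    have "\<exists>M. M ` X \<subseteq> X \<inter> (\<Inter>j\<in>J. A j ` X) \<and> (\<forall>j\<in>I. \<forall>b. M (A j b) = A j (M b))"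
      using that
    proof (induction J)
      case empty
      show ?case by (rule exI[of _ id]) auto
    next
      case (insert j J)
      then obtain M where M: "M ` X \<subseteq> X \<inter> (\<Inter>j\<in>J. A j ` X)" "\<forall>j\<in>I. \<forall>b. M (A j b) = A j (M b)"
        by auto
      show ?case
      proof (intro exI conjI)
        show "(\<lambda>b. A j (M b)) ` X \<subseteq> X \<inter> (\<Inter>j\<in>insert j J. A j ` X)"
        proof (rule image_subsetI)
          fix b assume b: "b \<in> X"
          have "A j (M b) \<in> A j ` X" using M(1) b by auto
          moreover have "A j (M b) = M (A j b)" "A j b \<in> X" using M(2) A_X b insert by auto
          moreover have "M (A j b) \<in> X \<inter> (\<Inter>j\<in>J. A j ` X)" using M(1) calculation(3) by blast
          ultimately show "A j (M b) \<in> X \<inter> (\<Inter>j\<in>insert j J. A j ` X)" by auto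
        qed
        show "\<forall>i\<in>I. \<forall>b. A j (M (A i b)) = A i (A j (M b))"
          using M(2) A_comm insert by auto
      qed
    qed
    then obtain M where "M ` X \<subseteq> X \<inter> (\<Inter>j\<in>J. A j ` X)" by metis
    then show ?thesis using X(2) by (metis image_is_empty subset_empty)
  qed
  have "X \<inter> (\<Inter>j\<in>I. A j ` X) \<noteq> {}"
    by (rule compact_imp_fip_image[OF X(1) closed fip])
  then obtain b where b: "b \<in> X" "\<And>j. j \<in> I \<Longrightarrow> b \<in> A j ` X" by blast
  moreover have "b \<circ> \<tau> g = b" if g: "g \<in> S" for g
  proof
    fix i
    have "bounded ((\<lambda>y. y i) ` X)"
      by (intro compact_imp_bounded compact_continuous_image X
          continuous_on_subset[OF continuous_on_product_coordinates]) auto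
    then obtain B where B: "\<And>y. y \<in> X \<Longrightarrow> \<bar>y i\<bar> \<le> B" by (auto simp: bounded_iff)
    have le: "\<bar>b (\<tau> g i) - b i\<bar> \<le> 2 * B / real n" if n: "n > 0" for n
    proof -
      obtain y where y: "y \<in> X" "b = A (g, n) y" using b(2)[of "(g, n)"] g n by (auto simp: I_def)
      have "b (\<tau> g i) - b i = ((\<Sum>k<n. y ((\<tau> g ^^ Suc k) i)) - (\<Sum>k<n. y ((\<tau> g ^^ k) i))) / real n"
        by (simp add: y(2) A_def diff_divide_distrib funpow_swap1)
      also have "(\<Sum>k<n. y ((\<tau> g ^^ Suc k) i)) - (\<Sum>k<n. y ((\<tau> g ^^ k) i))
                   = y ((\<tau> g ^^ n) i) - y i"
        using sum_lessThan_telescope[of "\<lambda>k. y ((\<tau> g ^^ k) i)" n]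
        by (simp only: sum_subtractf funpow_0)
      finally have eq: "b (\<tau> g i) - b i = (y ((\<tau> g ^^ n) i) - y i) / real n" .
      have "\<bar>y ((\<tau> g ^^ n) i)\<bar> \<le> B" "\<bar>y i\<bar> \<le> B" using B[OF pow[OF y(1) g, of n]] B[OF y(1)] by auto
      then have "\<bar>y ((\<tau> g ^^ n) i) - y i\<bar> \<le> 2 * B" by linarith
      then show ?thesis unfolding eq abs_divide using n by (simp add: divide_right_mono)
    qed
    have "(\<lambda>n. 2 * B / real n) \<longlonglongrightarrow> 0" by (rule lim_const_over_n)
    then have "\<bar>b (\<tau> g i) - b i\<bar> \<le> 0"
      by (rule LIMSEQ_le_const) (use le in \<open>auto intro!: exI[of _ 1]\<close>)
    then show "(b \<circ> \<tau> g) i = b i" by simp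
  qed
  ultimately show thesis using that by blast
qed

text \<open>
  A section \<open>\<gamma>\<close> is encoded by its bilinear form \<open>b (p, k) = \<langle>\<gamma> p, k\<rangle>\<close>, a point of a product of
  intervals; this turns weak operator compactness into compactness of a product.  Replacing \<open>\<gamma>\<close> by
  \<open>T f \<circ> \<gamma> \<circ> V f\<close> amounts to precomposing \<open>b\<close> with \<open>(p, k) \<mapsto> (V f p, (T f)\<^sup>* k)\<close>.  The spaces are
  real here; complex linearity of \<open>\<gamma>\<close> will come from commutation with the constant inner
  function \<open>\<i>\<close>.
\<close>

lemma intertwining_section:
  fixes \<beta> :: "'k::{real_inner,complete_space} \<Rightarrow> 'p::{real_inner,complete_space}"
    and T :: "'s \<Rightarrow> 'k \<Rightarrow> 'k" and U V :: "'s \<Rightarrow> 'p \<Rightarrow> 'p" and mul :: "'s \<Rightarrow> 's \<Rightarrow> 's"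
  assumes \<beta>: "bounded_linear \<beta>" "surj \<beta>"
    and mul: "\<And>f g. f \<in> S \<Longrightarrow> g \<in> S \<Longrightarrow> mul f g \<in> S" "\<And>f g. mul f g = mul g f"
    and T: "\<And>f. f \<in> S \<Longrightarrow> bounded_linear (T f)" "\<And>f k. f \<in> S \<Longrightarrow> norm (T f k) \<le> C * norm k"
      "\<And>f g k. f \<in> S \<Longrightarrow> g \<in> S \<Longrightarrow> T (mul f g) k = T f (T g k)"
    and U: "\<And>f. f \<in> S \<Longrightarrow> bounded_linear (U f)"
    and V: "\<And>f. f \<in> S \<Longrightarrow> bounded_linear (V f)" "\<And>f p. f \<in> S \<Longrightarrow> norm (V f p) \<le> D * norm p"
      "\<And>f g p. f \<in> S \<Longrightarrow> g \<in> S \<Longrightarrow> V (mul f g) p = V f (V g p)"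
    and UV: "\<And>f p. f \<in> S \<Longrightarrow> U f (V f p) = p" "\<And>f p. f \<in> S \<Longrightarrow> V f (U f p) = p"
    and \<beta>T: "\<And>f k. f \<in> S \<Longrightarrow> \<beta> (T f k) = U f (\<beta> k)"
  obtains \<gamma> where "bounded_linear \<gamma>" "\<And>p. \<beta> (\<gamma> p) = p"
    "\<And>f p. f \<in> S \<Longrightarrow> T f (\<gamma> p) = \<gamma> (U f p)"
proof -
  interpret \<beta>: bounded_linear \<beta> by fact
  obtain s where s: "bounded_linear s" "\<And>p. \<beta> (s p) = p"
    using surjective_bounded_section[OF \<beta>] by blast
  interpret s: bounded_linear s by fact
  obtain M0 where M0: "\<And>p. norm (s p) \<le> norm p * M0" "M0 > 0" using s.pos_bounded by blast
  define M where "M = M0 * (1 + \<bar>C\<bar> * \<bar>D\<bar>)"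
  have "M > 0" "M0 \<le> M" "\<bar>C\<bar> * \<bar>D\<bar> * M0 \<le> M" using M0(2) by (auto simp: M_def algebra_simps add_pos_nonneg)
  define \<tau> where "\<tau> f = (\<lambda>(p, k). (V f p, adjoint (T f) k))" for f
  \<comment> \<open>The condition \<open>b (p, \<beta>\<^sup>* q) = \<langle>p, q\<rangle>\<close> says \<open>\<beta> \<circ> \<gamma> = id\<close>.  The bound is imposed on all translates
    \<open>b \<circ> \<tau> f\<close> as well, because \<open>\<tau> f\<close> need not be a contraction.\<close>
  define X where "X = {b :: 'p \<times> 'k \<Rightarrow> real.
      (\<forall>p p' k. b (p + p', k) = b (p, k) + b (p', k)) \<and>
      (\<forall>p k k'. b (p, k + k') = b (p, k) + b (p, k')) \<and>
      (\<forall>r p k. b (r *\<^sub>R p, k) = r * b (p, k)) \<and>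
      (\<forall>r p k. b (p, r *\<^sub>R k) = r * b (p, k)) \<and>
      (\<forall>p q. b (p, adjoint \<beta> q) = inner p q) \<and>
      (\<forall>p k. \<bar>b (p, k)\<bar> \<le> M * norm p * norm k) \<and>
      (\<forall>f\<in>S. \<forall>p k. \<bar>b (\<tau> f (p, k))\<bar> \<le> M * norm p * norm k)}"
  note adjT = adjoint_hilbert[OF T(1)]
  note adjU = adjoint_hilbert[OF U]
  note adj\<beta> = adjoint_hilbert[OF \<beta>(1)]
  have adj_mul: "adjoint (T (mul f g)) k = adjoint (T g) (adjoint (T f) k)" if "f \<in> S" "g \<in> S" for f g k
  proof -
    have "adjoint (T (mul f g)) = (\<lambda>k. adjoint (T g) (adjoint (T f) k))"
      using that by (intro adjoint_unique) (simp add: T(3) adjT(1))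
    then show ?thesis by simp
  qed
  have adj_\<beta>: "adjoint (T f) (adjoint \<beta> q) = adjoint \<beta> (adjoint (U f) q)" if "f \<in> S" for f q
  proof -
    have "inner k (adjoint (T f) (adjoint \<beta> q) - adjoint \<beta> (adjoint (U f) q)) = 0" for k
      by (simp add: inner_diff_right \<beta>T[OF that] flip: adj\<beta>(1) adjT(1)[OF that] adjU(1)[OF that])
    then show ?thesis by (metis inner_eq_zero_iff right_minus_eq)
  qed
  have \<tau>_mul: "\<tau> f (\<tau> g i) = \<tau> (mul f g) i" if "f \<in> S" "g \<in> S" for f g i
  proof -
    have "adjoint (T f) (adjoint (T g) k) = adjoint (T (mul f g)) k" for k
      using adj_mul[OF that(2,1)] mul(2)[of f g] by simp
    then show ?thesis using that by (cases i) (simp add: \<tau>_def V(3))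
  qed
  have "\<exists>b. b \<in> X \<and> (\<forall>f\<in>S. b \<circ> \<tau> f = b)"
  proof (rule markov_kakutani_precomposition[of X S \<tau>])
    have "compact (PiE UNIV (\<lambda>(p, k). cball 0 (M * norm p * norm k)) :: ('p \<times> 'k \<Rightarrow> real) set)"
      unfolding compactin_euclidean_iff[symmetric] euclidean_product_topology[symmetric] compactin_PiE
      by auto
    moreover have "X \<subseteq> PiE UNIV (\<lambda>(p, k). cball 0 (M * norm p * norm k))"
      by (auto simp: X_def)
    moreover have "closed X"
      unfolding X_def Ball_def
      by (intro closed_Collect_conj closed_Collect_all closed_Collect_imp closed_Collect_eq
          closed_Collect_le continuous_intros continuous_on_product_coordinates open_Collect_const)
    ultimately show "compact X" by (metis closed_Int_compact inf.absorb_iff1)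
  next
    have "(\<lambda>(p, k). inner (s p) k) \<in> X"
      unfolding X_def mem_Collect_eq prod.case \<tau>_def
    proof (intro conjI allI ballI)
      fix p :: 'p and k :: 'k
      have 1: "\<bar>inner (s p) k\<bar> \<le> M0 * norm p * norm k"
        using Cauchy_Schwarz_ineq2[of "s p" k] mult_right_mono[OF M0(1)[of p] norm_ge_zero[of k]]
        by (simp add: algebra_simps)
      have "M0 * norm p * norm k \<le> M * norm p * norm k" using \<open>M0 \<le> M\<close> by (intro mult_right_mono) auto
      with 1 show "\<bar>inner (s p) k\<bar> \<le> M * norm p * norm k" by linarith
      fix f assume f: "f \<in> S"
      have "\<bar>inner (s (V f p)) (adjoint (T f) k)\<bar> = \<bar>inner (T f (s (V f p))) k\<bar>"
        by (simp add: adjT(1)[OF f])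
      also have "\<dots> \<le> norm (T f (s (V f p))) * norm k" by (rule Cauchy_Schwarz_ineq2)
      also have "\<dots> \<le> (\<bar>C\<bar> * ((\<bar>D\<bar> * norm p) * M0)) * norm k"
      proof (rule mult_right_mono)
        have "norm (T f (s (V f p))) \<le> \<bar>C\<bar> * norm (s (V f p))"
          by (rule order_trans[OF T(2)[OF f]]) (simp add: mult_right_mono)
        also have "\<dots> \<le> \<bar>C\<bar> * (norm (V f p) * M0)" by (intro mult_left_mono M0) auto
        also have "norm (V f p) \<le> \<bar>D\<bar> * norm p"
          by (rule order_trans[OF V(2)[OF f]]) (simp add: mult_right_mono)
        finally show "norm (T f (s (V f p))) \<le> \<bar>C\<bar> * ((\<bar>D\<bar> * norm p) * M0)"
          using M0(2) by (simp add: mult_left_mono mult_right_mono)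
      qed auto
      also have "\<dots> = (\<bar>C\<bar> * \<bar>D\<bar> * M0) * norm p * norm k" by simp
      also have "\<dots> \<le> M * norm p * norm k" using \<open>\<bar>C\<bar> * \<bar>D\<bar> * M0 \<le> M\<close> by (intro mult_right_mono) auto
      finally show "\<bar>inner (s (V f p)) (adjoint (T f) k)\<bar> \<le> M * norm p * norm k" .
    qed (auto simp: s.add s.scaleR inner_add s(2) simp flip: adj\<beta>(1))
    then show "X \<noteq> {}" by blast
  next
    fix n :: nat and b :: "nat \<Rightarrow> 'p \<times> 'k \<Rightarrow> real"
    assume n: "n > 0" and b: "\<And>k. k < n \<Longrightarrow> b k \<in> X"
    have bound: "\<bar>(\<Sum>j<n. x j) / real n\<bar> \<le> B" if "\<And>j. j < n \<Longrightarrow> \<bar>x j\<bar> \<le> B" for x :: "nat \<Rightarrow> real" and B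
    proof -
      have "\<bar>\<Sum>j<n. x j\<bar> \<le> (\<Sum>j<n. B)" using that by (intro order_trans[OF sum_abs] sum_mono) auto
      then show ?thesis using n by (simp add: field_simps)
    qed
    show "(\<lambda>i. (\<Sum>k<n. b k i) / real n) \<in> X"
      unfolding X_def mem_Collect_eq
    proof (intro conjI allI ballI)
      show "\<bar>(\<Sum>j<n. b j (p, k)) / real n\<bar> \<le> M * norm p * norm k" for p k
        using b by (intro bound) (simp add: X_def)
      show "\<bar>(\<Sum>j<n. b j (\<tau> f (p, k))) / real n\<bar> \<le> M * norm p * norm k" if "f \<in> S" for f p k
        using b that by (intro bound) (simp add: X_def)
      have eqs: "b j (p + p', k) = b j (p, k) + b j (p', k)" "b j (p, k + k') = b j (p, k) + b j (p, k')"
        "b j (r *\<^sub>R p, k) = r * b j (p, k)" "b j (p, r *\<^sub>R k) = r * b j (p, k)"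
        "b j (p, adjoint \<beta> q) = inner p q" if "j < n" for j p p' k k' r q
        using b[OF that] by (simp_all add: X_def)
      show "(\<Sum>j<n. b j (p + p', k)) / real n = (\<Sum>j<n. b j (p, k)) / real n + (\<Sum>j<n. b j (p', k)) / real n"
        and "(\<Sum>j<n. b j (p, k + k')) / real n = (\<Sum>j<n. b j (p, k)) / real n + (\<Sum>j<n. b j (p, k')) / real n"
        and "(\<Sum>j<n. b j (r *\<^sub>R p, k)) / real n = r * ((\<Sum>j<n. b j (p, k)) / real n)"
        and "(\<Sum>j<n. b j (p, r *\<^sub>R k)) / real n = r * ((\<Sum>j<n. b j (p, k)) / real n)"
        and "(\<Sum>j<n. b j (p, adjoint \<beta> q)) / real n = inner p q" for p p' k k' r q
        using n by (simp_all add: eqs sum.distrib add_divide_distrib sum_distrib_left)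
    qed
  next
    fix f b assume f: "f \<in> S" and b: "b \<in> X"
    interpret V: bounded_linear "V f" by (rule V(1)[OF f])
    interpret adjT: bounded_linear "adjoint (T f)" by (rule adjT(2)[OF f])
    show "b \<circ> \<tau> f \<in> X"
      unfolding X_def mem_Collect_eq
    proof (intro conjI allI ballI)
      fix p q
      show "(b \<circ> \<tau> f) (p, adjoint \<beta> q) = inner p q"
        using b f by (simp add: \<tau>_def X_def adj_\<beta> UV flip: adjU(1))
    next
      fix g p k assume g: "g \<in> S"
      have "\<bar>b (\<tau> (mul f g) (p, k))\<bar> \<le> M * norm p * norm k" using b mul(1)[OF f g] by (simp add: X_def)
      then show "\<bar>(b \<circ> \<tau> f) (\<tau> g (p, k))\<bar> \<le> M * norm p * norm k" by (simp add: \<tau>_mul[OF f g])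
    next
      fix p k
      show "\<bar>(b \<circ> \<tau> f) (p, k)\<bar> \<le> M * norm p * norm k" using b f by (simp add: X_def)
    qed (use b in \<open>auto simp: X_def \<tau>_def V.add V.scaleR adjT.add adjT.scaleR\<close>)
  next
    fix f g assume "f \<in> S" "g \<in> S"
    then show "\<tau> f \<circ> \<tau> g = \<tau> g \<circ> \<tau> f" by (auto simp: fun_eq_iff \<tau>_mul mul(2)[of f g])
  qed blast
  then obtain b where b: "b \<in> X" "\<And>f i. f \<in> S \<Longrightarrow> b (\<tau> f i) = b i" by (auto simp: fun_eq_iff)
  have "\<exists>x. \<forall>k. inner x k = b (p, k)" for p
  proof -
    have "bounded_linear (\<lambda>k. b (p, k))"
      using b(1) by (intro bounded_linear_intro[where K = "M * norm p"]) (auto simp: X_def algebra_simps)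
    from coercive_riesz[of "id" 1, OF _ _ _ this] show ?thesis
      by (auto simp: id_def bounded_linear_ident)
  qed
  then obtain \<gamma> where \<gamma>: "\<And>p k. inner (\<gamma> p) k = b (p, k)" by metis
  have eqI: "x = y" if "\<And>k. inner x k = inner y k" for x y :: "'z::real_inner"
    using that[of "x - y"] by (metis inner_diff_left inner_eq_zero_iff right_minus_eq)
  show thesis
  proof (rule that)
    show "bounded_linear \<gamma>"
    proof (rule bounded_linear_intro[where K = M])
      show "\<gamma> (p + p') = \<gamma> p + \<gamma> p'" for p p'
        by (rule eqI) (use b(1) in \<open>simp add: \<gamma> inner_add_left X_def\<close>)
      show "\<gamma> (r *\<^sub>R p) = r *\<^sub>R \<gamma> p" for r p
        by (rule eqI) (use b(1) in \<open>simp add: \<gamma> X_def\<close>)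
      fix p
      have "norm (\<gamma> p) * norm (\<gamma> p) = b (p, \<gamma> p)"
        by (simp only: \<gamma>[symmetric] power2_norm_eq_inner[symmetric] power2_eq_square)
      also have "\<dots> \<le> \<bar>b (p, \<gamma> p)\<bar>" by simp
      also have "\<dots> \<le> M * norm p * norm (\<gamma> p)" using b(1) unfolding X_def by blast
      finally show "norm (\<gamma> p) \<le> norm p * M"
        using \<open>M > 0\<close> by (cases "\<gamma> p = 0") (simp_all add: mult.commute)
    qed
    show "\<beta> (\<gamma> p) = p" for p
      by (rule eqI) (use b(1) in \<open>simp add: adj\<beta>(1) \<gamma> X_def\<close>)
    fix f p assume f: "f \<in> S"
    have "b (p, adjoint (T f) k) = b (U f p, k)" for k
      using b(2)[OF f, of "(U f p, k)"] by (simp add: \<tau>_def UV f)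
    then have "inner (T f (\<gamma> p)) k = inner (\<gamma> (U f p)) k" for k
      by (simp add: adjT(1)[OF f] \<gamma>)
    then show "T f (\<gamma> p) = \<gamma> (U f p)" by (rule eqI)
  qed
qed

section \<open>The basic polynomial map\<close>

definition closed_polydisc :: "('n::finite) cspace set" where
  "closed_polydisc = {z. \<forall>i. norm (z $ i) \<le> 1}"

definition torus :: "('n::finite) cspace set" where
  "torus = {z. \<forall>i. norm (z $ i) = 1}"

definition replace_coord :: "'n \<Rightarrow> complex \<Rightarrow> ('n::finite) cspace \<Rightarrow> 'n cspace" where
  "replace_coord i x z = (\<chi> j. if j = i then x else z $ j)"

text \<open>
  The degree of homogeneity of the coordinates of the basic polynomial map.
\<close>

definition weight :: "nat \<Rightarrow> nat \<Rightarrow> 'n::{finite,linorder} \<Rightarrow> nat" where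
  "weight m t i = (if coord_index i < CARD('n) then m * coord_index i else CARD('n) * (m div t))"

definition weighted_scale :: "nat \<Rightarrow> nat \<Rightarrow> complex \<Rightarrow> ('n::{finite,linorder}) cspace \<Rightarrow> 'n cspace" where
  "weighted_scale m t c w = (\<chi> i. c ^ weight m t i * w $ i)"

lemma elem_sym_scale: "elem_sym k (\<chi> j. (c * z $ j) ^ m) = c ^ (m * k) * elem_sym k (\<chi> j. (z $ j) ^ m)"
  unfolding elem_sym_def sum_distrib_left
  by (intro sum.cong) (auto simp: power_mult_distrib prod.distrib power_mult)

lemma theta_scale: "theta m t (c *s z) = weighted_scale m t c (theta m t z)"
  unfolding theta_def weighted_scale_def weight_def vec_eq_iff
  by (auto simp: elem_sym_scale[simplified power_mult_distrib] prod.distrib power_mult_distrib power_mult)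

text \<open>
  Distinct indices have distinct initial segments, so the numbering is injective into
  \<open>{1..d}\<close>, and by counting it is onto.
\<close>

lemma coord_index_bij: "bij_betw coord_index (UNIV :: 'n::{finite,linorder} set) {1..CARD('n)}"
proof -
  have "inj (coord_index :: 'n \<Rightarrow> nat)"
  proof (rule linorder_injI)
    fix i j :: 'n assume "i < j"
    then have "{k. k \<le> i} \<subseteq> {k. k \<le> j}" "j \<in> {k. k \<le> j} - {k. k \<le> i}" by auto
    then have "{k. k \<le> i} \<subset> {k. k \<le> j}" by blast
    then have "coord_index i < coord_index j" unfolding coord_index_def by (intro psubset_card_mono) auto
    then show "coord_index i \<noteq> coord_index j" by simp
  qed
  moreover have "coord_index i \<in> {1..CARD('n)}" for i :: 'n
    unfolding coord_index_def
    by (auto intro: card_mono simp: Suc_le_eq card_gt_0_iff)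
  ultimately show ?thesis
    by (intro bij_betw_imageI card_subset_eq) (auto simp: card_image)
qed

lemma coord_index_exists:
  assumes "1 \<le> k" "k \<le> CARD('n)"
  obtains i :: "'n::{finite,linorder}" where "coord_index i = k"
  using coord_index_bij[where 'n='n] assms by (metis atLeastAtMost_iff bij_betw_iff_bijections)

lemma coord_index_bounds: "1 \<le> coord_index i" "coord_index i \<le> CARD('n)" for i :: "'n::{finite,linorder}"
  using coord_index_bij[where 'n='n] by (auto dest: bij_betwE)

lemma weight_pos:
  assumes "m > 0" "t > 0" "t dvd m"
  shows "weight m t i > 0"
  using assms coord_index_bounds(1)[of i] by (auto simp: weight_def dvd_div_eq_0_iff div_greater_zero_iff dvd_imp_le)

text \<open>
  For unimodular coordinates conjugation is inversion, so multiplying the conjugate of a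
  product over \<open>S\<close> by the product of all coordinates leaves the product over the complement of \<open>S\<close>.
\<close>

lemma elem_sym_unimodular:
  fixes x :: "('n::finite) cspace"
  assumes "\<And>j. norm (x $ j) = 1" and k: "k \<le> CARD('n)"
  shows "cnj (elem_sym k x) * (\<Prod>j\<in>UNIV. x $ j) = elem_sym (CARD('n) - k) x"
proof -
  have 1: "(\<Prod>j\<in>S. cnj (x $ j)) * (\<Prod>j\<in>UNIV. x $ j) = (\<Prod>j\<in>-S. x $ j)" for S
  proof -
    have "(\<Prod>j\<in>UNIV. x $ j) = (\<Prod>j\<in>S. x $ j) * (\<Prod>j\<in>-S. x $ j)"
      by (metis Compl_eq_Diff_UNIV finite mult.commute prod.subset_diff subset_UNIV)
    moreover have "(\<Prod>j\<in>S. cnj (x $ j)) * (\<Prod>j\<in>S. x $ j) = 1"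
      unfolding prod.distrib[symmetric] using assms(1)
      by (intro prod.neutral) (simp add: mult.commute[of "cnj _"] complex_norm_square[symmetric])
    ultimately show ?thesis by (simp add: mult.assoc[symmetric])
  qed
  have "cnj (elem_sym k x) * (\<Prod>j\<in>UNIV. x $ j)
      = (\<Sum>S | S \<subseteq> UNIV \<and> card S = k. (\<Prod>j\<in>-S. x $ j))"
    unfolding elem_sym_def cnj_sum sum_distrib_right cnj_prod 1 ..
  also have "\<dots> = (\<Sum>S | S \<subseteq> UNIV \<and> card S = CARD('n) - k. (\<Prod>j\<in>S. x $ j))"
    by (rule sum.reindex_bij_witness[of _ uminus uminus]) (use k in \<open>auto simp: Compl_eq_Diff_UNIV card_Diff_subset double_diff\<close>)
  finally show ?thesis by (simp add: elem_sym_def)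
qed

text \<open>
  The reflection identity on \<open>\<theta>(\<^bold>T\<^sup>d)\<close> on which the construction of inner functions rests.
\<close>

lemma theta_torus_conj:
  fixes z :: "('n::{finite,linorder}) cspace"
  assumes td: "t dvd m" and z: "z \<in> torus"
    and i: "coord_index i < CARD('n)" "coord_index i' = CARD('n) - coord_index i"
    and e: "coord_index e = CARD('n)"
  shows "cnj (theta m t z $ i) * (theta m t z $ e) ^ t = theta m t z $ i'"
proof -
  have "coord_index i' < CARD('n)" using i coord_index_bounds(1)[of i] by linarith
  moreover have "((\<Prod>j\<in>UNIV. z $ j) ^ (m div t)) ^ t = (\<Prod>j\<in>UNIV. (\<chi> j. (z $ j) ^ m) $ j)"
    using td by (simp add: power_mult[symmetric] prod_power_distrib)
  ultimately show ?thesis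
    using elem_sym_unimodular[of "\<chi> j. (z $ j) ^ m" "coord_index i"] i e z
    by (simp add: theta_def torus_def norm_power)
qed

lemma theta_torus_last:
  assumes "z \<in> torus" "coord_index e = CARD('n)"
  shows "norm (theta m t z $ (e :: 'n::{finite,linorder})) = 1"
  using assms by (simp add: theta_def torus_def norm_power prod_norm[symmetric])

lemma continuous_on_theta: "continuous_on S (theta m t)"
  unfolding theta_def elem_sym_def
proof (rule continuous_on_vec_lambda)
  fix i :: 'a
  show "continuous_on S (\<lambda>z. if coord_index i < CARD('a)
      then \<Sum>S | S \<subseteq> UNIV \<and> card S = coord_index i. \<Prod>j\<in>S. (\<chi> j. (z $ j) ^ m) $ j
      else (\<Prod>j\<in>UNIV. z $ j) ^ (m div t))"
    by (cases "coord_index i < CARD('a)") (auto intro!: continuous_intros)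
qed

lemma theta_curve_holomorphic:
  assumes "\<And>j. (\<lambda>x. \<gamma> x $ j) holomorphic_on W"
  shows "(\<lambda>x. theta m t (\<gamma> x) $ i) holomorphic_on W"
  unfolding theta_def elem_sym_def vec_lambda_beta
  by (cases "coord_index i < CARD('a)") (auto intro!: holomorphic_intros assms)

lemma compact_closed_polydisc: "compact (closed_polydisc :: ('n::finite) cspace set)"
proof -
  have "closed (closed_polydisc :: 'n cspace set)"
    unfolding closed_polydisc_def by (intro closed_Collect_all closed_Collect_le continuous_intros)
  moreover have "bounded (closed_polydisc :: 'n cspace set)"
    unfolding bounded_iff
  proof (intro exI ballI)
    fix z :: "'n cspace" assume "z \<in> closed_polydisc"
    then show "norm z \<le> (\<Sum>i\<in>(UNIV::'n set). 1)"
      unfolding norm_vec_def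
      by (intro order_trans[OF L2_set_le_sum sum_mono]) (auto simp: closed_polydisc_def)
  qed
  ultimately show ?thesis by (simp add: compact_eq_bounded_closed)
qed

lemma compact_torus: "compact (torus :: ('n::finite) cspace set)"
proof -
  have "closed (torus :: 'n cspace set)"
    unfolding torus_def by (intro closed_Collect_all closed_Collect_eq continuous_intros)
  then have "compact (closed_polydisc \<inter> (torus :: 'n cspace set))"
    by (intro compact_Int_closed compact_closed_polydisc)
  moreover have "closed_polydisc \<inter> torus = (torus :: 'n cspace set)"
    by (auto simp: torus_def closed_polydisc_def)
  ultimately show ?thesis by simp
qed

lemma scale_closed_polydisc:
  assumes "norm c < 1" "z \<in> closed_polydisc" shows "c *s z \<in> polydisc"
  unfolding polydisc_def
proof (intro CollectI allI)
  fix i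
  have "norm (c * z $ i) \<le> norm c * 1"
    unfolding norm_mult
    by (rule mult_left_mono) (use assms(2) in \<open>auto simp: closed_polydisc_def\<close>)
  then show "norm ((c *s z) $ i) < 1" using assms(1) by (simp only: vector_smult_component mult_1_right)
qed

lemma closure_theta_domain: "closure (theta_domain m t) = theta m t ` (closed_polydisc :: ('n::{finite,linorder}) cspace set)"
proof
  have "closed (theta m t ` (closed_polydisc :: 'n cspace set))"
    by (intro compact_imp_closed compact_continuous_image continuous_on_theta compact_closed_polydisc)
  then show "closure (theta_domain m t) \<subseteq> theta m t ` (closed_polydisc :: 'n cspace set)"
    unfolding theta_domain_def
    by (intro closure_minimal image_mono) (auto simp: polydisc_def closed_polydisc_def less_imp_le)
  show "theta m t ` (closed_polydisc :: 'n cspace set) \<subseteq> closure (theta_domain m t)"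
  proof (rule image_subsetI)
    fix z :: "'n cspace" assume z: "z \<in> closed_polydisc"
    define r where "r n = complex_of_real (1 - inverse (real (Suc n)))" for n
    have "r n *s z \<in> polydisc" for n
    proof (rule scale_closed_polydisc[OF _ z])
      have "0 < inverse (real (Suc n))" "inverse (real (Suc n)) \<le> 1" by (auto simp: field_simps)
      then show "norm (r n) < 1" unfolding r_def norm_of_real by linarith
    qed
    then have "theta m t (r n *s z) \<in> theta_domain m t" for n by (auto simp: theta_domain_def)
    moreover have "(\<lambda>n. theta m t (r n *s z)) \<longlonglongrightarrow> theta m t z"
    proof (rule continuous_on_tendsto_compose[OF continuous_on_theta[of UNIV]])
      have "r \<longlonglongrightarrow> complex_of_real (1 - 0)"
        unfolding r_def by (intro tendsto_intros LIMSEQ_inverse_real_of_nat)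
      then have "(\<lambda>n. r n * z $ i) \<longlonglongrightarrow> 1 * z $ i" for i by (intro tendsto_intros) auto
      then show "(\<lambda>n. r n *s z) \<longlonglongrightarrow> z" by (intro vec_tendstoI) simp
    qed auto
    ultimately show "theta m t z \<in> closure (theta_domain m t)"
      unfolding closure_sequential
      by (intro exI[of _ "\<lambda>n. theta m t (r n *s z)"]) auto
  qed
qed

text \<open>
  Reduces questions about several variables to one variable: in this development holomorphic
  functions are only ever examined along discs.
\<close>

lemma holomorphic_several_comp_curve:
  assumes f: "holomorphic_several f W" and W: "\<And>x. x \<in> O' \<Longrightarrow> \<gamma> x \<in> W"
    and \<gamma>: "\<And>i. (\<lambda>x. \<gamma> x $ i) holomorphic_on O'" and O': "open O'"
  shows "(\<lambda>x. f (\<gamma> x)) holomorphic_on O'"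
proof (rule holomorphic_onI)
  fix x assume x: "x \<in> O'"
  obtain f' where f': "(f has_derivative f') (at (\<gamma> x) within W)" "\<And>c v. f' (c *s v) = c * f' v"
    using f W[OF x] unfolding holomorphic_several_def by blast
  have "\<forall>i. \<exists>D. ((\<lambda>x. \<gamma> x $ i) has_field_derivative D) (at x within O')"
    using \<gamma> x by (simp add: holomorphic_on_def field_differentiable_def)
  then obtain D where D: "\<And>i. ((\<lambda>x. \<gamma> x $ i) has_field_derivative D i) (at x within O')"
    unfolding choice_iff by blast
  have "(\<gamma> has_derivative (\<lambda>h. \<chi> i. D i * h)) (at x within O')"
    unfolding has_derivative_componentwise_within[of \<gamma>]
  proof
    fix b :: "'a cspace" assume "b \<in> Basis"
    then obtain i u where b: "b = axis i u" by (auto simp: Basis_vec_def)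
    have "((\<lambda>x. \<gamma> x $ i) has_derivative (*) (D i)) (at x within O')"
      using D by (simp add: has_field_derivative_def)
    from has_derivative_inner_left[OF this, of u]
    show "((\<lambda>x. inner (\<gamma> x) b) has_derivative (\<lambda>h. inner (\<chi> i. D i * h) b)) (at x within O')"
      by (simp add: b inner_axis)
  qed
  from has_derivative_in_compose[OF this has_derivative_subset[OF f'(1)]] W
  have "((\<lambda>x. f (\<gamma> x)) has_derivative (\<lambda>h. f' (\<chi> i. D i * h))) (at x within O')"
    by blast
  moreover have "f' (\<chi> i. D i * h) = f' (\<chi> i. D i) * h" for h
    using f'(2)[of h "\<chi> i. D i"] by (simp add: vector_scalar_mult_def mult.commute)
  ultimately show "(\<lambda>x. f (\<gamma> x)) field_differentiable at x within O'"
    unfolding field_differentiable_def has_field_derivative_def by auto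
qed

section \<open>The maximum principle and the Shilov boundary\<close>

lemma theta_algebraD:
  assumes "f \<in> theta_algebra m t"
  shows "continuous_on (theta m t ` closed_polydisc) f" "holomorphic_several f (theta_domain m t)"
    "\<And>w. w \<notin> theta m t ` closed_polydisc \<Longrightarrow> f w = 0"
  using assms by (auto simp: theta_algebra_def cont_algebra_def closure_theta_domain)

lemma dilation_uniform:
  fixes f :: "('n::{finite,linorder}) cspace \<Rightarrow> complex"
  assumes f: "continuous_on (theta m t ` closed_polydisc) f" and \<epsilon>: "\<epsilon> > 0"
  obtains r :: real where "0 < r" "r < 1"
    "\<And>z. z \<in> closed_polydisc \<Longrightarrow> norm (f (theta m t (complex_of_real r *s z)) - f (theta m t z)) < \<epsilon>"
proof -
  have "continuous_on closed_polydisc (f \<circ> theta m t)"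
    by (rule continuous_on_compose[OF continuous_on_theta f])
  then have "uniformly_continuous_on closed_polydisc (f \<circ> theta m t)"
    by (rule compact_uniformly_continuous[OF _ compact_closed_polydisc])
  then obtain \<delta> where \<delta>: "\<delta> > 0" "\<And>z z'. z \<in> closed_polydisc \<Longrightarrow> z' \<in> closed_polydisc \<Longrightarrow>
      dist z' z < \<delta> \<Longrightarrow> norm (f (theta m t z') - f (theta m t z)) < \<epsilon>"
    unfolding uniformly_continuous_on_def o_def dist_norm[of "f _"] using \<epsilon> by metis
  obtain B where B: "B > 0" "\<And>z :: 'n cspace. z \<in> closed_polydisc \<Longrightarrow> norm z \<le> B"
    using compact_imp_bounded[OF compact_closed_polydisc] unfolding bounded_pos by blast
  define s where "s = min (1/2) (\<delta> / (2 * B))"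
  have s: "0 < s" "s < 1" using \<delta>(1) B(1) by (auto simp: s_def)
  have "s * B \<le> \<delta> / 2" using B(1) \<delta>(1) by (auto simp: s_def min_def field_simps)
  show thesis
  proof (rule that[of "1 - s"])
    fix z :: "'n cspace" assume z: "z \<in> closed_polydisc"
    define z' where "z' = complex_of_real (1 - s) *s z"
    have "z' \<in> polydisc" unfolding z'_def
    proof (rule scale_closed_polydisc[OF _ z])
      show "norm (complex_of_real (1 - s)) < 1" unfolding norm_of_real using s by linarith
    qed
    then have "z' \<in> closed_polydisc" by (auto simp: polydisc_def closed_polydisc_def less_imp_le)
    moreover have "z' - z = (- s) *\<^sub>R z"
      by (simp add: z'_def vec_eq_iff scaleR_conv_of_real[where 'a = complex] algebra_simps)
    then have "dist z' z \<le> s * B"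
      using s B(2)[OF z] by (simp add: dist_norm mult_left_mono)
    then have "dist z' z < \<delta>" using \<open>s * B \<le> \<delta> / 2\<close> \<delta>(1) by linarith
    ultimately show "norm (f (theta m t (complex_of_real (1 - s) *s z)) - f (theta m t z)) < \<epsilon>"
      using \<delta>(2)[OF z] by (simp only: z'_def)
  qed (use s in auto)
qed

text \<open>
  Pull \<open>f\<close> back to the polydisc and move the coordinates of a point to the unit circle one after
  the other, by the maximum principle in that coordinate.  Once a coordinate has modulus \<open>1\<close> the
  remaining slices need no longer lie in the open polydisc, so the argument is made for the dilate
  \<open>z \<mapsto> f (\<theta> (r z))\<close> and \<open>r\<close> is chosen close to \<open>1\<close> by uniform continuity.
\<close>

lemma theta_algebra_max_modulus:
  fixes f :: "('n::{finite,linorder}) cspace \<Rightarrow> complex"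
  assumes f: "f \<in> theta_algebra m t"
  obtains b where "b \<in> theta m t ` torus" "\<And>w. w \<in> theta m t ` closed_polydisc \<Longrightarrow> norm (f w) \<le> norm (f b)"
proof -
  note fD = theta_algebraD[OF f]
  have torus_sub: "(torus :: 'n cspace set) \<subseteq> closed_polydisc" by (auto simp: torus_def closed_polydisc_def)
  have "(\<chi> i. 1) \<in> (torus :: 'n cspace set)" by (simp add: torus_def)
  then have ne: "theta m t ` (torus :: 'n cspace set) \<noteq> {}" by blast
  have "compact (theta m t ` (torus :: 'n cspace set))"
    by (intro compact_continuous_image continuous_on_theta compact_torus)
  moreover have "continuous_on (theta m t ` torus) (\<lambda>w. norm (f w))"
    by (intro continuous_on_norm continuous_on_subset[OF fD(1)] image_mono torus_sub)
  ultimately obtain b where b: "b \<in> theta m t ` torus"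
    and max: "\<And>w. w \<in> theta m t ` torus \<Longrightarrow> norm (f w) \<le> norm (f b)"
    using continuous_attains_sup[OF _ ne] by metis
  have "norm (f (theta m t u)) \<le> norm (f b)" if u: "u \<in> closed_polydisc" for u
  proof (rule field_le_epsilon)
    fix e :: real assume "e > 0"
    then obtain r where r: "0 < r" "r < 1" and close:
      "\<And>z. z \<in> closed_polydisc \<Longrightarrow> norm (f (theta m t (complex_of_real r *s z)) - f (theta m t z)) < e / 2"
      using dilation_uniform[OF fD(1), of "e / 2"] by (metis half_gt_zero)
    define F where "F z = f (theta m t (complex_of_real r *s z))" for z
    have inside: "complex_of_real r *s z \<in> polydisc" if "z \<in> closed_polydisc" for z :: "'n cspace"
      using scale_closed_polydisc[OF _ that, of "complex_of_real r"] r by simp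
    have "\<exists>u'. u' \<in> closed_polydisc \<and> (\<forall>i\<in>I. norm (u' $ i) = 1) \<and> norm (F u) \<le> norm (F u')"
      if "finite I" for I :: "'n set"
      using that
    proof (induction I)
      case empty
      show ?case using u by auto
    next
      case (insert i I)
      then obtain v where v: "v \<in> closed_polydisc" "\<And>j. j \<in> I \<Longrightarrow> norm (v $ j) = 1" "norm (F u) \<le> norm (F v)"
        by auto
      have rep: "replace_coord i x v \<in> closed_polydisc" if "norm x \<le> 1" for x
        using v(1) that by (auto simp: replace_coord_def closed_polydisc_def)
      define h where "h x = F (replace_coord i x v)" for x
      have hol: "(\<lambda>x. (complex_of_real r *s replace_coord i x v) $ j) holomorphic_on W" for j W
        by (cases "j = i") (auto simp: replace_coord_def intro!: holomorphic_intros)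
      have "h holomorphic_on ball 0 (1 / r)"
        unfolding h_def F_def
      proof (rule holomorphic_several_comp_curve[OF fD(2)])
        fix x :: complex assume "x \<in> ball 0 (1 / r)"
        then have "norm x * r < 1" using r by (simp add: field_simps)
        moreover have "r * norm (v $ j) < 1" for j
          using inside[OF v(1)] r by (simp add: polydisc_def norm_mult)
        ultimately have "complex_of_real r *s replace_coord i x v \<in> polydisc"
          using r by (auto simp: polydisc_def replace_coord_def norm_mult mult.commute)
        then show "theta m t (complex_of_real r *s replace_coord i x v) \<in> theta_domain m t"
          by (auto simp: theta_domain_def)
      qed (auto intro: theta_curve_holomorphic hol)
      moreover have "1 < 1 / r" using r by simp
      then have "cball 0 1 \<subseteq> ball (0::complex) (1 / r)" by auto
      ultimately have holh: "h holomorphic_on cball 0 1" by (rule holomorphic_on_subset)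
      then have "continuous_on (cball 0 1) h" by (rule holomorphic_on_imp_continuous_on)
      then have cont: "continuous_on (sphere 0 1) (\<lambda>x. norm (h x))"
        by (intro continuous_on_norm) (auto elim: continuous_on_subset)
      have "sphere (0::complex) 1 \<noteq> {}" by simp
      from continuous_attains_sup[OF compact_sphere this cont]
      obtain x where x: "norm x = 1" "\<And>y. norm y = 1 \<Longrightarrow> norm (h y) \<le> norm (h x)" by auto
      have "norm (h (v $ i)) \<le> norm (h x)"
      proof (rule maximum_modulus_frontier[of h "cball 0 1"])
        show "h holomorphic_on interior (cball 0 1)"
          using holh by (rule holomorphic_on_subset) auto
        show "continuous_on (closure (cball 0 1)) h"
          using holh by (simp add: holomorphic_on_imp_continuous_on)
        show "v $ i \<in> cball 0 1" using v(1) by (auto simp: closed_polydisc_def)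
      qed (use x in auto)
      moreover have "h (v $ i) = F v"
        by (auto simp: h_def replace_coord_def vec_eq_iff intro!: arg_cong[of _ _ F])
      ultimately have "norm (F u) \<le> norm (F (replace_coord i x v))" using v(3) by (simp add: h_def)
      then show ?case
        using rep[of x] x(1) v(2) by (intro exI[of _ "replace_coord i x v"]) (auto simp: replace_coord_def)
    qed
    from this[of UNIV] obtain u' where u': "u' \<in> closed_polydisc" "u' \<in> torus" "norm (F u) \<le> norm (F u')"
      by (auto simp: torus_def)
    have "norm (f (theta m t u)) \<le> norm (F u) + e / 2"
      using close[OF u] norm_triangle_sub[of "f (theta m t u)" "F u"] by (simp add: F_def norm_minus_commute)
    moreover have "norm (F u') \<le> norm (f (theta m t u')) + e / 2"
      using close[OF u'(1)] norm_triangle_sub[of "F u'" "f (theta m t u')"] by (simp add: F_def)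
    moreover have "norm (f (theta m t u')) \<le> norm (f b)" using u'(2) by (intro max) auto
    ultimately show "norm (f (theta m t u)) \<le> norm (f b) + e" using u'(3) by linarith
  qed
  then show thesis using b by (intro that[of b]) auto
qed

lemma theta_boundary_subset: "theta_boundary m t \<subseteq> theta m t ` (torus :: ('n::{finite,linorder}) cspace set)"
proof -
  have sub: "theta m t ` (torus :: 'n cspace set) \<subseteq> theta m t ` closed_polydisc"
    by (auto simp: torus_def closed_polydisc_def)
  have "closed (theta m t ` (torus :: 'n cspace set))"
    by (intro compact_imp_closed compact_continuous_image continuous_on_theta compact_torus)
  then have "is_boundary (closure (theta_domain m t)) (theta_algebra m t) (theta m t ` (torus :: 'n cspace set))"
    unfolding is_boundary_def closure_theta_domain using sub theta_algebra_max_modulus by metis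
  then show ?thesis unfolding theta_boundary_def shilov_boundary_def by blast
qed

section \<open>Polynomial approximation of separately holomorphic functions\<close>

lemma taylor_remainder:
  assumes h: "h holomorphic_on ball 0 R" and B: "\<And>x. x \<in> ball 0 R \<Longrightarrow> norm (h x) \<le> B"
    and s: "0 \<le> s" "s < r" "r < R" and x: "norm x \<le> s"
  shows "norm (h x - (\<Sum>k<N. (deriv ^^ k) h 0 / fact k * x ^ k)) \<le> B * (s / r) ^ N / (1 - s / r)"
proof -
  define a where "a k = (deriv ^^ k) h 0 / fact k" for k
  have r: "r > 0" using s by simp
  have "B \<ge> 0" using B[of 0] s by (meson centre_in_ball norm_ge_zero order_trans order_le_less_trans less_trans)
  have sub: "cball 0 r \<subseteq> ball (0::complex) R" using s by auto
  have coef: "norm (a k) \<le> B / r ^ k" for k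
  proof -
    have "norm ((deriv ^^ k) h 0) \<le> fact k * B / r ^ k"
    proof (rule Cauchy_inequality)
      show "h holomorphic_on ball 0 r" using h by (rule holomorphic_on_subset) (use s in auto)
      show "continuous_on (cball 0 r) h"
        using holomorphic_on_imp_continuous_on[OF holomorphic_on_subset[OF h sub]] .
      show "norm (h x) \<le> B" if "norm (0 - x) = r" for x using that s by (intro B) auto
    qed (use r in auto)
    then show ?thesis by (simp add: a_def norm_divide field_simps)
  qed
  have q: "0 \<le> s / r" "s / r < 1" using s r by auto
  have term_le: "norm (a (k + N) * x ^ (k + N)) \<le> B * (s / r) ^ N * (s / r) ^ k" for k
  proof -
    have "norm (a (k + N) * x ^ (k + N)) \<le> B / r ^ (k + N) * s ^ (k + N)"
      unfolding norm_mult norm_power using coef s x r \<open>B \<ge> 0\<close> by (intro mult_mono power_mono) auto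
    also have "\<dots> = B * (s / r) ^ N * (s / r) ^ k" by (simp add: power_add power_divide mult_ac)
    finally show ?thesis .
  qed
  have sums: "(\<lambda>k. a k * x ^ k) sums h x"
    using holomorphic_power_series[OF h, of x] s x by (simp add: a_def)
  then have "(\<lambda>k. a (k + N) * x ^ (k + N)) sums (h x - (\<Sum>k<N. a k * x ^ k))"
    by (rule sums_split_initial_segment)
  moreover have "(\<lambda>k. B * (s / r) ^ N * (s / r) ^ k) sums (B * (s / r) ^ N * (1 / (1 - s / r)))"
    using q by (intro sums_mult geometric_sums) auto
  ultimately have "norm (h x - (\<Sum>k<N. a k * x ^ k)) \<le> B * (s / r) ^ N * (1 / (1 - s / r))"
    using term_le by (rule norm_sums_le)
  then show ?thesis by (simp add: a_def)
qed

text \<open>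
  Orthogonality of the characters of the group of \<open>N\<close>-th roots of unity.
\<close>

lemma sum_cis_powers:
  assumes "N > 0" "k < N" "n < N"
  shows "(\<Sum>j<N. (cis (2 * pi * real j / real N)) ^ k * cnj (cis (2 * pi * real j / real N)) ^ n)
      = (if k = n then of_nat N else 0)"
proof -
  define \<omega> where "\<omega> = cis (2 * pi / real N)"
  define \<zeta> where "\<zeta> = \<omega> ^ k * cnj \<omega> ^ n"
  have cis: "cis (2 * pi * real j / real N) = \<omega> ^ j" for j
    using Complex.DeMoivre[of "2 * pi / real N" j] by (simp add: \<omega>_def mult.commute)
  have unit: "\<omega> ^ j * cnj \<omega> ^ j = 1" for j
    by (simp add: \<omega>_def cis_cnj Complex.DeMoivre cis_mult flip: power_mult_distrib)
  have term_eq: "(cis (2 * pi * real j / real N)) ^ k * cnj (cis (2 * pi * real j / real N)) ^ n = \<zeta> ^ j" for j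
    unfolding cis \<zeta>_def power_mult_distrib by (simp add: mult.commute flip: power_mult)
  have "\<omega> ^ N = 1" using assms by (simp add: \<omega>_def Complex.DeMoivre)
  then have "cnj \<omega> ^ N = 1" by (metis complex_cnj_one complex_cnj_power)
  then have \<zeta>N: "\<zeta> ^ N = 1"
    using \<open>\<omega> ^ N = 1\<close> by (simp add: \<zeta>_def power_mult_distrib) (metis mult_1 power_mult mult.commute power_one)
  show ?thesis
  proof (cases "k = n")
    case True
    then have "\<zeta> = 1" using unit by (simp add: \<zeta>_def)
    then show ?thesis unfolding term_eq using True by simp
  next
    case False
    have "\<zeta> \<noteq> 1"
    proof
      assume "\<zeta> = 1"
      then have "\<omega> ^ k = \<omega> ^ n"
        using unit[of n] by (metis \<zeta>_def mult.assoc mult.commute mult_1)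
      then have "cis (2 * pi * real k / real N) = cis (2 * pi * real n / real N)" by (simp add: cis)
      then show False
        using Complex.bij_betw_roots_unity[of N] assms False by (auto simp: bij_betw_def inj_on_def)
    qed
    then have "(\<Sum>j<N. \<zeta> ^ j) = 0" by (simp add: geometric_sum \<zeta>N)
    then show ?thesis unfolding term_eq using False by simp
  qed
qed

text \<open>
  Interpolation at \<open>N\<close> equidistant points of the circle of radius \<open>\<rho>\<close>.  It reproduces polynomials
  of degree below \<open>N\<close>, and the fundamental polynomials \<open>L j\<close> are bounded by \<open>1\<close> on the disc.  So the
  error is at most \<open>1 + N\<close> times a Taylor remainder, which decays geometrically.  The nodes and the
  polynomials depend on the bound \<open>B\<close> but not on \<open>h\<close>; this uniformity is what allows the other
  variables to be treated as parameters.
\<close>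

lemma interpolation_disc:
  fixes R \<rho> B \<eta> :: real
  assumes \<rho>: "0 < \<rho>" "\<rho> < R" and \<eta>: "\<eta> > 0"
  obtains N :: nat and x :: "nat \<Rightarrow> complex" and L :: "nat \<Rightarrow> complex poly"
  where "\<forall>j. norm (x j) = \<rho>"
    "\<forall>h y. h holomorphic_on ball 0 R \<and> (\<forall>u\<in>ball 0 R. norm (h u) \<le> B) \<and> norm y \<le> \<rho> \<longrightarrow>
        norm (h y - (\<Sum>j<N. h (x j) * poly (L j) y)) \<le> \<eta>"
proof -
  define r where "r = (\<rho> + R) / 2"
  define q where "q = \<rho> / r"
  have r: "\<rho> < r" "r < R" "r > 0" using \<rho> by (auto simp: r_def)
  have q: "0 \<le> q" "q < 1" using \<rho> r by (auto simp: q_def)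
  have "(\<lambda>N. (1 + real N) * (\<bar>B\<bar> * q ^ N / (1 - q))) \<longlonglongrightarrow> 0"
  proof -
    have a1: "(\<lambda>N. real N * q ^ N) \<longlonglongrightarrow> 0" using q by (intro powser_times_n_limit_0) auto
    have a2: "(\<lambda>N. q ^ N) \<longlonglongrightarrow> 0" using q by (intro LIMSEQ_power_zero) auto
    have "(\<lambda>N. (q ^ N + real N * q ^ N) * (\<bar>B\<bar> / (1 - q))) \<longlonglongrightarrow> (0 + 0) * (\<bar>B\<bar> / (1 - q))"
      by (rule tendsto_mult[OF tendsto_add[OF a2 a1] tendsto_const])
    then show ?thesis by (simp add: algebra_simps add_divide_distrib)
  qed
  then have "eventually (\<lambda>N. (1 + real N) * (\<bar>B\<bar> * q ^ N / (1 - q)) < \<eta>) sequentially"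
    using \<eta> by (rule order_tendstoD)
  then obtain N0 where N0: "\<And>N. N \<ge> N0 \<Longrightarrow> (1 + real N) * (\<bar>B\<bar> * q ^ N / (1 - q)) < \<eta>"
    unfolding eventually_sequentially by blast
  then obtain N where N: "N > 0" "(1 + real N) * (\<bar>B\<bar> * q ^ N / (1 - q)) < \<eta>"
    using N0[of "Suc N0"] by (metis le_SucI order_refl zero_less_Suc)
  define c where "c j = cis (2 * pi * real j / real N)" for j
  define x where "x j = of_real \<rho> * c j" for j
  define L where "L j = (\<Sum>n<N. monom (inverse (x j) ^ n / of_nat N) n)" for j
  have nx: "norm (x j) = \<rho>" for j using \<rho> by (simp add: x_def c_def norm_mult)
  have Lpoly: "poly (L j) y = (\<Sum>n<N. (y / x j) ^ n) / of_nat N" for j y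
    by (simp add: L_def poly_sum poly_monom sum_divide_distrib power_divide divide_inverse power_mult_distrib sum_distrib_left mult_ac)
  have Lbound: "norm (poly (L j) y) \<le> 1" if "norm y \<le> \<rho>" for j y
  proof -
    have "norm (\<Sum>n<N. (y / x j) ^ n) \<le> (\<Sum>n<N. 1)"
      using that \<rho> by (intro sum_norm_le) (auto simp: norm_power norm_divide nx intro!: power_le_one)
    then show ?thesis using N(1) by (simp add: Lpoly norm_divide field_simps)
  qed
  have exact: "(\<Sum>j<N. x j ^ k * poly (L j) y) = y ^ k" if k: "k < N" for k y
  proof -
    have inv: "1 / x j = cnj (c j) / of_real \<rho>" for j
      by (simp add: x_def c_def divide_inverse cis_inverse cis_cnj mult.commute)
    have "(\<Sum>j<N. x j ^ k * poly (L j) y) = (\<Sum>j<N. \<Sum>n<N. x j ^ k * (y * (1 / x j)) ^ n / of_nat N)"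
      by (simp add: Lpoly sum_distrib_left sum_divide_distrib)
    also have "\<dots> = (\<Sum>n<N. \<Sum>j<N. x j ^ k * (y * (1 / x j)) ^ n / of_nat N)" by (rule sum.swap)
    also have "\<dots> = (\<Sum>n<N. (of_real \<rho> ^ k * (y / of_real \<rho>) ^ n / of_nat N) * (\<Sum>j<N. c j ^ k * cnj (c j) ^ n))"
      unfolding inv sum_distrib_left
      by (intro sum.cong refl) (simp add: x_def power_mult_distrib power_divide mult_ac)
    also have "\<dots> = (\<Sum>n<N. if n = k then y ^ k else 0)"
      unfolding c_def using k N(1) \<rho> by (intro sum.cong refl, subst sum_cis_powers) (auto simp: power_divide)
    also have "\<dots> = y ^ k" using k by simp
    finally show ?thesis .
  qed
  show thesis
  proof (rule that[where x = x and N = N and L = L])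
    show "\<forall>h y. h holomorphic_on ball 0 R \<and> (\<forall>u\<in>ball 0 R. norm (h u) \<le> B) \<and> norm y \<le> \<rho> \<longrightarrow>
        norm (h y - (\<Sum>j<N. h (x j) * poly (L j) y)) \<le> \<eta>"
    proof (intro allI impI)
      fix h :: "complex \<Rightarrow> complex" and y :: complex assume "h holomorphic_on ball 0 R \<and> (\<forall>u\<in>ball 0 R. norm (h u) \<le> B) \<and> norm y \<le> \<rho>"
      then have h: "h holomorphic_on ball 0 R" and B: "\<And>y. y \<in> ball 0 R \<Longrightarrow> norm (h y) \<le> B"
        and y: "norm y \<le> \<rho>" by auto
      define p where "p y = (\<Sum>k<N. (deriv ^^ k) h 0 / fact k * y ^ k)" for y
      define e where "e = \<bar>B\<bar> * q ^ N / (1 - q)"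
      have "B \<ge> 0" using B[of 0] \<rho> by (auto intro: order_trans[OF norm_ge_zero])
      then have rem: "norm (h y - p y) \<le> e" if "norm y \<le> \<rho>" for y
        using taylor_remainder[OF h B, of \<rho> r y N] that \<rho> r by (simp add: p_def e_def q_def)
      have "(\<Sum>j<N. p (x j) * poly (L j) y) = (\<Sum>k<N. (deriv ^^ k) h 0 / fact k * (\<Sum>j<N. x j ^ k * poly (L j) y))"
        unfolding p_def sum_distrib_left sum_distrib_right by (subst sum.swap) (simp add: mult_ac)
      also have "\<dots> = p y" by (simp add: exact p_def)
      finally have pint: "(\<Sum>j<N. p (x j) * poly (L j) y) = p y" .
      have "h y - (\<Sum>j<N. h (x j) * poly (L j) y) = (h y - p y) - (\<Sum>j<N. (h (x j) - p (x j)) * poly (L j) y)"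
        by (simp add: left_diff_distrib sum_subtractf pint)
      also have "norm \<dots> \<le> e + (\<Sum>j<N. e * 1)"
      proof (rule order_trans[OF norm_triangle_ineq4], rule add_mono[OF rem[OF y]], rule sum_norm_le)
        fix j
        have "e \<ge> 0" using rem[of 0] \<rho> by (auto intro: order_trans[OF norm_ge_zero])
        then show "norm ((h (x j) - p (x j)) * poly (L j) y) \<le> e * 1"
          unfolding norm_mult by (intro mult_mono rem Lbound y) (auto simp: nx)
      qed
      also have "\<dots> = (1 + real N) * e" by (simp add: algebra_simps)
      also have "\<dots> \<le> \<eta>" using N(2) by (simp add: e_def)
      finally show "norm (h y - (\<Sum>j<N. h (x j) * poly (L j) y)) \<le> \<eta>" .
    qed
  qed (simp add: nx)
qed

text \<open>
  Polynomial functions, given by generators so that they can be followed by induction into any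
  algebra that contains the constants and the coordinates.
\<close>

inductive_set poly_fun :: "(('n::finite) cspace \<Rightarrow> complex) set" where
  const: "(\<lambda>w. c) \<in> poly_fun"
| coord: "(\<lambda>w. w $ i) \<in> poly_fun"
| add: "p \<in> poly_fun \<Longrightarrow> q \<in> poly_fun \<Longrightarrow> (\<lambda>w. p w + q w) \<in> poly_fun"
| mult: "p \<in> poly_fun \<Longrightarrow> q \<in> poly_fun \<Longrightarrow> (\<lambda>w. p w * q w) \<in> poly_fun"

lemma poly_fun_sum: "(\<And>j. j \<in> J \<Longrightarrow> q j \<in> poly_fun) \<Longrightarrow> (\<lambda>w. \<Sum>j\<in>J. q j w) \<in> poly_fun"
  by (induction J rule: infinite_finite_induct) (auto intro: poly_fun.intros)

lemma poly_fun_poly: "(\<lambda>w. poly p (w $ i)) \<in> poly_fun"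
proof (induction p)
  case 0
  show ?case by (simp add: poly_fun.const)
next
  case (pCons a p)
  show ?case
    unfolding poly_pCons
    by (rule poly_fun.add[OF poly_fun.const poly_fun.mult[OF poly_fun.coord pCons.IH]])
qed

text \<open>
  As a function of \<open>c\<close> the left-hand side is a polynomial; its coefficient at \<open>c\<^sup>k\<close> is the component
  of weighted degree \<open>k\<close> of \<open>q\<close>.
\<close>

lemma poly_fun_weighted_components:
  assumes "q \<in> poly_fun"
  obtains n Q where "\<And>k. Q k \<in> poly_fun"
    "\<And>c w. q (weighted_scale m t c w) = (\<Sum>k\<le>n. Q k w * c ^ k)"
  using assms
proof (induction arbitrary: thesis rule: poly_fun.induct)
  case (const c)
  show ?case by (rule const[of "\<lambda>_ _. c" 0]) (auto intro: poly_fun.const)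
next
  case (coord i)
  define a where "a = weight m t i"
  show ?case
  proof (rule coord[of "\<lambda>k w. if k = a then w $ i else 0" a])
    show "(\<lambda>w. if k = a then w $ i else 0) \<in> poly_fun" for k
      by (cases "k = a") (auto intro: poly_fun.intros)
    show "weighted_scale m t c w $ i = (\<Sum>k\<le>a. (if k = a then w $ i else 0) * c ^ k)" for c w
      by (simp add: weighted_scale_def a_def if_distrib if_distribR cong: if_cong)
  qed
next
  case (add p q)
  obtain n P where P: "\<And>k. P k \<in> poly_fun" "\<And>c w. p (weighted_scale m t c w) = (\<Sum>k\<le>n. P k w * c ^ k)"
    using add.IH(1) by blast
  obtain n' Q where Q: "\<And>k. Q k \<in> poly_fun" "\<And>c w. q (weighted_scale m t c w) = (\<Sum>k\<le>n'. Q k w * c ^ k)"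
    using add.IH(2) by blast
  define P' where "P' k w = (if k \<le> n then P k w else 0)" for k w
  define Q' where "Q' k w = (if k \<le> n' then Q k w else 0)" for k w
  show ?case
  proof (rule add.prems[of "\<lambda>k w. P' k w + Q' k w" "max n n'"])
    show "(\<lambda>w. P' k w + Q' k w) \<in> poly_fun" for k
      by (cases "k \<le> n"; cases "k \<le> n'") (auto simp: P'_def Q'_def intro!: poly_fun.intros P Q)
    fix c w
    have "(\<Sum>k\<le>n. P k w * c ^ k) = (\<Sum>k\<le>max n n'. P' k w * c ^ k)"
      by (intro sum.mono_neutral_cong_left) (auto simp: P'_def)
    moreover have "(\<Sum>k\<le>n'. Q k w * c ^ k) = (\<Sum>k\<le>max n n'. Q' k w * c ^ k)"
      by (intro sum.mono_neutral_cong_left) (auto simp: Q'_def)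
    ultimately show "p (weighted_scale m t c w) + q (weighted_scale m t c w)
        = (\<Sum>k\<le>max n n'. (P' k w + Q' k w) * c ^ k)"
      by (simp add: P Q sum.distrib distrib_right)
  qed
next
  case (mult p q)
  obtain n P where P: "\<And>k. P k \<in> poly_fun" "\<And>c w. p (weighted_scale m t c w) = (\<Sum>k\<le>n. P k w * c ^ k)"
    using mult.IH(1) by blast
  obtain n' Q where Q: "\<And>k. Q k \<in> poly_fun" "\<And>c w. q (weighted_scale m t c w) = (\<Sum>k\<le>n'. Q k w * c ^ k)"
    using mult.IH(2) by blast
  define P' where "P' k w = (if k \<le> n then P k w else 0)" for k w
  define Q' where "Q' k w = (if k \<le> n' then Q k w else 0)" for k w
  have in_poly: "P' k \<in> poly_fun" "Q' k \<in> poly_fun" for k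
  proof -
    show "P' k \<in> poly_fun" unfolding P'_def by (cases "k \<le> n") (auto intro: poly_fun.const P)
    show "Q' k \<in> poly_fun" unfolding Q'_def by (cases "k \<le> n'") (auto intro: poly_fun.const Q)
  qed
  show ?case
  proof (rule mult.prems[of "\<lambda>r w. \<Sum>k\<le>r. P' k w * Q' (r - k) w" "n + n'"])
    show "(\<lambda>w. \<Sum>k\<le>r. P' k w * Q' (r - k) w) \<in> poly_fun" for r
      by (intro poly_fun_sum poly_fun.mult in_poly)
    fix c w
    have "(\<Sum>k\<le>n. P' k w * c ^ k) * (\<Sum>k\<le>n'. Q' k w * c ^ k)
        = (\<Sum>r\<le>n + n'. (\<Sum>k\<le>r. P' k w * Q' (r - k) w) * c ^ r)"
      by (rule polynomial_product) (auto simp: P'_def Q'_def)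
    then show "p (weighted_scale m t c w) * q (weighted_scale m t c w)
        = (\<Sum>r\<le>n + n'. (\<Sum>k\<le>r. P' k w * Q' (r - k) w) * c ^ r)"
      by (simp add: P Q P'_def Q'_def)
  qed
qed

text \<open>
  Interpolate in one variable after the other.  With the coordinates outside \<open>J\<close> frozen, \<open>f\<close> is
  approximated in the coordinate \<open>i \<in> J\<close> by a sum of terms \<open>f(\<dots>, x\<^sub>j, \<dots>) L\<^sub>j(w\<^sub>i)\<close> whose first factor has
  one more frozen coordinate.  Sampling \<open>f\<close> at finitely many values, in place of a Cauchy integral,
  keeps these factors visibly holomorphic in the other variables.
\<close>

lemma separately_holomorphic_approx:
  fixes f :: "('n::finite) cspace \<Rightarrow> complex" and R \<rho> B \<eta> :: real
  assumes \<rho>: "0 < \<rho>" "\<rho> < R" and \<eta>: "\<eta> > 0"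
    and hol: "\<And>i w. (\<And>j. norm (w $ j) < R) \<Longrightarrow> (\<lambda>x. f (replace_coord i x w)) holomorphic_on ball 0 R"
    and B: "\<And>w. (\<And>j. norm (w $ j) < R) \<Longrightarrow> norm (f w) \<le> B"
  obtains q where "q \<in> poly_fun" "\<forall>w. (\<forall>j. norm (w $ j) \<le> \<rho>) \<longrightarrow> norm (f w - q w) \<le> \<eta>"
proof -
  define K where "K = {w :: 'n cspace. \<forall>j. norm (w $ j) \<le> \<rho>}"
  define approx where "approx g \<longleftrightarrow> (\<forall>\<eta>>0. \<exists>q\<in>poly_fun. \<forall>w\<in>K. norm (g w - q w) \<le> \<eta>)"
    for g :: "'n cspace \<Rightarrow> complex"
  have approx_add: "approx (\<lambda>w. g w + h w)" if g: "approx g" and h: "approx h" for g h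
    unfolding approx_def
  proof (intro allI impI)
    fix \<eta> :: real assume "\<eta> > 0"
    then obtain p q where p: "p \<in> poly_fun" "\<forall>w\<in>K. norm (g w - p w) \<le> \<eta> / 2"
      and q: "q \<in> poly_fun" "\<forall>w\<in>K. norm (h w - q w) \<le> \<eta> / 2"
      using g h unfolding approx_def by (meson half_gt_zero)
    show "\<exists>q\<in>poly_fun. \<forall>w\<in>K. norm ((g w + h w) - q w) \<le> \<eta>"
    proof (rule bexI[OF _ poly_fun.add[OF p(1) q(1)]], rule ballI)
      fix w assume "w \<in> K"
      then have "norm ((g w - p w) + (h w - q w)) \<le> \<eta> / 2 + \<eta> / 2"
        using p q by (intro order_trans[OF norm_triangle_ineq] add_mono) auto
      then show "norm ((g w + h w) - (p w + q w)) \<le> \<eta>" by (simp add: algebra_simps)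
    qed
  qed
  have approx_mult: "approx (\<lambda>w. g w * poly L (w $ i))" if g: "approx g" for g L i
    unfolding approx_def
  proof (intro allI impI)
    fix \<eta> :: real assume "\<eta> > 0"
    have "compact (poly L ` cball 0 \<rho>)" by (intro compact_continuous_image continuous_intros compact_cball)
    from compact_imp_bounded[OF this] obtain C where C: "C > 0" "\<And>y. norm y \<le> \<rho> \<Longrightarrow> norm (poly L y) \<le> C"
      unfolding bounded_pos by auto
    have "\<eta> / C > 0" using C(1) \<open>\<eta> > 0\<close> by simp
    then obtain p where p: "p \<in> poly_fun" "\<forall>w\<in>K. norm (g w - p w) \<le> \<eta> / C"
      using g unfolding approx_def by meson
    show "\<exists>q\<in>poly_fun. \<forall>w\<in>K. norm (g w * poly L (w $ i) - q w) \<le> \<eta>"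
    proof (rule bexI[OF _ poly_fun.mult[OF p(1) poly_fun_poly[of L i]]], rule ballI)
      fix w assume w: "w \<in> K"
      have "norm ((g w - p w) * poly L (w $ i)) \<le> \<eta> / C * C"
        unfolding norm_mult using p(2) w C by (intro mult_mono) (auto simp: K_def intro: order_trans[OF norm_ge_zero])
      then show "norm (g w * poly L (w $ i) - p w * poly L (w $ i)) \<le> \<eta>"
        using C(1) by (simp add: algebra_simps)
    qed
  qed
  have approx_sum: "approx (\<lambda>w. \<Sum>j<n. g j w)" if "\<And>j. approx (g j)" for g and n :: nat
  proof (induction n)
    case 0
    show ?case unfolding approx_def by (auto intro!: bexI[of _ "\<lambda>_. 0"] poly_fun.const)
  qed (auto intro: approx_add that)
  have approx_lim: "approx g" if lim: "\<And>\<eta>. \<eta> > 0 \<Longrightarrow> \<exists>h. approx h \<and> (\<forall>w\<in>K. norm (g w - h w) \<le> \<eta>)" for g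
    unfolding approx_def
  proof (intro allI impI)
    fix \<eta> :: real assume "\<eta> > 0"
    then obtain h where h: "approx h" "\<forall>w\<in>K. norm (g w - h w) \<le> \<eta> / 2" using lim[of "\<eta> / 2"] \<open>\<eta> > 0\<close> by auto
    then obtain q where q: "q \<in> poly_fun" "\<forall>w\<in>K. norm (h w - q w) \<le> \<eta> / 2"
      using \<open>\<eta> > 0\<close> unfolding approx_def by (meson half_gt_zero)
    have "norm (g w - q w) \<le> \<eta>" if "w \<in> K" for w
      using norm_triangle_ineq[of "g w - h w" "h w - q w"] h(2) q(2) that by fastforce
    then show "\<exists>q\<in>poly_fun. \<forall>w\<in>K. norm (g w - q w) \<le> \<eta>" using q(1) by blast
  qed
  define merge where "merge J v w = (\<chi> j. if j \<in> J then w $ j else v $ j)" for J and v w :: "'n cspace"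
  have main: "approx (\<lambda>w. f (merge J v w))" if "finite J" "v \<in> K" for J v
    using that
  proof (induction J arbitrary: v)
    case empty
    have "merge {} v w = v" for w by (simp add: merge_def vec_eq_iff)
    then show ?case unfolding approx_def by (auto intro!: bexI[of _ "\<lambda>_. f v"] poly_fun.const)
  next
    case (insert i J)
    show ?case
    proof (rule approx_lim)
      fix \<eta> :: real assume "\<eta> > 0"
      obtain N :: nat and x and L where x: "\<forall>j. norm (x j) = \<rho>"
        and L: "\<forall>h y. h holomorphic_on ball 0 R \<and> (\<forall>u\<in>ball 0 R. norm (h u) \<le> B) \<and> norm y \<le> \<rho> \<longrightarrow>
            norm (h y - (\<Sum>j<N. h (x j) * poly (L j) y)) \<le> \<eta>"
        by (rule interpolation_disc[OF \<rho> \<open>\<eta> > 0\<close>, of B]) (rule that)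
      define V where "V y = replace_coord i y v" for y
      have merge_rep: "replace_coord i y (merge (insert i J) v w) = merge J (V y) w" for y w
        using insert.hyps by (auto simp: merge_def V_def replace_coord_def vec_eq_iff)
      have VK: "V (x j) \<in> K" for j
        using insert.prems x by (auto simp: V_def K_def replace_coord_def)
      show "\<exists>h. approx h \<and> (\<forall>w\<in>K. norm (f (merge (insert i J) v w) - h w) \<le> \<eta>)"
      proof (intro exI conjI ballI)
        show "approx (\<lambda>w. \<Sum>j<N. f (merge J (V (x j)) w) * poly (L j) (w $ i))"
          by (intro approx_sum approx_mult insert.IH VK)
        fix w assume w: "w \<in> K"
        define u where "u = merge (insert i J) v w"
        have u: "norm (u $ j) < R" for j
          using w insert.prems \<rho> by (auto simp: u_def merge_def K_def intro: order_le_less_trans)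
        have "norm (f (replace_coord i (w $ i) u) - (\<Sum>j<N. f (replace_coord i (x j) u) * poly (L j) (w $ i))) \<le> \<eta>"
          using w u by (intro L[rule_format, of "\<lambda>y. f (replace_coord i y u)"] conjI ballI hol B) (auto simp: K_def replace_coord_def)
        moreover have "replace_coord i (w $ i) u = u"
          by (auto simp: u_def merge_def replace_coord_def vec_eq_iff)
        ultimately show "norm (f (merge (insert i J) v w) - (\<Sum>j<N. f (merge J (V (x j)) w) * poly (L j) (w $ i))) \<le> \<eta>"
          by (simp add: u_def merge_rep)
      qed
    qed
  qed
  have "0 \<in> K" using \<rho> by (simp add: K_def)
  moreover have "merge UNIV 0 w = w" for w by (simp add: merge_def vec_eq_iff)
  ultimately have "approx f" using main[of UNIV 0] by simp
  then show thesis using \<eta> that unfolding approx_def K_def by auto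
qed

section \<open>The origin is an interior point of the domain\<close>

lemma multiset_indexed_by_finite_type:
  fixes A :: "'a multiset"
  assumes "size A = CARD('n::finite)"
  obtains x :: "'n::finite \<Rightarrow> 'a" where "A = image_mset x (mset_set UNIV)"
proof -
  obtain xs where xs: "mset xs = A" using ex_mset by blast
  then have len: "length xs = CARD('n)" using assms by auto
  obtain b where b: "bij_betw b (UNIV :: 'n set) {..<CARD('n)}"
    using ex_bij_betw_finite_nat[of "UNIV :: 'n set"] by (auto simp: atLeast0LessThan)
  have "image_mset (\<lambda>j. xs ! b j) (mset_set UNIV) = image_mset ((!) xs) (image_mset b (mset_set UNIV))"
    by (simp add: multiset.map_comp o_def)
  also have "image_mset b (mset_set UNIV) = mset_set {..<length xs}"
    using b by (simp add: image_mset_mset_set bij_betw_def len)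
  also have "image_mset ((!) xs) (mset_set {..<length xs}) = mset xs"
    by (metis atLeast0LessThan map_nth mset_map mset_upt)
  finally show thesis using xs by (intro that[of "\<lambda>j. xs ! b j"]) simp
qed

text \<open>
  Vieta's formula: expand the product over all subsets and collect the subsets of size \<open>k\<close>.
\<close>

lemma vieta_coeff:
  fixes x :: "complex ^ 'n::finite"
  assumes k: "k \<le> CARD('n)"
  shows "coeff (\<Prod>j\<in>UNIV. [:- (x $ j), 1:]) (CARD('n) - k) = (-1) ^ k * elem_sym k x"
proof -
  have "(\<Prod>j\<in>UNIV. [:- (x $ j), 1:]) = (\<Prod>j\<in>UNIV. [:- (x $ j):] + [:0, 1:])" by simp
  also have "\<dots> = (\<Sum>S\<in>Pow UNIV. (\<Prod>j\<in>S. [:- (x $ j):]) * (\<Prod>j\<in>UNIV - S. [:0, 1:]))"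
    by (rule prod_add) simp
  also have "\<dots> = (\<Sum>S\<in>UNIV. monom (\<Prod>j\<in>S. - (x $ j)) (CARD('n) - card S))"
  proof (rule sum.cong)
    fix S :: "'n set"
    have "(\<Prod>j\<in>S. [:- (x $ j):]) = [:\<Prod>j\<in>S. - (x $ j):]"
      by (induction S rule: infinite_finite_induct) (simp_all add: one_pCons)
    moreover have "(\<Prod>j\<in>UNIV - S. [:0, 1 :: complex:]) = monom 1 (CARD('n) - card S)"
      by (simp add: card_Diff_subset monom_altdef)
    ultimately show "(\<Prod>j\<in>S. [:- (x $ j):]) * (\<Prod>j\<in>UNIV - S. [:0, 1:])
        = monom (\<Prod>j\<in>S. - (x $ j)) (CARD('n) - card S)"
      by (simp add: smult_monom)
  qed simp
  finally have "coeff (\<Prod>j\<in>UNIV. [:- (x $ j), 1:]) (CARD('n) - k)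
      = (\<Sum>S\<in>UNIV. if CARD('n) - card S = CARD('n) - k then \<Prod>j\<in>S. - (x $ j) else 0)"
    by (simp add: coeff_sum)
  also have "\<dots> = (\<Sum>S\<in>UNIV. if card S = k then \<Prod>j\<in>S. - (x $ j) else 0)"
  proof (rule sum.cong)
    fix S :: "'n set"
    have "card S \<le> CARD('n)" by (rule card_mono) auto
    then have "CARD('n) - card S = CARD('n) - k \<longleftrightarrow> card S = k" using k by linarith
    then show "(if CARD('n) - card S = CARD('n) - k then \<Prod>j\<in>S. - (x $ j) else 0)
        = (if card S = k then \<Prod>j\<in>S. - (x $ j) else 0)" by simp
  qed simp
  also have "\<dots> = (\<Sum>S | card S = k. \<Prod>j\<in>S. - (x $ j))"
    by (simp add: sum.If_cases)
  also have "\<dots> = (\<Sum>S | card S = k. (-1) ^ k * (\<Prod>j\<in>S. x $ j))"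
  proof (rule sum.cong)
    fix S assume "S \<in> {S :: 'n set. card S = k}"
    then show "(\<Prod>j\<in>S. - (x $ j)) = (-1) ^ k * (\<Prod>j\<in>S. x $ j)"
      using prod.distrib[of "\<lambda>_. - 1" "\<lambda>j. x $ j" S] by simp
  qed simp
  finally show ?thesis by (simp add: elem_sym_def sum_distrib_left)
qed

text \<open>
  The \<open>x\<^sub>j\<close> are the roots of the monic polynomial with coefficients \<open>(-1)\<^sup>k e\<^sub>k\<close>.  A root of modulus at
  least \<open>1\<close> would have \<open>\<bar>x\<bar>\<^sup>d \<le> \<Sum>\<^sub>k \<bar>e\<^sub>k\<bar> \<bar>x\<bar>\<^bsup>d-1\<^esup> < \<bar>x\<bar>\<^bsup>d-1\<^esup>\<close>; this is where the bound \<open>1/d\<close> comes from.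
\<close>

lemma elem_sym_surjective:
  fixes e :: "nat \<Rightarrow> complex"
  assumes small: "\<And>k. 1 \<le> k \<Longrightarrow> k \<le> CARD('n) \<Longrightarrow> norm (e k) < 1 / CARD('n)"
  obtains x :: "complex ^ 'n::finite" where "\<And>j. norm (x $ j) < 1"
    "\<And>k. 1 \<le> k \<Longrightarrow> k \<le> CARD('n) \<Longrightarrow> elem_sym k x = e k"
proof -
  define d where "d = CARD('n)"
  have d: "d > 0" by (simp add: d_def)
  define p where "p = monom 1 d + (\<Sum>k=1..d. monom ((-1) ^ k * e k) (d - k))"
  have coeff_p: "coeff p (d - k) = (-1) ^ k * e k" if k: "1 \<le> k" "k \<le> d" for k
  proof -
    have "coeff p (d - k) = (\<Sum>l=1..d. if d - l = d - k then (-1) ^ l * e l else 0)"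
      using k d by (simp add: p_def coeff_sum)
    also have "\<dots> = (\<Sum>l=1..d. if l = k then (-1) ^ l * e l else 0)"
      using k by (intro sum.cong) auto
    finally show ?thesis using k by simp
  qed
  have deg_tail: "coeff (\<Sum>k=1..d. monom ((-1) ^ k * e k) (d - k)) n = 0" if "n \<ge> d" for n
    unfolding coeff_sum coeff_monom using that by (intro sum.neutral) auto
  have lead: "coeff p d = 1" using deg_tail[of d] by (simp add: p_def)
  have deg: "degree p = d"
  proof (rule antisym)
    show "degree p \<le> d"
      by (rule degree_le) (use deg_tail in \<open>auto simp: p_def\<close>)
    show "d \<le> degree p" by (rule le_degree) (simp add: lead)
  qed
  then have "p \<noteq> 0" using lead by auto
  then obtain A where A: "size A = degree p" "p = smult (lead_coeff p) (\<Prod>x\<in>#A. [:-x, 1:])"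
    using alg_closed_imp_factorization[OF \<open>p \<noteq> 0\<close>] by blast
  obtain x where x: "A = image_mset x (mset_set (UNIV :: 'n set))"
    using multiset_indexed_by_finite_type[of A] A(1) deg unfolding d_def by metis
  have p_prod: "p = (\<Prod>j\<in>UNIV. [:- ((\<chi> j. x j) $ j), 1:])"
    using A(2) by (simp add: x deg lead multiset.map_comp o_def prod_unfold_prod_mset)
  have "norm (x j) < 1" for j
  proof (rule ccontr)
    assume "\<not> norm (x j) < 1"
    then have ge: "norm (x j) \<ge> 1" by simp
    have "poly p (x j) = 0" unfolding p_prod poly_prod by (rule prod_zero) auto
    then have "x j ^ d = - (\<Sum>k=1..d. (-1) ^ k * e k * x j ^ (d - k))"
      by (simp add: p_def poly_sum poly_monom eq_neg_iff_add_eq_0)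
    then have "norm (x j) ^ d = norm (\<Sum>k=1..d. (-1) ^ k * e k * x j ^ (d - k))"
      by (metis norm_minus_cancel norm_power)
    also have "\<dots> \<le> (\<Sum>k=1..d. norm (e k) * norm (x j) ^ (d - 1))"
      using ge by (intro sum_norm_le) (auto simp: norm_mult norm_power intro!: mult_left_mono power_increasing)
    also have "\<dots> < (\<Sum>k=1..d. 1 / d * norm (x j) ^ (d - 1))"
    proof (rule sum_strict_mono)
      fix k assume "k \<in> {1..d}"
      then show "norm (e k) * norm (x j) ^ (d - 1) < 1 / d * norm (x j) ^ (d - 1)"
        using small[of k] ge by (intro mult_strict_right_mono) (auto simp: d_def intro: less_le_trans[OF zero_less_one])
    qed (use d in auto)
    also have "\<dots> = norm (x j) ^ (d - 1)" using d by simp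
    also have "\<dots> \<le> norm (x j) ^ d" using ge by (intro power_increasing) auto
    finally show False by simp
  qed
  moreover have "elem_sym k (\<chi> j. x j) = e k" if "1 \<le> k" "k \<le> CARD('n)" for k
    using vieta_coeff[OF that(2), of "\<chi> j. x j"] coeff_p[of k] that p_prod by (simp add: d_def)
  ultimately show thesis by (intro that[of "\<chi> j. x j"]) auto
qed

text \<open>
  Prescribe the elementary symmetric polynomials of \<open>z\<^sub>1\<^sup>m, \<dots>, z\<^sub>d\<^sup>m\<close>, the last one being \<open>w\<^sub>d\<^sup>t\<close>, and take
  \<open>m\<close>-th roots.  Then \<open>(z\<^sub>1 \<cdots> z\<^sub>d)\<^bsup>m/t\<^esup>\<close> agrees with \<open>w\<^sub>d\<close> up to a \<open>t\<close>-th root of unity, which is removed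
  by multiplying a single coordinate by an \<open>m\<close>-th root of unity \<open>\<eta>\<close>.
\<close>

lemma small_polydisc_in_theta_domain:
  fixes w :: "('n::{finite,linorder}) cspace"
  assumes m: "m > 0" and t: "t > 0" "t dvd m" and small: "\<And>j. norm (w $ j) < 1 / CARD('n)"
  shows "w \<in> theta_domain m t"
proof -
  define d where "d = CARD('n)"
  have d: "d > 0" by (simp add: d_def)
  obtain l :: 'n where l: "coord_index l = d"
    using coord_index_exists[of d] d by (auto simp: d_def)
  have coord_inj: "i = j" if "coord_index i = coord_index j" for i j :: 'n
    using coord_index_bij[where 'n = 'n] that by (auto simp: bij_betw_def inj_on_def)
  \<comment> \<open>The prescribed values of the elementary symmetric polynomials of the \<open>m\<close>-th powers.\<close>
  define e where "e k = (if k = d then (w $ l) ^ t else w $ (THE i. coord_index i = k))" for k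
  have e_coord: "e (coord_index i) = w $ i" if "coord_index i < d" for i
  proof -
    have "(THE j. coord_index j = coord_index i) = i" by (rule the_equality) (auto dest: coord_inj)
    then show ?thesis using that by (simp add: e_def)
  qed
  have "1 / real d \<le> 1" using d by simp
  then have "norm (w $ l) \<le> 1" using small[of l] unfolding d_def by linarith
  then have "norm (w $ l) ^ t \<le> norm (w $ l) ^ 1" using t by (intro power_decreasing) auto
  then have "norm ((w $ l) ^ t) < 1 / d" using small[of l] by (simp add: norm_power d_def)
  then have "norm (e k) < 1 / CARD('n)" for k using small by (simp add: e_def d_def)
  then obtain x :: "'n cspace" where x: "\<And>j. norm (x $ j) < 1"
    "\<And>k. 1 \<le> k \<Longrightarrow> k \<le> CARD('n) \<Longrightarrow> elem_sym k x = e k"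
    using elem_sym_surjective[of e] by blast
  have "\<exists>z. z ^ m = x $ j" for j using nth_root_exists[of m "x $ j"] m by auto
  then obtain z where z: "\<And>j. z j ^ m = x $ j" by metis
  have nz: "norm (z j) < 1" for j
  proof (rule ccontr)
    assume "\<not> norm (z j) < 1"
    then have "1 \<le> norm (z j) ^ m" by (intro one_le_power) simp
    then show False using x(1)[of j] z[of j] by (metis norm_power not_less)
  qed
  define y where "y = (\<Prod>j\<in>UNIV. z j) ^ (m div t)"
  have "elem_sym d x = (\<Prod>j\<in>UNIV. x $ j)"
  proof -
    have "{S. S \<subseteq> (UNIV :: 'n set) \<and> card S = d} = {UNIV}"
      using card_subset_eq[of "UNIV :: 'n set"] by (auto simp: d_def)
    then show ?thesis by (simp add: elem_sym_def)
  qed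
  then have "(\<Prod>j\<in>UNIV. z j) ^ m = (w $ l) ^ t"
    using x(2)[of d] d by (simp add: prod_power_distrib z e_def d_def)
  then have yt: "y ^ t = (w $ l) ^ t" using t by (simp add: y_def power_mult[symmetric])
  have "m div t > 0" using m t by (simp add: div_greater_zero_iff dvd_imp_le)
  have "\<exists>\<eta>. \<eta> ^ (m div t) * y = w $ l \<and> \<eta> ^ m = 1"
  proof (cases "w $ l = 0")
    case True
    then have "y = 0" using yt t(1) by (simp add: zero_power)
    then show ?thesis using True by (intro exI[of _ 1]) simp
  next
    case False
    then have "y \<noteq> 0" using yt t(1) by (metis power_eq_0_iff zero_power)
    obtain \<eta> where \<eta>: "\<eta> ^ (m div t) = w $ l / y"
      using nth_root_exists[of "m div t" "w $ l / y"] \<open>m div t > 0\<close> by auto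
    have "\<eta> ^ m = (\<eta> ^ (m div t)) ^ t" using t by (simp add: power_mult[symmetric])
    also have "\<dots> = 1" using yt False by (simp add: \<eta> power_divide)
    finally show ?thesis using \<eta> \<open>y \<noteq> 0\<close> by (intro exI[of _ \<eta>]) simp
  qed
  then obtain \<eta> where \<eta>: "\<eta> ^ (m div t) * y = w $ l" "\<eta> ^ m = 1" by blast
  have "norm \<eta> ^ m = 1" using \<eta>(2) by (metis norm_one norm_power)
  then have "norm \<eta> = 1" using m by (metis norm_ge_zero power_eq_1_iff abs_norm_cancel gr_implies_not0 real_norm_def)
  define z' where "z' = (\<chi> j. (if j = l then \<eta> else 1) * z j)"
  have "z' \<in> polydisc" using nz \<open>norm \<eta> = 1\<close> by (simp add: z'_def polydisc_def norm_mult)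
  moreover have "theta m t z' = w"
  proof -
    have "(\<chi> j. (z' $ j) ^ m) = x" by (simp add: z'_def vec_eq_iff power_mult_distrib \<eta> z)
    moreover have "(\<Prod>j\<in>UNIV. z' $ j) ^ (m div t) = w $ l"
      using \<eta>(1) by (simp add: z'_def prod.distrib y_def power_mult_distrib)
    moreover have "i = l" if "\<not> coord_index i < CARD('n)" for i
      using that coord_index_bounds(2)[of i] l by (intro coord_inj) (simp add: d_def)
    moreover have "elem_sym (coord_index i) x = w $ i" if "coord_index i < CARD('n)" for i
      using x(2)[of "coord_index i"] e_coord[of i] coord_index_bounds[of i] that by (simp add: d_def)
    ultimately show ?thesis by (auto simp: theta_def vec_eq_iff)
  qed
  ultimately show ?thesis unfolding theta_domain_def by blast
qed

section \<open>Density of the polynomials\<close>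

text \<open>
  If \<open>h\<close> is close to a polynomial on a small disc, then by Cauchy's inequality their Taylor
  coefficients are close, and the first \<open>n\<close> coefficients of the polynomial reproduce \<open>h\<close> at a
  point \<open>r\<close> far outside that small disc.
\<close>

lemma taylor_coeffs_near_polynomial:
  fixes h :: "complex \<Rightarrow> complex" and Q :: "nat \<Rightarrow> complex"
  assumes h: "h holomorphic_on ball 0 1" and B: "\<And>x. norm x < 1 \<Longrightarrow> norm (h x) \<le> B"
    and \<delta>: "0 < \<delta>" "\<delta> < 1" and close: "\<And>x. norm x \<le> \<delta> \<Longrightarrow> norm (h x - (\<Sum>k\<le>M. Q k * x ^ k)) \<le> \<eta>"
    and r: "0 \<le> r" "r < s" "s < 1"
  shows "norm (h (complex_of_real r) - (\<Sum>k<n. (if k \<le> M then Q k else 0) * complex_of_real r ^ k))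
    \<le> B * (r / s) ^ n / (1 - r / s) + (\<Sum>k<n. \<eta> / \<delta> ^ k)"
proof -
  define a where "a k = (deriv ^^ k) h 0 / fact k" for k
  define g where "g x = (\<Sum>k\<le>M. Q k * x ^ k)" for x
  define G where "G = (\<Sum>k\<le>M. fps_const (Q k) * fps_X ^ k)"
  have "h analytic_on {0}" using h analytic_on_open[of "ball 0 1" h] by (auto intro: analytic_on_subset)
  then have exp_h: "h has_fps_expansion fps_expansion h 0" by (rule analytic_at_imp_has_fps_expansion_0)
  have exp_g: "g has_fps_expansion G" unfolding g_def G_def by (intro fps_expansion_intros)
  have nth_G: "fps_nth G k = (if k \<le> M then Q k else 0)" for k
    unfolding G_def fps_sum_nth by (simp add: if_distrib cong: if_cong)
  have coef: "(deriv ^^ k) (\<lambda>x. h x - g x) 0 / fact k = a k - (if k \<le> M then Q k else 0)" for k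
    using fps_nth_fps_expansion[OF has_fps_expansion_diff[OF exp_h exp_g], of k]
      fps_nth_fps_expansion[OF exp_h, of k]
    by (simp add: a_def nth_G)
  have hol: "(\<lambda>x. h x - g x) holomorphic_on ball 0 1" unfolding g_def by (intro holomorphic_intros h)
  have cbound: "norm (a k - (if k \<le> M then Q k else 0)) \<le> \<eta> / \<delta> ^ k" for k
  proof -
    have "norm ((deriv ^^ k) (\<lambda>x. h x - g x) 0) \<le> fact k * \<eta> / \<delta> ^ k"
    proof (rule Cauchy_inequality)
      show "(\<lambda>x. h x - g x) holomorphic_on ball 0 \<delta>"
        using hol by (rule holomorphic_on_subset) (use \<delta> in auto)
      show "continuous_on (cball 0 \<delta>) (\<lambda>x. h x - g x)"
        by (rule holomorphic_on_imp_continuous_on, rule holomorphic_on_subset[OF hol]) (use \<delta> in auto)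
      show "norm (h x - g x) \<le> \<eta>" if "norm (0 - x) = \<delta>" for x
        using close[of x] that by (simp add: g_def)
    qed (rule \<delta>)
    then show ?thesis unfolding coef[symmetric] by (simp add: norm_divide field_simps)
  qed
  have "norm (h (complex_of_real r) - (\<Sum>k<n. a k * complex_of_real r ^ k)) \<le> B * (r / s) ^ n / (1 - r / s)"
    unfolding a_def by (rule taylor_remainder[OF h]) (use B r in auto)
  moreover have "norm (\<Sum>k<n. (a k - (if k \<le> M then Q k else 0)) * complex_of_real r ^ k) \<le> (\<Sum>k<n. \<eta> / \<delta> ^ k)"
  proof (rule sum_norm_le)
    fix k
    have "norm (complex_of_real r ^ k) \<le> 1" using r by (simp add: norm_power power_le_one)
    then have "norm (a k - (if k \<le> M then Q k else 0)) * norm (complex_of_real r ^ k) \<le> \<eta> / \<delta> ^ k * 1"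
      using cbound[of k] by (intro mult_mono) (auto intro: order_trans[OF norm_ge_zero])
    then show "norm ((a k - (if k \<le> M then Q k else 0)) * complex_of_real r ^ k) \<le> \<eta> / \<delta> ^ k"
      by (simp add: norm_mult)
  qed
  moreover have "h (complex_of_real r) - (\<Sum>k<n. (if k \<le> M then Q k else 0) * complex_of_real r ^ k)
      = (h (complex_of_real r) - (\<Sum>k<n. a k * complex_of_real r ^ k))
        + (\<Sum>k<n. (a k - (if k \<le> M then Q k else 0)) * complex_of_real r ^ k)"
    by (simp add: left_diff_distrib sum_subtractf)
  ultimately show ?thesis
    by (simp only:) (rule order_trans[OF norm_triangle_ineq add_mono])
qed

lemma norm_weighted_scale_le:
  assumes "m > 0" "t > 0" "t dvd m" and c: "norm c \<le> \<delta>" "\<delta> \<le> 1" and w: "norm w \<le> K"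
  shows "norm (weighted_scale m t c w $ i) \<le> \<delta> * K"
proof -
  have "norm c ^ weight m t i \<le> norm c ^ 1"
    using weight_pos[OF assms(1-3), of i] c by (intro power_decreasing) auto
  then have "norm c ^ weight m t i \<le> \<delta>" using c by simp
  moreover have "norm (w $ i) \<le> K" using w Finite_Cartesian_Product.norm_nth_le order_trans by blast
  moreover have "0 \<le> \<delta>" using c(1) norm_ge_zero[of c] by linarith
  ultimately have "norm c ^ weight m t i * norm (w $ i) \<le> \<delta> * K"
    by (intro mult_mono) auto
  then show ?thesis by (simp add: weighted_scale_def norm_mult norm_power)
qed

text \<open>
  The parameters are chosen in the order \<open>r\<close> (dilation), \<open>n\<close> (length of the Taylor section), \<open>\<eta>0\<close>
  (accuracy near the origin): the loss from the small scale \<open>\<delta>\<close> to the scale \<open>r\<close> is a factor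
  of order \<open>\<delta>\<^bsup>-n\<^esup>\<close>, which is known before \<open>\<eta>0\<close> is chosen.
\<close>

lemma poly_fun_dense:
  fixes f :: "('n::{finite,linorder}) cspace \<Rightarrow> complex"
  assumes mt: "m > 0" "t > 0" "t dvd m" and f: "f \<in> theta_algebra m t" and \<eta>: "\<eta> > 0"
  obtains q where "q \<in> poly_fun" "\<And>w. w \<in> theta m t ` closed_polydisc \<Longrightarrow> norm (f w - q w) \<le> \<eta>"
proof -
  note fD = theta_algebraD[OF f]
  define X where "X = theta m t ` (closed_polydisc :: 'n cspace set)"
  have "compact X" unfolding X_def
    by (intro compact_continuous_image continuous_on_theta compact_closed_polydisc)
  then obtain K where K: "K > 0" "\<And>w. w \<in> X \<Longrightarrow> norm w \<le> K"
    using compact_imp_bounded[of X] unfolding bounded_pos by auto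
  have "compact (f ` X)" using fD(1) \<open>compact X\<close> by (auto simp: X_def intro: compact_continuous_image)
  then obtain B where B: "B > 0" "\<And>w. w \<in> X \<Longrightarrow> norm (f w) \<le> B"
    using compact_imp_bounded[of "f ` X"] unfolding bounded_pos by auto
  have dom_X: "theta_domain m t \<subseteq> X"
    unfolding theta_domain_def X_def by (auto simp: polydisc_def closed_polydisc_def less_imp_le)
  have "\<eta> / 2 > 0" using \<eta> by simp
  then obtain r where r: "0 < r" "r < 1" and close:
    "\<And>z. z \<in> closed_polydisc \<Longrightarrow> norm (f (theta m t (complex_of_real r *s z)) - f (theta m t z)) < \<eta> / 2"
    using dilation_uniform[OF fD(1)] by blast
  define s where "s = (1 + r) / 2"
  have s: "r < s" "s < 1" "s > 0" using r by (auto simp: s_def)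
  have "(\<lambda>n. B * (r / s) ^ n / (1 - r / s)) \<longlonglongrightarrow> B * 0 / (1 - r / s)"
    using r s by (intro tendsto_divide tendsto_mult tendsto_const LIMSEQ_power_zero) auto
  then have "eventually (\<lambda>n. B * (r / s) ^ n / (1 - r / s) < \<eta> / 4) sequentially"
    using \<eta> by (intro order_tendstoD) auto
  then obtain n where n: "B * (r / s) ^ n / (1 - r / s) < \<eta> / 4"
    unfolding eventually_sequentially by blast
  define R where "R = 1 / real CARD('n)"
  define \<rho> where "\<rho> = R / 2"
  have "R > 0" by (simp add: R_def)
  then have R: "0 < \<rho>" "\<rho> < R" by (auto simp: \<rho>_def)
  define \<delta> where "\<delta> = min (1/2) (\<rho> / K)"
  have \<delta>: "0 < \<delta>" "\<delta> < 1" using R K by (auto simp: \<delta>_def)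
  have "\<delta> * K \<le> \<rho>" using K by (auto simp: \<delta>_def min_def field_simps)
  define \<sigma> where "\<sigma> = (\<Sum>k<n. 1 / \<delta> ^ k)"
  have "\<sigma> \<ge> 0" unfolding \<sigma>_def using \<delta> by (intro sum_nonneg) auto
  define \<eta>0 where "\<eta>0 = \<eta> / 4 / (\<sigma> + 1)"
  have \<eta>0: "\<eta>0 > 0" using \<eta> \<open>\<sigma> \<ge> 0\<close> by (simp add: \<eta>0_def)
  have "(\<Sum>k<n. \<eta>0 / \<delta> ^ k) = \<eta>0 * \<sigma>" by (simp add: \<sigma>_def sum_distrib_left)
  also have "\<dots> \<le> \<eta> / 4" using \<eta> \<open>\<sigma> \<ge> 0\<close> by (simp add: \<eta>0_def field_simps)
  finally have sum_le: "(\<Sum>k<n. \<eta>0 / \<delta> ^ k) \<le> \<eta> / 4" .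
  have near0: "w \<in> theta_domain m t" if "\<And>j. norm (w $ j) < R" for w :: "'n cspace"
    using small_polydisc_in_theta_domain[OF mt, of w] that by (simp add: R_def)
  obtain q0 where q0: "q0 \<in> poly_fun" "\<forall>w. (\<forall>j. norm (w $ j) \<le> \<rho>) \<longrightarrow> norm (f w - q0 w) \<le> \<eta>0"
  proof (rule separately_holomorphic_approx[OF R \<eta>0, of f B])
    fix i and w :: "'n cspace" assume w: "\<And>j. norm (w $ j) < R"
    show "(\<lambda>x. f (replace_coord i x w)) holomorphic_on ball 0 R"
    proof (rule holomorphic_several_comp_curve[OF fD(2)])
      show "replace_coord i x w \<in> theta_domain m t" if "x \<in> ball 0 R" for x
        using that w by (intro near0) (auto simp: replace_coord_def)
      show "(\<lambda>x. replace_coord i x w $ j) holomorphic_on ball 0 R" for j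
        by (cases "j = i") (auto simp: replace_coord_def intro!: holomorphic_intros)
    qed simp
  next
    fix w :: "'n cspace" assume "\<And>j. norm (w $ j) < R"
    then show "norm (f w) \<le> B" using near0 dom_X B(2) by blast
  qed (rule that)
  obtain M Q where Q: "\<And>k. Q k \<in> poly_fun"
    "\<And>c w. q0 (weighted_scale m t c w) = (\<Sum>k\<le>M. Q k w * c ^ k)"
    using poly_fun_weighted_components[OF q0(1), of m t] by metis
  define q where "q w = (\<Sum>k<n. (if k \<le> M then Q k w else 0) * complex_of_real r ^ k)" for w
  have "q \<in> poly_fun"
  proof -
    have "(\<lambda>w. if k \<le> M then Q k w else 0) \<in> poly_fun" for k
      by (cases "k \<le> M") (auto intro: Q poly_fun.const)
    then show ?thesis unfolding q_def[abs_def]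
      by (intro poly_fun_sum poly_fun.mult poly_fun.const)
  qed
  moreover have "norm (f w - q w) \<le> \<eta>" if w: "w \<in> X" for w
  proof -
    obtain z where z: "z \<in> closed_polydisc" "w = theta m t z" using w by (auto simp: X_def)
    define h where "h c = f (weighted_scale m t c w)" for c
    have h_eq: "h c = f (theta m t (c *s z))" for c by (simp add: h_def z theta_scale)
    have inside: "theta m t (c *s z) \<in> theta_domain m t" if "norm c < 1" for c
      using scale_closed_polydisc[OF that z(1)] by (auto simp: theta_domain_def)
    have "norm (h (complex_of_real r) - (\<Sum>k<n. (if k \<le> M then Q k w else 0) * complex_of_real r ^ k))
        \<le> B * (r / s) ^ n / (1 - r / s) + (\<Sum>k<n. \<eta>0 / \<delta> ^ k)"
    proof (rule taylor_coeffs_near_polynomial[OF _ _ \<delta>])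
      show "h holomorphic_on ball 0 1"
        unfolding h_eq
      proof (rule holomorphic_several_comp_curve[OF fD(2)])
        show "(\<lambda>c. theta m t (c *s z) $ i) holomorphic_on ball 0 1" for i
          by (intro theta_curve_holomorphic) (simp, intro holomorphic_intros)
      qed (use inside in auto)
      show "norm (h c) \<le> B" if "norm c < 1" for c
        unfolding h_eq using inside[OF that] dom_X B(2) by blast
      show "norm (h c - (\<Sum>k\<le>M. Q k w * c ^ k)) \<le> \<eta>0" if c: "norm c \<le> \<delta>" for c
      proof -
        have "norm (weighted_scale m t c w $ j) \<le> \<rho>" for j
          using norm_weighted_scale_le[OF mt c _ K(2)[OF \<open>w \<in> X\<close>], of j] \<delta> \<open>\<delta> * K \<le> \<rho>\<close> by linarith
        with q0(2) have "norm (f (weighted_scale m t c w) - q0 (weighted_scale m t c w)) \<le> \<eta>0" by blast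
        then show ?thesis by (simp add: h_def Q(2))
      qed
    qed (use r s in auto)
    then have 1: "norm (h (complex_of_real r) - q w) \<le> \<eta> / 4 + \<eta> / 4"
      using n sum_le unfolding q_def by linarith
    have 2: "norm (f w - h (complex_of_real r)) \<le> \<eta> / 2"
      using close[OF z(1)] by (simp add: h_eq z(2) norm_minus_commute)
    have "norm (f w - q w) \<le> norm (f w - h (complex_of_real r)) + norm (h (complex_of_real r) - q w)"
      using norm_triangle_ineq[of "f w - h (complex_of_real r)" "h (complex_of_real r) - q w"] by simp
    then show ?thesis using 1 2 by linarith
  qed
  ultimately show thesis using that[of q] by (simp add: X_def)
qed

section \<open>The function algebra and its Hilbert modules\<close>

lemma holomorphic_several_const: "holomorphic_several (\<lambda>w. c) W"
  unfolding holomorphic_several_def by (auto intro!: exI[of _ "\<lambda>_. 0"])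

lemma holomorphic_several_coord: "holomorphic_several (\<lambda>w. w $ i) W"
  unfolding holomorphic_several_def
  by (auto intro!: exI[of _ "\<lambda>w. w $ i"] bounded_linear_imp_has_derivative bounded_linear_vec_nth)

lemma holomorphic_several_add:
  assumes "holomorphic_several f W" "holomorphic_several g W"
  shows "holomorphic_several (\<lambda>w. f w + g w) W"
  unfolding holomorphic_several_def
proof
  fix z assume "z \<in> W"
  then obtain f' g' where f': "(f has_derivative f') (at z within W)" "\<And>c v. f' (c *s v) = c * f' v"
    and g': "(g has_derivative g') (at z within W)" "\<And>c v. g' (c *s v) = c * g' v"
    using assms unfolding holomorphic_several_def by meson
  show "\<exists>h'. ((\<lambda>w. f w + g w) has_derivative h') (at z within W) \<and> (\<forall>c v. h' (c *s v) = c * h' v)"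
    using has_derivative_add[OF f'(1) g'(1)] f'(2) g'(2)
    by (intro exI[of _ "\<lambda>v. f' v + g' v"]) (simp add: distrib_left)
qed

lemma holomorphic_several_mult:
  assumes "holomorphic_several f W" "holomorphic_several g W"
  shows "holomorphic_several (\<lambda>w. f w * g w) W"
  unfolding holomorphic_several_def
proof
  fix z assume "z \<in> W"
  then obtain f' g' where f': "(f has_derivative f') (at z within W)" "\<And>c v. f' (c *s v) = c * f' v"
    and g': "(g has_derivative g') (at z within W)" "\<And>c v. g' (c *s v) = c * g' v"
    using assms unfolding holomorphic_several_def by meson
  show "\<exists>h'. ((\<lambda>w. f w * g w) has_derivative h') (at z within W) \<and> (\<forall>c v. h' (c *s v) = c * h' v)"
    using has_derivative_mult[OF f'(1) g'(1)] f'(2) g'(2)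
    by (intro exI[of _ "\<lambda>v. f z * g' v + f' v * g z"]) (simp add: algebra_simps)
qed

lemma holomorphic_several_inverse:
  assumes "holomorphic_several f W" "\<And>w. w \<in> W \<Longrightarrow> f w \<noteq> 0"
  shows "holomorphic_several (\<lambda>w. inverse (f w)) W"
  unfolding holomorphic_several_def
proof
  fix z assume z: "z \<in> W"
  then obtain f' where f': "(f has_derivative f') (at z within W)" "\<And>c v. f' (c *s v) = c * f' v"
    using assms unfolding holomorphic_several_def by meson
  show "\<exists>h'. ((\<lambda>w. inverse (f w)) has_derivative h') (at z within W) \<and> (\<forall>c v. h' (c *s v) = c * h' v)"
    using Deriv.has_derivative_inverse[OF assms(2)[OF z] f'(1)] f'(2)
    by (intro exI[of _ "\<lambda>v. - (inverse (f z) * f' v * inverse (f z))"]) simp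
qed

lemma holomorphic_several_cong:
  assumes "holomorphic_several f W" "\<And>w. w \<in> W \<Longrightarrow> g w = f w"
  shows "holomorphic_several g W"
  unfolding holomorphic_several_def
proof
  fix z assume z: "z \<in> W"
  then obtain f' where f': "(f has_derivative f') (at z within W)" "\<And>c v. f' (c *s v) = c * f' v"
    using assms unfolding holomorphic_several_def by meson
  have "(g has_derivative f') (at z within W)"
    by (rule has_derivative_transform[OF z _ f'(1)]) (use assms(2) in auto)
  then show "\<exists>g'. (g has_derivative g') (at z within W) \<and> (\<forall>c v. g' (c *s v) = c * g' v)"
    using f'(2) by blast
qed

lemma restrict_fun_in_theta_algebra:
  assumes "continuous_on (closure (theta_domain m t)) g" "holomorphic_several g (theta_domain m t)"
  shows "restrict_fun (closure (theta_domain m t)) g \<in> theta_algebra m t"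
proof -
  have "continuous_on (closure (theta_domain m t)) (restrict_fun (closure (theta_domain m t)) g)"
    using assms(1) by (rule continuous_on_cong[THEN iffD1, rotated -1]) (auto simp: restrict_fun_def)
  moreover have "holomorphic_several (restrict_fun (closure (theta_domain m t)) g) (theta_domain m t)"
    using closure_subset by (intro holomorphic_several_cong[OF assms(2)]) (auto simp: restrict_fun_def)
  ultimately show ?thesis by (auto simp: theta_algebra_def cont_algebra_def restrict_fun_def)
qed

lemma theta_algebra_add:
  assumes "f \<in> theta_algebra m t" "g \<in> theta_algebra m t"
  shows "(\<lambda>w. f w + g w) \<in> theta_algebra m t"
  using assms holomorphic_several_add unfolding theta_algebra_def cont_algebra_def
  by (auto intro: continuous_intros)

lemma theta_algebra_mult:
  assumes "f \<in> theta_algebra m t" "g \<in> theta_algebra m t"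
  shows "(\<lambda>w. f w * g w) \<in> theta_algebra m t"
  using assms holomorphic_several_mult unfolding theta_algebra_def cont_algebra_def
  by (auto intro: continuous_intros)

lemma theta_algebra_cmult:
  assumes "f \<in> theta_algebra m t"
  shows "(\<lambda>w. c * f w) \<in> theta_algebra m t"
  using assms holomorphic_several_mult[OF holomorphic_several_const] unfolding theta_algebra_def cont_algebra_def
  by (auto intro: continuous_intros)

lemma hilbert_moduleD:
  assumes "hilbert_module X A act"
  shows "f \<in> A \<Longrightarrow> act f (h + k) = act f h + act f k"
    "f \<in> A \<Longrightarrow> g \<in> A \<Longrightarrow> act (\<lambda>x. f x + g x) h = act f h + act g h"
    "f \<in> A \<Longrightarrow> g \<in> A \<Longrightarrow> act (\<lambda>x. f x * g x) h = act f (act g h)"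
    "f \<in> A \<Longrightarrow> act (\<lambda>x. c * f x) h = c *\<^sub>C act f h"
    "f \<in> A \<Longrightarrow> act f (c *\<^sub>C h) = c *\<^sub>C act f h"
    "act (indicator X) h = h"
  using assms unfolding hilbert_module_def by simp_all

text \<open>
  Joint continuity at the origin bounds the action uniformly on the unit balls, by scaling.  For
  \<open>X = {}\<close> the supremum norm has no meaning, but then the only function is \<open>0\<close>.
\<close>

lemma hilbert_module_bounded:
  fixes act :: "('x \<Rightarrow> complex) \<Rightarrow> 'h \<Rightarrow> 'h::complex_hilbert"
  assumes mod: "hilbert_module X A act"
    and A: "\<And>c f. f \<in> A \<Longrightarrow> (\<lambda>x. c * f x) \<in> A" "\<And>f x. f \<in> A \<Longrightarrow> x \<notin> X \<Longrightarrow> f x = 0"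
  obtains C where "C \<ge> 0"
    "\<forall>f\<in>A. \<forall>M>0. (\<forall>x\<in>X. norm (f x) \<le> M) \<longrightarrow> (\<forall>h. norm (act f h) \<le> C * M * norm h)"
proof (cases "A = {}")
  case True
  then show thesis by (intro that[of 0]) auto
next
  case False
  then obtain f0 where "f0 \<in> A" by blast
  have cmult: "act (\<lambda>x. c * f x) h = c *\<^sub>C act f h" "act f (c *\<^sub>C h) = c *\<^sub>C act f h" if "f \<in> A" for f c h
    using hilbert_moduleD(4,5)[OF mod that] .
  have zero: "(\<lambda>x. 0) \<in> A" using A(1)[OF \<open>f0 \<in> A\<close>, of 0] by simp
  have C0: "0 *\<^sub>C x = 0" for x :: 'h using scaleC_of_real[of 0 x] by simp
  have act0: "act (\<lambda>x. 0) h = 0" for h using cmult(1)[OF zero, of 0 h] by (simp add: C0)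
  have "\<forall>f\<in>A. \<forall>h. \<forall>\<epsilon>>0. \<exists>\<delta>>0. \<forall>g\<in>A. \<forall>k.
        sup_norm X (\<lambda>x. g x - f x) < \<delta> \<and> norm (k - h) < \<delta> \<longrightarrow> norm (act g k - act f h) < \<epsilon>"
    using mod unfolding hilbert_module_def by blast
  from this[rule_format, OF zero, of 1 0] obtain \<delta> where \<delta>: "\<delta> > 0"
    "\<And>g k. g \<in> A \<Longrightarrow> sup_norm X g < \<delta> \<Longrightarrow> norm k < \<delta> \<Longrightarrow> norm (act g k) < 1"
    by (auto simp: act0)
  have "\<forall>f\<in>A. \<forall>M>0. (\<forall>x\<in>X. norm (f x) \<le> M) \<longrightarrow> (\<forall>h. norm (act f h) \<le> 4 / \<delta>\<^sup>2 * M * norm h)"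
  proof (intro ballI allI impI)
    fix f M h assume f: "f \<in> A" and M: "(M :: real) > 0" and le: "\<forall>x\<in>X. norm (f x) \<le> M"
    show "norm (act f h) \<le> 4 / \<delta>\<^sup>2 * M * norm h"
    proof (cases "X = {} \<or> h = 0")
      case True
      then have "act f h = 0"
      proof
        assume "X = {}"
        then have "f = (\<lambda>x. 0)" using A(2)[OF f] by auto
        then show ?thesis by (simp add: act0)
      next
        assume "h = 0"
        then show ?thesis using cmult(2)[OF f, of 0 h] by (simp add: C0)
      qed
      then show ?thesis using M by simp
    next
      case False
      define a where "a = \<delta> / (2 * M)"
      define b where "b = \<delta> / (2 * norm h)"
      have ab: "a > 0" "b > 0" using False M \<delta> by (auto simp: a_def b_def)
      have "sup_norm X (\<lambda>x. complex_of_real a * f x) \<le> \<delta> / 2"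
        unfolding sup_norm_def
      proof (rule cSUP_least)
        fix x assume "x \<in> X"
        then have "a * norm (f x) \<le> a * M" using ab le by (intro mult_left_mono) auto
        moreover have "a * M = \<delta> / 2" using M by (simp add: a_def)
        moreover have "norm (complex_of_real a * f x) = a * norm (f x)" using ab by (simp add: norm_mult)
        ultimately show "norm (complex_of_real a * f x) \<le> \<delta> / 2" by linarith
      qed (use False in auto)
      moreover have "norm (complex_of_real b *\<^sub>C h) = \<delta> / 2"
        unfolding scaleC_of_real using False \<delta> by (simp add: b_def)
      ultimately have "norm (act (\<lambda>x. complex_of_real a * f x) (complex_of_real b *\<^sub>C h)) < 1"
        using \<delta>(1) by (intro \<delta>(2) A(1) f) auto
      moreover have "act f (b *\<^sub>R h) = b *\<^sub>R act f h"
        using cmult(2)[OF f, of "complex_of_real b" h] unfolding scaleC_of_real .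
      ultimately have "a * (b * norm (act f h)) < 1"
        using ab by (simp add: cmult[OF f] A(1)[OF f] cmult[OF A(1)[OF f]] scaleC_of_real)
      then show ?thesis using False M \<delta>(1)
        by (simp add: a_def b_def field_simps power2_eq_square)
    qed
  qed
  then show thesis by (rule that[rotated]) simp
qed

lemma hilbert_module_linear:
  fixes act :: "('x \<Rightarrow> complex) \<Rightarrow> 'h \<Rightarrow> 'h::complex_hilbert"
  assumes "hilbert_module X A act" "f \<in> A" "\<And>h. norm (act f h) \<le> C * norm h"
  shows "bounded_linear (act f)"
proof (rule bounded_linear_intro[where K = C])
  show "act f (x + y) = act f x + act f y" for x y by (rule hilbert_moduleD(1)[OF assms(1,2)])
  have "act f (complex_of_real r *\<^sub>C x) = complex_of_real r *\<^sub>C act f x" for r x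
    by (rule hilbert_moduleD(5)[OF assms(1,2)])
  then show "act f (r *\<^sub>R x) = r *\<^sub>R act f x" for r x by (simp add: scaleC_of_real)
  show "norm (act f x) \<le> norm x * C" for x using assms(3)[of x] by (simp add: mult.commute)
qed

section \<open>From inner functions to the whole algebra\<close>

text \<open>
  With \<open>b = M a\<^sup>*\<close>, where \<open>a\<^sup>*\<close> is the conjugate of \<open>a\<close>, the denominator is \<open>c M\<close> times the conjugate
  of the numerator.
\<close>

lemma reflected_coordinate_inner:
  fixes a b M c :: complex and \<epsilon> :: real
  assumes M: "norm M = 1" and c: "norm c = 1" and ab: "cnj a * M = b"
    and ne: "1 + c * \<epsilon> * b \<noteq> 0"
  shows "norm ((\<epsilon> * a + c * M) * inverse (1 + c * \<epsilon> * b)) = 1"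
proof -
  have "M * cnj M = 1" "c * cnj c = 1" using M c by (simp_all add: complex_norm_square[symmetric])
  then have "1 + c * \<epsilon> * b = c * M * cnj (\<epsilon> * a + c * M)"
    by (simp add: ab[symmetric] algebra_simps)
  then have eq: "norm (\<epsilon> * a + c * M) = norm (1 + c * \<epsilon> * b)"
    using M c by (simp only: norm_mult complex_mod_cnj mult_1)
  have "norm (1 + c * \<epsilon> * b) \<noteq> 0" using ne by simp
  then show ?thesis unfolding norm_mult norm_inverse eq by (rule right_inverse)
qed

text \<open>
  A bounded real linear map that commutes with the action of all inner functions.  The aim is
  \<open>module_map_gamma\<close>: it is a module map.
\<close>

locale intertwined_modules =
  fixes m t :: nat
    and actK :: "(('n::{finite,linorder}) cspace \<Rightarrow> complex) \<Rightarrow> 'k \<Rightarrow> 'k::complex_hilbert"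
    and actP :: "('n cspace \<Rightarrow> complex) \<Rightarrow> 'p \<Rightarrow> 'p::complex_hilbert"
    and \<gamma> :: "'p \<Rightarrow> 'k"
  assumes mt: "m > 0" "t > 0" "t dvd m"
    and modK: "hilbert_module (closure (theta_domain m t)) (theta_algebra m t) actK"
    and modP: "hilbert_module (closure (theta_domain m t)) (theta_algebra m t) actP"
    and \<gamma>: "bounded_linear \<gamma>"
    and inner_function: "\<And>f p. f \<in> theta_algebra m t \<Longrightarrow> (\<And>w. w \<in> theta m t ` torus \<Longrightarrow> norm (f w) = 1) \<Longrightarrow>
        actK f (\<gamma> p) = \<gamma> (actP f p)"
begin

abbreviation X :: "'n cspace set" where "X \<equiv> closure (theta_domain m t)"
abbreviation A :: "('n cspace \<Rightarrow> complex) set" where "A \<equiv> theta_algebra m t"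

definition intertwined :: "('n cspace \<Rightarrow> complex) set" where
  "intertwined = {f \<in> A. \<forall>p. actK f (\<gamma> p) = \<gamma> (actP f p)}"

sublocale \<gamma>: bounded_linear \<gamma> by (rule \<gamma>)

lemma torus_in_X: "theta m t ` torus \<subseteq> X"
  unfolding closure_theta_domain by (auto simp: torus_def closed_polydisc_def)

lemma restrict_const: "restrict_fun X (\<lambda>w. c) \<in> A"
  by (intro restrict_fun_in_theta_algebra holomorphic_several_const continuous_intros)

text \<open>
  Unimodular constants are inner functions, and every complex number is a real multiple of one.
\<close>

lemma gamma_scaleC: "\<gamma> (c *\<^sub>C p) = c *\<^sub>C \<gamma> p"
proof -
  have unit: "\<gamma> (u *\<^sub>C p) = u *\<^sub>C \<gamma> p" if u: "norm u = 1" for u p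
  proof -
    have "restrict_fun X (\<lambda>w. 1) = indicator X" by (auto simp: restrict_fun_def fun_eq_iff)
    then have one: "indicator X \<in> A" using restrict_const[of 1] by simp
    have "actK (\<lambda>w. u * indicator X w) (\<gamma> p) = \<gamma> (actP (\<lambda>w. u * indicator X w) p)"
    proof (rule inner_function)
      show "norm (u * indicator X w) = 1" if "w \<in> theta m t ` torus" for w
        using that torus_in_X u by (auto simp: indicator_def)
    qed (rule theta_algebra_cmult[OF one])
    then show ?thesis
      by (simp add: hilbert_moduleD(4)[OF modK one] hilbert_moduleD(4)[OF modP one]
          hilbert_moduleD(6)[OF modK] hilbert_moduleD(6)[OF modP])
  qed
  show ?thesis
  proof (cases "c = 0")
    case True
    have "0 *\<^sub>C x = 0" for x :: 'p using scaleC_of_real[of 0 x] by simp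
    moreover have "0 *\<^sub>C x = 0" for x :: 'k using scaleC_of_real[of 0 x] by simp
    ultimately show ?thesis using True by (simp add: \<gamma>.zero)
  next
    case False
    have c: "c = complex_of_real (norm c) * sgn c" by (simp add: sgn_eq)
    have "\<gamma> (complex_of_real (norm c) *\<^sub>C (sgn c *\<^sub>C p)) = complex_of_real (norm c) *\<^sub>C (sgn c *\<^sub>C \<gamma> p)"
      unfolding scaleC_of_real \<gamma>.scaleR using False by (simp add: unit norm_sgn)
    then show ?thesis unfolding scaleC_scaleC c[symmetric] .
  qed
qed

lemma intertwined_inner_function:
  "f \<in> A \<Longrightarrow> (\<And>w. w \<in> theta m t ` torus \<Longrightarrow> norm (f w) = 1) \<Longrightarrow> f \<in> intertwined"
  by (simp add: intertwined_def inner_function)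

lemma intertwined_add: "f \<in> intertwined \<Longrightarrow> g \<in> intertwined \<Longrightarrow> (\<lambda>w. f w + g w) \<in> intertwined"
  by (auto simp: intertwined_def theta_algebra_add hilbert_moduleD(2)[OF modK] hilbert_moduleD(2)[OF modP] \<gamma>.add)

lemma intertwined_mult: "f \<in> intertwined \<Longrightarrow> g \<in> intertwined \<Longrightarrow> (\<lambda>w. f w * g w) \<in> intertwined"
  by (auto simp: intertwined_def theta_algebra_mult hilbert_moduleD(3)[OF modK] hilbert_moduleD(3)[OF modP])

lemma intertwined_cmult: "f \<in> intertwined \<Longrightarrow> (\<lambda>w. c * f w) \<in> intertwined"
  by (auto simp: intertwined_def theta_algebra_cmult hilbert_moduleD(4)[OF modK] hilbert_moduleD(4)[OF modP] gamma_scaleC)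

lemma intertwined_closed:
  assumes f: "f \<in> A" and lim: "\<And>\<epsilon>. \<epsilon> > 0 \<Longrightarrow> \<exists>g\<in>intertwined. \<forall>w\<in>X. norm (f w - g w) \<le> \<epsilon>"
  shows "f \<in> intertwined"
proof -
  have off: "f w = 0" if "f \<in> A" "w \<notin> X" for f w
    using theta_algebraD(3)[OF that(1)] that(2) by (simp add: closure_theta_domain)
  obtain CK where CK: "CK \<ge> 0"
    "\<forall>f\<in>A. \<forall>M>0. (\<forall>x\<in>X. norm (f x) \<le> M) \<longrightarrow> (\<forall>h. norm (actK f h) \<le> CK * M * norm h)"
    by (rule hilbert_module_bounded[OF modK])
      (rule theta_algebra_cmult, assumption, rule off, assumption, assumption, rule that)
  obtain CP where CP: "CP \<ge> 0"
    "\<forall>f\<in>A. \<forall>M>0. (\<forall>x\<in>X. norm (f x) \<le> M) \<longrightarrow> (\<forall>h. norm (actP f h) \<le> CP * M * norm h)"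
    by (rule hilbert_module_bounded[OF modP])
      (rule theta_algebra_cmult, assumption, rule off, assumption, assumption, rule that)
  obtain N where N: "\<And>p. norm (\<gamma> p) \<le> norm p * N" "N > 0" using \<gamma>.pos_bounded by blast
  have "actK f (\<gamma> p) = \<gamma> (actP f p)" for p
  proof -
    define L where "L = CK * norm (\<gamma> p) + CP * norm p * N"
    have "norm (actK f (\<gamma> p) - \<gamma> (actP f p)) \<le> 0 + e" if e: "e > 0" for e
    proof -
      have "L \<ge> 0" using CK(1) CP(1) N(2) by (simp add: L_def)
      define \<epsilon> where "\<epsilon> = e / (L + 1)"
      have \<epsilon>: "\<epsilon> > 0" using e \<open>L \<ge> 0\<close> by (simp add: \<epsilon>_def)
      then obtain g where g: "g \<in> intertwined" "\<And>w. w \<in> X \<Longrightarrow> norm (f w - g w) \<le> \<epsilon>" using lim by blast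
      define h where "h = (\<lambda>w. f w + (-1) * g w)"
      have gA: "g \<in> A" using g(1) by (simp add: intertwined_def)
      have h: "h \<in> A" unfolding h_def by (rule theta_algebra_add[OF f theta_algebra_cmult[OF gA]])
      have hle: "norm (h w) \<le> \<epsilon>" if "w \<in> X" for w using g(2)[OF that] by (simp add: h_def)
      have f_eq: "f = (\<lambda>w. h w + g w)" by (simp add: h_def)
      have "actK f (\<gamma> p) - \<gamma> (actP f p) = actK h (\<gamma> p) - \<gamma> (actP h p)"
        using g(1) unfolding f_eq hilbert_moduleD(2)[OF modK h gA] hilbert_moduleD(2)[OF modP h gA] \<gamma>.add
        by (simp add: intertwined_def)
      also have "norm \<dots> \<le> norm (actK h (\<gamma> p)) + norm (\<gamma> (actP h p))" by (rule norm_triangle_ineq4)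
      also have "\<dots> \<le> CK * \<epsilon> * norm (\<gamma> p) + (CP * \<epsilon> * norm p) * N"
        using CK(2)[rule_format, OF h \<epsilon> hle, of "\<gamma> p"] N(1)[of "actP h p"] mult_right_mono[OF CP(2)[rule_format, OF h \<epsilon> hle, of p], of N] N(2)
        by linarith
      also have "\<dots> = \<epsilon> * L" by (simp add: L_def algebra_simps)
      also have "\<dots> \<le> e" using e \<open>L \<ge> 0\<close> by (simp add: \<epsilon>_def field_simps)
      finally show ?thesis by simp
    qed
    then have "norm (actK f (\<gamma> p) - \<gamma> (actP f p)) \<le> 0" by (rule field_le_epsilon)
    then show ?thesis by simp
  qed
  then show ?thesis using f by (simp add: intertwined_def)
qed

lemma compact_X: "compact X"
  unfolding closure_theta_domain
  by (intro compact_continuous_image continuous_on_theta compact_closed_polydisc)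

lemma restrict_coord: "restrict_fun X (\<lambda>w. w $ i) \<in> A"
  by (intro restrict_fun_in_theta_algebra holomorphic_several_coord continuous_intros)

lemma intertwined_last_coord:
  fixes i :: 'n
  assumes "coord_index i = CARD('n)"
  shows "restrict_fun X (\<lambda>w. w $ i) \<in> intertwined"
proof (rule intertwined_inner_function[OF restrict_coord])
  fix w :: "'n cspace" assume w: "w \<in> theta m t ` torus"
  then show "norm (restrict_fun X (\<lambda>w. w $ i) w) = 1"
    using torus_in_X theta_torus_last[OF _ assms] by (auto simp: restrict_fun_def)
qed

text \<open>
  The function is the derivative at \<open>\<epsilon> = 0\<close> of the inner functions
  \<open>\<phi> = (\<epsilon> w\<^sub>i + c w\<^sub>e\<^sup>t) / (1 + c \<epsilon> w\<^bsub>i'\<^esub>)\<close>: the difference quotient \<open>(\<phi> - c w\<^sub>e\<^sup>t) / \<epsilon>\<close> equals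
  \<open>(w\<^sub>i - c\<^sup>2 w\<^sub>e\<^sup>t w\<^bsub>i'\<^esub>) / (1 + c \<epsilon> w\<^bsub>i'\<^esub>)\<close> and converges uniformly on the compact set \<open>X\<close>.
\<close>

lemma intertwined_coord_difference:
  fixes i i' e :: 'n
  assumes i: "coord_index i < CARD('n)" and i': "coord_index i' = CARD('n) - coord_index i"
    and e: "coord_index e = CARD('n)" and c: "norm c = 1"
  shows "restrict_fun X (\<lambda>w. w $ i - c\<^sup>2 * (w $ e) ^ t * w $ i') \<in> intertwined"
proof (rule intertwined_closed)
  define G where "G w = w $ i - c\<^sup>2 * (w $ e) ^ t * w $ i'" for w :: "'n cspace"
  have contG: "continuous_on X G" unfolding G_def by (intro continuous_intros)
  have holpow: "holomorphic_several (\<lambda>w. (w $ e) ^ k) W" for k W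
    by (induction k) (auto intro: holomorphic_several_const holomorphic_several_mult holomorphic_several_coord)
  have "holomorphic_several (\<lambda>w. w $ i + (- c\<^sup>2) * ((w $ e) ^ t * w $ i')) (theta_domain m t)"
    by (intro holomorphic_several_add holomorphic_several_mult holomorphic_several_const holomorphic_several_coord holpow)
  then have "holomorphic_several G (theta_domain m t)" by (simp add: G_def[abs_def] mult.assoc)
  with contG show "restrict_fun X (\<lambda>w. w $ i - c\<^sup>2 * (w $ e) ^ t * w $ i') \<in> A"
    unfolding G_def[symmetric] by (intro restrict_fun_in_theta_algebra)
  have power_intertwined: "restrict_fun X (\<lambda>w. (w $ e) ^ t) \<in> intertwined"
  proof -
    have "restrict_fun X (\<lambda>w. (w $ e) ^ k) \<in> intertwined" if "k > 0" for k
      using that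
    proof (induction k rule: nat_induct_non_zero)
      case 1
      then show ?case using intertwined_last_coord[OF e] by simp
    next
      case (Suc k)
      have "(\<lambda>w. restrict_fun X (\<lambda>w. w $ e) w * restrict_fun X (\<lambda>w. (w $ e) ^ k) w)
          = restrict_fun X (\<lambda>w. (w $ e) ^ Suc k)" by (auto simp: restrict_fun_def fun_eq_iff)
      then show ?case using intertwined_mult[OF intertwined_last_coord[OF e] Suc.IH] by simp
    qed
    then show ?thesis using mt by simp
  qed
  have "compact (G ` X)" by (intro compact_continuous_image contG compact_X)
  then obtain K1 where K1: "K1 > 0" "\<And>w. w \<in> X \<Longrightarrow> norm (G w) \<le> K1"
    using compact_imp_bounded[of "G ` X"] unfolding bounded_pos by auto
  obtain K2 where K2: "K2 > 0" "\<And>w. w \<in> X \<Longrightarrow> norm w \<le> K2"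
    using compact_imp_bounded[OF compact_X] unfolding bounded_pos by auto
  have coord: "norm (w $ i') \<le> K2" if "w \<in> X" for w
    using K2(2)[OF that] Finite_Cartesian_Product.norm_nth_le[of w i'] by linarith
  fix \<eta> :: real assume \<eta>: "\<eta> > 0"
  \<comment> \<open>The first bound keeps the denominator away from zero, the second makes the error at most \<open>\<eta>\<close>.\<close>
  define \<epsilon> where "\<epsilon> = min (1 / (2 * K2)) (\<eta> / (2 * K1 * K2))"
  have \<epsilon>: "\<epsilon> > 0" using K1(1) K2(1) \<eta> by (simp add: \<epsilon>_def)
  have \<epsilon>K: "\<epsilon> * K2 \<le> 1 / 2" using K2(1) by (auto simp: \<epsilon>_def min_def field_simps)
  have \<epsilon>\<eta>: "2 * K1 * (\<epsilon> * K2) \<le> \<eta>" using K1(1) K2(1) by (auto simp: \<epsilon>_def min_def field_simps)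
  define D where "D w = 1 + c * \<epsilon> * w $ i'" for w :: "'n cspace"
  have small: "norm (c * \<epsilon> * w $ i') \<le> \<epsilon> * K2" if "w \<in> X" for w :: "'n cspace"
    using coord[OF that] \<epsilon> c by (simp add: norm_mult)
  have D: "norm (D w) \<ge> 1 / 2" if "w \<in> X" for w
    using norm_diff_ineq[of 1 "c * \<epsilon> * w $ i'"] small[OF that] \<epsilon>K by (simp add: D_def)
  then have D0: "D w \<noteq> 0" if "w \<in> X" for w using that by fastforce
  define \<phi> where "\<phi> w = (\<epsilon> * w $ i + c * (w $ e) ^ t) * inverse (D w)" for w :: "'n cspace"
  have "restrict_fun X \<phi> \<in> intertwined"
  proof (rule intertwined_inner_function)
    have "continuous_on X \<phi>" unfolding \<phi>_def D_def
      using D0 by (intro continuous_intros) (auto simp: D_def)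
    moreover have "holomorphic_several \<phi> (theta_domain m t)"
      unfolding \<phi>_def[abs_def]
    proof (intro holomorphic_several_mult holomorphic_several_inverse holomorphic_several_add
          holomorphic_several_const holomorphic_several_coord holpow)
      show "holomorphic_several D (theta_domain m t)" unfolding D_def[abs_def]
        by (intro holomorphic_several_mult holomorphic_several_add holomorphic_several_const holomorphic_several_coord)
    qed (use D0 closure_subset in blast)
    ultimately show "restrict_fun X \<phi> \<in> A" by (rule restrict_fun_in_theta_algebra)
    fix w :: "'n cspace" assume "w \<in> theta m t ` torus"
    then obtain z where z: "z \<in> torus" "w = theta m t z" by auto
    then have wX: "w \<in> X" using torus_in_X by auto
    have "norm (\<phi> w) = 1"
      unfolding \<phi>_def D_def
    proof (rule reflected_coordinate_inner[OF _ c])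
      show "norm ((w $ e) ^ t) = 1" using theta_torus_last[OF z(1) e] by (simp add: z norm_power)
      show "cnj (w $ i) * (w $ e) ^ t = w $ i'" unfolding z(2) by (rule theta_torus_conj[OF mt(3) z(1) i i' e])
      show "1 + c * \<epsilon> * w $ i' \<noteq> 0" using D0[OF wX] by (simp add: D_def)
    qed
    then show "norm (restrict_fun X \<phi> w) = 1" using wX by (simp add: restrict_fun_def)
  qed
  then have "(\<lambda>w. complex_of_real (1 / \<epsilon>) * (restrict_fun X \<phi> w + (- c) * restrict_fun X (\<lambda>w. (w $ e) ^ t) w)) \<in> intertwined"
    by (intro intertwined_cmult intertwined_add power_intertwined)
  then show "\<exists>g\<in>intertwined. \<forall>w\<in>X. norm (restrict_fun X (\<lambda>w. w $ i - c\<^sup>2 * (w $ e) ^ t * w $ i') w - g w) \<le> \<eta>"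
  proof (rule bexI[rotated], intro ballI)
    fix w assume w: "w \<in> X"
    have "complex_of_real (1 / \<epsilon>) * (\<phi> w + (- c) * (w $ e) ^ t) = G w / D w"
    proof -
      have "\<phi> w + (- c) * (w $ e) ^ t = (\<epsilon> * w $ i + c * (w $ e) ^ t - c * (w $ e) ^ t * D w) / D w"
        using D0[OF w] by (simp add: \<phi>_def field_simps)
      also have "\<epsilon> * w $ i + c * (w $ e) ^ t - c * (w $ e) ^ t * D w = \<epsilon> * G w"
        by (simp add: D_def G_def algebra_simps power2_eq_square)
      finally show ?thesis using \<epsilon> by simp
    qed
    then have "restrict_fun X (\<lambda>w. w $ i - c\<^sup>2 * (w $ e) ^ t * w $ i') w
        - complex_of_real (1 / \<epsilon>) * (restrict_fun X \<phi> w + (- c) * restrict_fun X (\<lambda>w. (w $ e) ^ t) w)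
        = G w - G w / D w"
      using w by (simp only: restrict_fun_def if_True G_def)
    also have "\<dots> = G w * (c * \<epsilon> * w $ i') / D w" using D0[OF w] by (simp add: D_def field_simps)
    also have "norm \<dots> \<le> K1 * (\<epsilon> * K2) / (1 / 2)"
      unfolding norm_divide norm_mult[of "G w"]
      using K1 w small[OF w] D[OF w] \<epsilon> K2(1) by (intro frac_le mult_mono mult_nonneg_nonneg) auto
    also have "\<dots> \<le> \<eta>" using \<epsilon>\<eta> by simp
    finally show "norm (restrict_fun X (\<lambda>w. w $ i - c\<^sup>2 * (w $ e) ^ t * w $ i') w
        - complex_of_real (1 / \<epsilon>) * (restrict_fun X \<phi> w + (- c) * restrict_fun X (\<lambda>w. (w $ e) ^ t) w)) \<le> \<eta>" .
  qed
qed

text \<open>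
  The unwanted terms for \<open>c = 1\<close> and \<open>c = \<i>\<close> cancel, because \<open>c\<^sup>2\<close> takes the values \<open>1\<close> and \<open>-1\<close>.
\<close>

lemma intertwined_coord: "restrict_fun X (\<lambda>w. w $ i) \<in> intertwined"
proof (cases "coord_index i = CARD('n)")
  case True
  then show ?thesis by (rule intertwined_last_coord)
next
  case False
  then have i: "coord_index i < CARD('n)" "1 \<le> coord_index i"
    using coord_index_bounds[of i] by auto
  have "1 \<le> CARD('n) - coord_index i" "CARD('n) - coord_index i \<le> CARD('n)" using i by linarith+
  then obtain i' :: 'n where i': "coord_index i' = CARD('n) - coord_index i"
    by (rule coord_index_exists)
  have "1 \<le> CARD('n)" using i by linarith
  then obtain e :: 'n where e: "coord_index e = CARD('n)"
    by (rule coord_index_exists[OF _ order_refl])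
  have "(\<lambda>w. (1 / 2) * (restrict_fun X (\<lambda>w. w $ i - 1\<^sup>2 * (w $ e) ^ t * w $ i') w
      + restrict_fun X (\<lambda>w. w $ i - \<i>\<^sup>2 * (w $ e) ^ t * w $ i') w)) \<in> intertwined"
    by (intro intertwined_cmult intertwined_add intertwined_coord_difference[OF i(1) i' e]) auto
  also have "(\<lambda>w. (1 / 2) * (restrict_fun X (\<lambda>w. w $ i - 1\<^sup>2 * (w $ e) ^ t * w $ i') w
      + restrict_fun X (\<lambda>w. w $ i - \<i>\<^sup>2 * (w $ e) ^ t * w $ i') w)) = restrict_fun X (\<lambda>w. w $ i)"
    by (auto simp: restrict_fun_def fun_eq_iff)
  finally show ?thesis .
qed

lemma intertwined_poly_fun: "q \<in> poly_fun \<Longrightarrow> restrict_fun X q \<in> intertwined"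
proof (induction rule: poly_fun.induct)
  case (const c)
  have "restrict_fun X (\<lambda>w. 1) \<in> intertwined"
    by (rule intertwined_inner_function[OF restrict_const]) (use torus_in_X in \<open>auto simp: restrict_fun_def\<close>)
  from intertwined_cmult[OF this, of c] show ?case by (simp add: restrict_fun_def if_distrib cong: if_cong)
next
  case (coord i)
  show ?case by (rule intertwined_coord)
next
  case (add p q)
  have "restrict_fun X (\<lambda>w. p w + q w) = (\<lambda>w. restrict_fun X p w + restrict_fun X q w)"
    by (auto simp: restrict_fun_def)
  then show ?case using intertwined_add[OF add.IH] by simp
next
  case (mult p q)
  have "restrict_fun X (\<lambda>w. p w * q w) = (\<lambda>w. restrict_fun X p w * restrict_fun X q w)"
    by (auto simp: restrict_fun_def)
  then show ?case using intertwined_mult[OF mult.IH] by simp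
qed

lemma module_map_gamma: "module_map A actP actK \<gamma>"
proof -
  have "f \<in> intertwined" if f: "f \<in> A" for f
  proof (rule intertwined_closed[OF f])
    fix \<eta> :: real assume "\<eta> > 0"
    then obtain q where "q \<in> poly_fun" "\<And>w. w \<in> X \<Longrightarrow> norm (f w - q w) \<le> \<eta>"
      using poly_fun_dense[OF mt f] unfolding closure_theta_domain by metis
    then show "\<exists>g\<in>intertwined. \<forall>w\<in>X. norm (f w - g w) \<le> \<eta>"
      by (intro bexI[OF _ intertwined_poly_fun]) (auto simp: restrict_fun_def)
  qed
  then show ?thesis unfolding module_map_def bounded_clinear_def
    by (auto simp: \<gamma> gamma_scaleC intertwined_def)
qed

end

text \<open>
  On \<open>P\<close> the conjugate of an inner function acts, as the continuous function \<open>V f\<close> on the boundary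
  \<open>Y\<close>, and inverts the action of \<open>f\<close>; this is the only place where the module structure over the
  continuous functions enters.
\<close>

theorem theorem4:
  fixes m t :: nat
    and \<rho> :: "(('n::{finite,linorder}) cspace \<Rightarrow> 'n cspace) \<Rightarrow> complex"
    and l :: "'n cspace \<Rightarrow> complex"
    and act :: "('n cspace \<Rightarrow> complex) \<Rightarrow> 'p \<Rightarrow> 'p::complex_hilbert"
  assumes "m > 0" and "t > 0" and "t dvd m" and "CARD('n) > 1"
    and "\<rho> \<in> one_dim_reps m t"
    and "is_ell m t \<rho> l"
    and "normal_boundary_module m t l act"
  shows "projective_normal_module TYPE('h::complex_hilbert) TYPE('k::complex_hilbert)
           (theta_measure m t l) (closure (theta_domain m t)) (theta_algebra m t)
           (restricted_action (theta_boundary m t) act)"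
proof -
  define X where "X = closure (theta_domain m t :: 'n cspace set)"
  define A where "A = (theta_algebra m t :: ('n cspace \<Rightarrow> complex) set)"
  define Y where "Y = (theta_boundary m t :: 'n cspace set)"
  define actP where "actP = restricted_action Y act"
  have modY: "hilbert_module Y (cont_algebra Y) act"
    and normalP: "normal_module (theta_measure m t l) X A actP"
    using assms(7) by (simp_all add: normal_boundary_module_def Y_def X_def A_def actP_def)
  have modP: "hilbert_module X A actP" using normalP by (simp add: normal_module_def)
  have Y_torus: "Y \<subseteq> theta m t ` torus" unfolding Y_def by (rule theta_boundary_subset)
  have torus_X: "theta m t ` torus \<subseteq> X"
    unfolding X_def closure_theta_domain by (auto simp: torus_def closed_polydisc_def)
  have "\<exists>\<gamma>. module_map A actP actK \<gamma> \<and> (\<forall>p. \<beta> (\<gamma> p) = p)"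
    if K: "normal_module (theta_measure m t l) X A actK"
      and \<beta>: "module_map A actK actP \<beta>" "surj \<beta>"
    for actK :: "('n cspace \<Rightarrow> complex) \<Rightarrow> 'k \<Rightarrow> 'k" and \<beta>
  proof -
    have modK: "hilbert_module X A actK" using K by (simp add: normal_module_def)
    define S where "S = {f \<in> A. \<forall>w\<in>theta m t ` torus. norm (f w) = 1}"
    define V where "V f = act (restrict_fun Y (\<lambda>w. cnj (f w)))" for f
    have A_cont: "continuous_on X f" "\<And>w. w \<notin> X \<Longrightarrow> f w = 0" if "f \<in> A" for f
      using theta_algebraD[of f m t] that by (auto simp: A_def X_def closure_theta_domain)
    have restr: "restrict_fun Y f \<in> cont_algebra Y" "restrict_fun Y (\<lambda>w. cnj (f w)) \<in> cont_algebra Y"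
      if "f \<in> A" for f
    proof -
      have "continuous_on Y f" using A_cont(1)[OF that] Y_torus torus_X by (meson continuous_on_subset subset_trans)
      then have "continuous_on Y (restrict_fun Y f)" "continuous_on Y (restrict_fun Y (\<lambda>w. cnj (f w)))"
        by (auto simp: restrict_fun_def intro!: continuous_intros cong: continuous_on_cong_simp)
      then show "restrict_fun Y f \<in> cont_algebra Y" "restrict_fun Y (\<lambda>w. cnj (f w)) \<in> cont_algebra Y"
        by (auto simp: cont_algebra_def restrict_fun_def)
    qed
    have A_cmult: "(\<lambda>x. c * f x) \<in> A" if "f \<in> A" for c f
      using that unfolding A_def by (rule theta_algebra_cmult)
    have cont_cmult: "(\<lambda>x. c * f x) \<in> cont_algebra Y" if "f \<in> cont_algebra Y" for c f
      using that by (auto simp: cont_algebra_def intro!: continuous_intros)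
    have cont_off: "f x = 0" if "f \<in> cont_algebra Y" "x \<notin> Y" for f x
      using that by (simp add: cont_algebra_def)
    obtain CK where CK: "\<forall>f\<in>A. \<forall>M>0. (\<forall>x\<in>X. norm (f x) \<le> M) \<longrightarrow> (\<forall>h. norm (actK f h) \<le> CK * M * norm h)"
      by (rule hilbert_module_bounded[OF modK])
        (rule A_cmult, assumption, rule A_cont(2), assumption, assumption, rule that)
    obtain CP where CP: "\<forall>f\<in>A. \<forall>M>0. (\<forall>x\<in>X. norm (f x) \<le> M) \<longrightarrow> (\<forall>h. norm (actP f h) \<le> CP * M * norm h)"
      by (rule hilbert_module_bounded[OF modP])
        (rule A_cmult, assumption, rule A_cont(2), assumption, assumption, rule that)
    obtain CY where CY: "\<forall>f\<in>cont_algebra Y. \<forall>M>0. (\<forall>x\<in>Y. norm (f x) \<le> M) \<longrightarrow> (\<forall>h. norm (act f h) \<le> CY * M * norm h)"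
      by (rule hilbert_module_bounded[OF modY])
        (rule cont_cmult, assumption, rule cont_off, assumption, assumption, rule that)
    have S_le: "norm (f x) \<le> 1" if f: "f \<in> S" and x: "x \<in> X" for f x
    proof -
      obtain b where "b \<in> theta m t ` torus" "\<And>w. w \<in> theta m t ` closed_polydisc \<Longrightarrow> norm (f w) \<le> norm (f b)"
        using theta_algebra_max_modulus[of f m t] f by (auto simp: S_def A_def)
      then show ?thesis using f x by (auto simp: S_def X_def closure_theta_domain)
    qed
    have S_A: "f \<in> A" if "f \<in> S" for f using that by (simp add: S_def)
    have TK: "norm (actK f h) \<le> CK * norm h" if "f \<in> S" for f h
      using CK[rule_format, OF S_A[OF that], of 1 h] S_le[OF that] by simp
    have TP: "norm (actP f h) \<le> CP * norm h" if "f \<in> S" for f h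
      using CP[rule_format, OF S_A[OF that], of 1 h] S_le[OF that] by simp
    have TV: "norm (V f h) \<le> CY * norm h" if "f \<in> S" for f h
    proof -
      have "norm (restrict_fun Y (\<lambda>w. cnj (f w)) x) \<le> 1" if "x \<in> Y" for x
        using that \<open>f \<in> S\<close> Y_torus by (auto simp: restrict_fun_def S_def)
      then show ?thesis using CY[rule_format, OF restr(2)[OF S_A[OF that]], of 1 h] by (simp add: V_def)
    qed
    have unit: "(\<lambda>w. restrict_fun Y f w * restrict_fun Y (\<lambda>w. cnj (f w)) w) = indicator Y"
      "(\<lambda>w. restrict_fun Y (\<lambda>w. cnj (f w)) w * restrict_fun Y f w) = indicator Y" if "f \<in> S" for f
    proof -
      have "f w * cnj (f w) = 1" if "w \<in> Y" for w
        using that \<open>f \<in> S\<close> Y_torus by (auto simp: S_def complex_norm_square[symmetric])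
      then show "(\<lambda>w. restrict_fun Y f w * restrict_fun Y (\<lambda>w. cnj (f w)) w) = indicator Y"
        "(\<lambda>w. restrict_fun Y (\<lambda>w. cnj (f w)) w * restrict_fun Y f w) = indicator Y"
        by (auto simp: restrict_fun_def fun_eq_iff indicator_def mult.commute)
    qed
    have lin_\<beta>: "bounded_linear \<beta>" and int_\<beta>: "\<And>f k. f \<in> A \<Longrightarrow> \<beta> (actK f k) = actP f (\<beta> k)"
      using \<beta>(1) by (auto simp: module_map_def bounded_clinear_def)
    obtain \<gamma> where \<gamma>: "bounded_linear \<gamma>" "\<And>p. \<beta> (\<gamma> p) = p"
      "\<And>f p. f \<in> S \<Longrightarrow> actK f (\<gamma> p) = \<gamma> (actP f p)"
    proof (rule intertwining_section[OF lin_\<beta> \<beta>(2), of S "\<lambda>f g w. f w * g w" actK CK actP V CY])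
      show "(\<lambda>w. f w * g w) \<in> S" if "f \<in> S" "g \<in> S" for f g
        using that by (auto simp: S_def A_def theta_algebra_mult norm_mult)
      show "(\<lambda>w. f w * g w) = (\<lambda>w. g w * f w)" for f g :: "'n cspace \<Rightarrow> complex" by (simp add: mult.commute)
      show "bounded_linear (actK f)" if "f \<in> S" for f
        by (rule hilbert_module_linear[OF modK S_A[OF that] TK[OF that]])
      show "actK (\<lambda>w. f w * g w) k = actK f (actK g k)" if "f \<in> S" "g \<in> S" for f g k
        by (rule hilbert_moduleD(3)[OF modK S_A S_A]) (use that in auto)
      show "bounded_linear (actP f)" if "f \<in> S" for f
        by (rule hilbert_module_linear[OF modP S_A[OF that] TP[OF that]])
      show "bounded_linear (V f)" if "f \<in> S" for f
        unfolding V_def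
        by (rule hilbert_module_linear[OF modY restr(2)[OF S_A[OF that]]]) (rule TV[OF that, unfolded V_def])
      show "V (\<lambda>w. f w * g w) p = V f (V g p)" if "f \<in> S" "g \<in> S" for f g p
      proof -
        have "restrict_fun Y (\<lambda>w. cnj (f w * g w))
            = (\<lambda>w. restrict_fun Y (\<lambda>w. cnj (f w)) w * restrict_fun Y (\<lambda>w. cnj (g w)) w)"
          by (auto simp: restrict_fun_def)
        then show ?thesis
          using hilbert_moduleD(3)[OF modY restr(2)[OF S_A] restr(2)[OF S_A]] that by (simp add: V_def)
      qed
      show "actP f (V f p) = p" "V f (actP f p) = p" if "f \<in> S" for f p
        using hilbert_moduleD(3)[OF modY restr(1)[OF S_A[OF that]] restr(2)[OF S_A[OF that]], of p]
          hilbert_moduleD(3)[OF modY restr(2)[OF S_A[OF that]] restr(1)[OF S_A[OF that]], of p]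
        by (simp_all add: unit[OF that] hilbert_moduleD(6)[OF modY] V_def actP_def restricted_action_def)
      show "\<beta> (actK f k) = actP f (\<beta> k)" if "f \<in> S" for f k by (rule int_\<beta>[OF S_A[OF that]])
    qed (auto intro: TK TV)
    have "intertwined_modules m t actK actP \<gamma>"
      unfolding intertwined_modules_def using assms(1-3) modK modP \<gamma>(1,3) by (simp add: X_def A_def S_def)
    then have "module_map A actP actK \<gamma>"
      unfolding A_def by (rule intertwined_modules.module_map_gamma)
    then show ?thesis using \<gamma>(2) by blast
  qed
  then show ?thesis
    using normalP unfolding projective_normal_module_def short_exact_def X_def A_def actP_def Y_def by blast
qed

end
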